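(* Let $h:\mathbb R^d\to\mathbb R$ be a fixed deterministic function and $t\ge0$. For any numerical constants $c_\ell>1$, $\epsilon>0$ and $c_0>0$ such that $ec_0>2(4/3+\epsilon)c_\ell$, the following holds for any $x>0$: $$\mathbb P\Bigg[|Z_t(h)|\ge c_1\sqrt{\frac{x+\hat\ell_{n,x}(h)}{n}\hat V_t(h)}+c_2\frac{x+1+\hat\ell_{n,x}(h)}{n}\|h\|_{n,\infty}\Bigg]\le c_3e^{-x},$$ where $\|h\|_{n,\infty}=\max_{1\le i\le n}|h(X_i)|$, $$\hat\ell_{n,x}(h)=c_\ell\log\log\Big(\frac{2en\hat V_t(h)+8e(4/3+\epsilon)x\|h\|_{n,\infty}^2}{4(ec_0-2(4/3+\epsilon)c_\ell)\|h\|_{n,\infty}^2}\vee e\Big),$$ $$c_1=2\sqrt{1+\epsilon},\quad c_2=2\sqrt{2\max\big(c_0,2(1+\epsilon)(4/3+\epsilon)\big)}+2/3,\quad c_3=8+6(\log(1+\epsilon))^{-c_\ell}\sum_{j\ge1}j^{-c_\ell}.$$ Moreover, for $c_\ell=2$, $\epsilon=1$, $c_0=56/(3e)$, the inequality holds with $c_1=2\sqrt2$, $c_2=4\sqrt{14/3}+2/3$ ($\le 9.31$), $c_3=28.55$ and $$\hat\ell_{n,x}(h)=2\log\log\Big(\frac{2en\hat V_t(h)+56ex\|h\|_{n,\infty}^2/3}{8\|h\|_{n,\infty}^2}\vee e\Big).$$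
   Context: Setting. $(\Omega,\mathcal F,\mathbb P)$ is a probability space with a filtration $(\mathcal F_t)_{t\ge0}$ satisfying the usual conditions. For $i=1,\dots,n$, $(X_i,N^i,Y^i)$ are i.i.d. copies of $(X,N,Y)$, where $X\in\mathbb R^d$ is an $\mathcal F_0$-measurable random vector, $Y$ is a predictable process with values in $[0,1]$, and $N$ is a counting process with $N_0=0$ whose compensator is $\int_0^t\alpha_0(s,X)Y_s\,ds$ for an unknown deterministic nonnegative function $\alpha_0$. Thus $M^i_t=N^i_t-\int_0^t\alpha_0(s,X_i)Y^i_s\,ds$ are independent $(\mathcal F_t)$-martingales with jumps of size $1$. Notation. $\bar h_Y(s)=\sum_{i=1}^nh(X_i)Y^i_s\big/\sum_{i=1}^nY^i_s$. The noise process is $$Z_t(h)=\frac1n\sum_{i=1}^n\int_0^t(h(X_i)-\bar h_Y(s))\,dM^i_s,$$ and its (observable) optional-variation term is $$\hat V_t(h)=\frac1n\sum_{i=1}^n\int_0^t(h(X_i)-\bar h_Y(s))^2\,dN^i_s .$$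
   Formalization: The event is restricted to ‖h‖_{n,∞} > 0, since for ‖h‖_{n,∞} = 0 (e.g. h = 0) the ratio in ℓ̂ is 0/0 and the inequality 0 ≥ 0 always holds, so the bound fails for large x; the numerical remark c₂ ≤ 9.31 is not stated. *)

theory Defs
  imports "HOL-Probability.Probability"
begin

definition filtration :: "'a measure \<Rightarrow> (real \<Rightarrow> 'a measure) \<Rightarrow> bool" where
  "filtration M F \<longleftrightarrow>
     (\<forall>t\<ge>0. subalgebra M (F t)) \<and>
     (\<forall>s t. 0 \<le> s \<longrightarrow> s \<le> t \<longrightarrow> sets (F s) \<subseteq> sets (F t))"

definition usual_conditions :: "'a measure \<Rightarrow> (real \<Rightarrow> 'a measure) \<Rightarrow> bool" where
  "usual_conditions M F \<longleftrightarrow>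
     filtration M F \<and> complete_measure M \<and> null_sets M \<subseteq> sets (F 0) \<and>
     (\<forall>t\<ge>0. sets (F t) = (\<Inter>u\<in>{t<..}. sets (F u)))"

definition adapted :: "(real \<Rightarrow> 'a measure) \<Rightarrow> (real \<Rightarrow> 'a \<Rightarrow> real) \<Rightarrow> bool" where
  "adapted F Z \<longleftrightarrow> (\<forall>t\<ge>0. Z t \<in> borel_measurable (F t))"

definition predictable_sigma :: "'a measure \<Rightarrow> (real \<Rightarrow> 'a measure) \<Rightarrow> (real \<times> 'a) measure" where
  "predictable_sigma M F = sigma ({0..} \<times> space M)
     ({{0} \<times> A | A. A \<in> sets (F 0)} \<union>
      {{s<..t} \<times> A | s t A. 0 \<le> s \<and> s \<le> t \<and> A \<in> sets (F s)})"

definition predictable :: "'a measure \<Rightarrow> (real \<Rightarrow> 'a measure) \<Rightarrow> (real \<Rightarrow> 'a \<Rightarrow> real) \<Rightarrow> bool" where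
  "predictable M F Y \<longleftrightarrow> (\<lambda>(t, \<omega>). Y t \<omega>) \<in> borel_measurable (predictable_sigma M F)"

definition martingale :: "'a measure \<Rightarrow> (real \<Rightarrow> 'a measure) \<Rightarrow> (real \<Rightarrow> 'a \<Rightarrow> real) \<Rightarrow> bool" where
  "martingale M F Z \<longleftrightarrow>
     adapted F Z \<and> (\<forall>t\<ge>0. integrable M (Z t)) \<and>
     (\<forall>s t A. 0 \<le> s \<longrightarrow> s \<le> t \<longrightarrow> A \<in> sets (F s) \<longrightarrow>
        (LINT \<omega>:A|M. Z t \<omega>) = (LINT \<omega>:A|M. Z s \<omega>))"

definition counting_path :: "(real \<Rightarrow> real) \<Rightarrow> bool" where
  "counting_path f \<longleftrightarrow>
     f 0 = 0 \<and> mono_on {0..} f \<and> (\<forall>t\<ge>0. f t \<in> \<nat>) \<and>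
     (\<forall>t\<ge>0. continuous (at_right t) f) \<and>
     (\<forall>t>0. \<exists>j\<in>{0,1}. (f \<longlongrightarrow> f t - j) (at_left t))"

definition counting_process :: "(real \<Rightarrow> 'a measure) \<Rightarrow> 'a measure \<Rightarrow> (real \<Rightarrow> 'a \<Rightarrow> real) \<Rightarrow> bool" where
  "counting_process F M N \<longleftrightarrow> adapted F N \<and> (\<forall>\<omega>\<in>space M. counting_path (\<lambda>t. N t \<omega>))"

definition cp_integral :: "(real \<Rightarrow> real) \<Rightarrow> (real \<Rightarrow> real) \<Rightarrow> real \<Rightarrow> real" where
  "cp_integral f g t = (LINT s:{0<..t}|interval_measure (\<lambda>s. f (max 0 s)). g s)"

definition hbarY :: "('x \<Rightarrow> real) \<Rightarrow> nat \<Rightarrow> (nat \<Rightarrow> 'a \<Rightarrow> 'x) \<Rightarrow> (nat \<Rightarrow> real \<Rightarrow> 'a \<Rightarrow> real)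
    \<Rightarrow> real \<Rightarrow> 'a \<Rightarrow> real" where
  "hbarY h n X Y s \<omega> = (\<Sum>i\<in>{1..n}. h (X i \<omega>) * Y i s \<omega>) / (\<Sum>i\<in>{1..n}. Y i s \<omega>)"

text \<open>Z_t(h) = (1/n) \<Sum>_i \<integral>_0^t (h(X_i) - hbar_Y(s)) dM^i_s, with dM^i_s = dN^i_s - \<alpha>0(s,X_i) Y^i_s ds.\<close>
definition Zt :: "(real \<Rightarrow> 'x \<Rightarrow> real) \<Rightarrow> ('x \<Rightarrow> real) \<Rightarrow> nat \<Rightarrow> (nat \<Rightarrow> 'a \<Rightarrow> 'x)
    \<Rightarrow> (nat \<Rightarrow> real \<Rightarrow> 'a \<Rightarrow> real) \<Rightarrow> (nat \<Rightarrow> real \<Rightarrow> 'a \<Rightarrow> real) \<Rightarrow> real \<Rightarrow> 'a \<Rightarrow> real" where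
  "Zt \<alpha>0 h n X N Y t \<omega> = (1 / real n) * (\<Sum>i\<in>{1..n}.
      cp_integral (\<lambda>s. N i s \<omega>) (\<lambda>s. h (X i \<omega>) - hbarY h n X Y s \<omega>) t
      - (LINT s:{0..t}|lborel. (h (X i \<omega>) - hbarY h n X Y s \<omega>) * (\<alpha>0 s (X i \<omega>) * Y i s \<omega>)))"

definition Vhat :: "('x \<Rightarrow> real) \<Rightarrow> nat \<Rightarrow> (nat \<Rightarrow> 'a \<Rightarrow> 'x)
    \<Rightarrow> (nat \<Rightarrow> real \<Rightarrow> 'a \<Rightarrow> real) \<Rightarrow> (nat \<Rightarrow> real \<Rightarrow> 'a \<Rightarrow> real) \<Rightarrow> real \<Rightarrow> 'a \<Rightarrow> real" where
  "Vhat h n X N Y t \<omega> = (1 / real n) * (\<Sum>i\<in>{1..n}.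
      cp_integral (\<lambda>s. N i s \<omega>) (\<lambda>s. (h (X i \<omega>) - hbarY h n X Y s \<omega>)\<^sup>2) t)"

definition hnorm_n :: "('x \<Rightarrow> real) \<Rightarrow> nat \<Rightarrow> (nat \<Rightarrow> 'a \<Rightarrow> 'x) \<Rightarrow> 'a \<Rightarrow> real" where
  "hnorm_n h n X \<omega> = Max ((\<lambda>i. \<bar>h (X i \<omega>)\<bar>) ` {1..n})"

definition path_space :: "(real \<Rightarrow> real) measure" where
  "path_space = PiM UNIV (\<lambda>_. borel)"

end

theory Submission
  imports Defs
begin

text \<open>Put \<open>W = n Z / \<parallel>h\<parallel>\<close> and \<open>Q = n V / \<parallel>h\<parallel>\<^sup>2\<close>, so that the integrands \<open>H\<close> are predictable and
  bounded by \<open>2\<close>. Independence excludes common jumps of the counting processes, and therefore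
  \<open>exp (\<Sum> (\<integral> G dN - \<integral> (exp G - 1) d\<Lambda>))\<close> has expectation at most \<open>1\<close> for bounded predictable \<open>G\<close>.
  With \<open>G = ln (1 \<plusminus> l H)\<close> the compensator term is exactly linear in \<open>H\<close>, and
  \<open>ln (1 + u) \<ge> u - u\<^sup>2 / (2 (1 - 2 l))\<close> bounds the jump term from below by the observable quantity
  \<open>Q\<close>. Thus \<open>\<plusminus>W\<close> is sub-gamma on \<open>{Q \<le> v}\<close> with variance factor \<open>v\<close> and scale \<open>2\<close>, without passing
  through the predictable variation. Peeling over the slices
  \<open>2 c\<^sub>0 (1 + \<epsilon>)\<^sup>j < Q \<le> 2 c\<^sub>0 (1 + \<epsilon>)\<^sup>j\<^sup>+\<^sup>1\<close> costs the iterated logarithm and the sum in the constant.\<close>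

text \<open>Two obstacles shape the proof. First, only the difference of a counting process and its
  compensator is integrable, so a whole stochastic integral cannot be compensated at once. Each jump
  time is treated on its own: the indicator of one jump is bounded, optional stopping across one
  interjump interval compensates it over rectangles, and a generator argument extends this to
  predictable integrands. Second, common jumps would spoil the exponential: at a simultaneous jump
  of \<open>i\<close> and \<open>j\<close>, \<open>exp (G i + G j) - 1\<close> is not the sum of
  \<open>exp (G i) - 1\<close> and \<open>exp (G j) - 1\<close>, which is what the compensator
  accounts for. Compensators that are integrals against Lebesgue measure leave the law of a jump
  time without atoms on [0, t], and of two independent times with that property no coincidence in
  [0, t] has positive probability. The constants have room: both signs and all slices together cost
  4 + 2 S, where the statement allows 8 + 6 S, with S the series multiplied by the power of ln (1 +
  \<epsilon>).\<close>

section \<open>Jump times of a counting path\<close>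

text \<open>The infimum is capped at the horizon \<open>K\<close>, so that it is always finite; the value
  \<open>K\<close> also stands for ``no \<open>m\<close>-th jump before \<open>K\<close>''.\<close>

definition jump_time :: "real \<Rightarrow> (real \<Rightarrow> real) \<Rightarrow> nat \<Rightarrow> real" where
  "jump_time K f m = Inf ({s\<in>{0..K}. real m \<le> f s} \<union> {K})"

lemma jump_time_bounds:
  assumes "0 \<le> K"
  shows "0 \<le> jump_time K f m" "jump_time K f m \<le> K"
proof -
  have bdd: "bdd_below ({s\<in>{0..K}. real m \<le> f s} \<union> {K})"
    by (intro bdd_belowI[of _ 0]) (use assms in auto)
  show "0 \<le> jump_time K f m"
    unfolding jump_time_def by (rule cInf_greatest) (use assms in auto)
  show "jump_time K f m \<le> K"
    unfolding jump_time_def by (rule cInf_lower[OF _ bdd]) auto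
qed

lemma counting_path_mono:
  "counting_path f \<Longrightarrow> 0 \<le> a \<Longrightarrow> a \<le> b \<Longrightarrow> f a \<le> f b"
  by (auto simp: counting_path_def mono_on_def)

lemma counting_path_nat:
  assumes "counting_path f" "0 \<le> s"
  obtains k :: nat where "f s = real k"
  using assms by (auto simp: counting_path_def Nats_def)

lemma counting_path_right:
  "counting_path f \<Longrightarrow> 0 \<le> s \<Longrightarrow> (f \<longlongrightarrow> f s) (at_right s)"
  by (auto simp: counting_path_def continuous_within)

text \<open>Right continuity makes the infimum attained, hence the non-strict inequalities. The
  condition \<open>s < K\<close> cannot be relaxed to \<open>s \<le> K\<close>, since the cap makes
  the left side true at \<open>K\<close> for every \<open>m\<close>.\<close>

lemma jump_time_le_iff:
  assumes f: "counting_path f" and s: "0 \<le> s" "s < K"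
  shows "jump_time K f m \<le> s \<longleftrightarrow> real m \<le> f s"
proof
  let ?S = "{s\<in>{0..K}. real m \<le> f s} \<union> {K}"
  have bdd: "bdd_below ?S"
    by (intro bdd_belowI[of _ 0]) (use s in auto)
  show "jump_time K f m \<le> s" if "real m \<le> f s"
    unfolding jump_time_def by (rule cInf_lower[OF _ bdd]) (use s that in auto)
  show "real m \<le> f s" if le: "jump_time K f m \<le> s"
  proof (rule tendsto_lowerbound[OF counting_path_right[OF f s(1)]])
    show "\<forall>\<^sub>F r in at_right s. real m \<le> f r"
      unfolding eventually_at_right_field
    proof (intro exI[of _ K] conjI allI impI)
      fix r assume r: "s < r" "r < K"
      then have "Inf ?S < r" using le unfolding jump_time_def by simp
      then obtain q where q: "q \<in> ?S" "q < r"
        using cInf_less_iff[of ?S r] bdd by auto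
      with r have "q \<in> {0..K}" "real m \<le> f q" by auto
      then show "real m \<le> f r" using counting_path_mono[OF f, of q r] q by auto
    qed (use s in auto)
  qed auto
qed

lemma jump_time_0:
  assumes "counting_path f" "0 < K" shows "jump_time K f 0 = 0"
  using jump_time_le_iff[OF assms(1) order_refl assms(2), of 0] jump_time_bounds[of K f 0] assms
  by (auto simp: counting_path_def)

lemma jump_time_pos:
  assumes "counting_path f" "0 < K" "m \<ge> 1" shows "0 < jump_time K f m"
  using jump_time_le_iff[OF assms(1) order_refl assms(2), of m] jump_time_bounds[of K f m] assms
  by (auto simp: counting_path_def)

text \<open>Before the jump time the path is an integer below \<open>m\<close>, hence at most
  \<open>m - 1\<close>; a jump of size at most one cannot overshoot \<open>m\<close>.\<close>

lemma jump_time_value: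
  assumes f: "counting_path f" and K: "0 < K" and m: "m \<ge> 1" and lt: "jump_time K f m < K"
  shows "f (jump_time K f m) = real m"
proof -
  let ?T = "jump_time K f m"
  have T0: "0 < ?T" by (rule jump_time_pos[OF f K m])
  have ge: "real m \<le> f ?T" using jump_time_le_iff[OF f _ lt, of m] T0 by auto
  obtain j where j: "j \<in> {0,1::real}" "(f \<longlongrightarrow> f ?T - j) (at_left ?T)"
    using f T0 unfolding counting_path_def by blast
  have "f ?T - j \<le> real m - 1"
  proof (rule tendsto_upperbound[OF j(2)])
    show "\<forall>\<^sub>F s in at_left ?T. f s \<le> real m - 1"
      unfolding eventually_at_left_field
    proof (intro exI[of _ 0] conjI allI impI)
      fix s assume s: "0 < s" "s < ?T"
      then have "f s < real m" using jump_time_le_iff[OF f, of s K m] lt by auto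
      moreover obtain k where "f s = real k" using counting_path_nat[OF f, of s] s by auto
      ultimately show "f s \<le> real m - 1" by simp
    qed (rule T0)
  qed (auto simp: trivial_limit_at_left_real)
  then show ?thesis using ge j by auto
qed

lemma jump_time_mono:
  assumes f: "counting_path f" and K: "0 < K" and m: "m \<le> m'"
  shows "jump_time K f m \<le> jump_time K f m'"
  unfolding jump_time_def
  by (rule cInf_superset_mono) (use K m in \<open>auto intro!: bdd_belowI[of _ 0]\<close>)

lemma jump_time_strict_mono:
  assumes f: "counting_path f" and K: "0 < K" and m: "m < m'" and lt: "jump_time K f m' < K"
  shows "jump_time K f m < jump_time K f m'"
proof (cases "m = 0")
  case True
  then show ?thesis using jump_time_0[OF f K] jump_time_pos[OF f K, of m'] m by auto
next
  case False
  have le: "jump_time K f m \<le> jump_time K f m'"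
    by (rule jump_time_mono[OF f K]) (use m in simp)
  have "f (jump_time K f m) = real m" "f (jump_time K f m') = real m'"
    by (rule jump_time_value[OF f K]; use le lt m False in auto)+
  then show ?thesis using le m by (cases "jump_time K f m = jump_time K f m'") auto
qed

section \<open>The Stieltjes measure of a counting path\<close>

text \<open>The interval measure needs monotonicity and right continuity on the whole line, while a
  counting path is only constrained at nonnegative times; \<open>max 0\<close> freezes it at its
  value at 0 to the left.\<close>

lemma emeasure_counting_path:
  assumes f: "counting_path f" and ab: "0 \<le> a" "a \<le> b"
  shows "emeasure (interval_measure (\<lambda>s. f (max 0 s))) {a<..b} = ennreal (f b - f a)"
proof -
  have "emeasure (interval_measure (\<lambda>s. f (max 0 s))) {a<..b} = ennreal (f (max 0 b) - f (max 0 a))"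
  proof (rule emeasure_interval_measure_Ioc)
    show "f (max 0 x) \<le> f (max 0 y)" if "x \<le> y" for x y
      by (rule counting_path_mono[OF f]) (use that in auto)
    show "continuous (at_right x) (\<lambda>s. f (max 0 s))" for x
      unfolding continuous_within
    proof (cases "x < 0")
      case True
      have "\<forall>\<^sub>F s in at_right x. f (max 0 x) = f (max 0 s)"
        unfolding eventually_at_right_field by (intro exI[of _ 0]) (use True in auto)
      then show "((\<lambda>s. f (max 0 s)) \<longlongrightarrow> f (max 0 x)) (at_right x)"
        by (rule Lim_transform_eventually[OF tendsto_const])
    next
      case False
      have "\<forall>\<^sub>F s in at_right x. f s = f (max 0 s)"
        unfolding eventually_at_right_field by (intro exI[of _ "x+1"]) (use False in auto)
      moreover have "(f \<longlongrightarrow> f (max 0 x)) (at_right x)"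
        using counting_path_right[OF f, of x] False by (simp add: max_def)
      ultimately show "((\<lambda>s. f (max 0 s)) \<longlongrightarrow> f (max 0 x)) (at_right x)"
        by (rule Lim_transform_eventually[rotated])
    qed
  qed (fact ab)
  then show ?thesis using ab by simp
qed

text \<open>The path is constant from the preceding jump time up to this one, so the open interval
  between them is null and the unit increment must sit at its right end.\<close>

lemma emeasure_jump_time:
  assumes f: "counting_path f" and K: "0 < K" and m: "m \<ge> 1" and lt: "jump_time K f m < K"
  shows "emeasure (interval_measure (\<lambda>s. f (max 0 s))) {jump_time K f m} = 1"
proof -
  let ?\<mu> = "interval_measure (\<lambda>s. f (max 0 s))"
  let ?T = "jump_time K f m" and ?R = "jump_time K f (m - 1)"
  have RT: "?R < ?T" by (rule jump_time_strict_mono[OF f K]) (use m lt in auto)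
  have R0: "0 \<le> ?R" using jump_time_bounds[of K f] K by auto
  have fv: "f s = real m - 1" if s: "?R \<le> s" "s < ?T" for s
  proof -
    have s0: "0 \<le> s" "s < K" using s R0 lt by auto
    obtain k where k: "f s = real k" using counting_path_nat[OF f s0(1)] by auto
    have "real (m - 1) \<le> f s" "\<not> real m \<le> f s"
      using jump_time_le_iff[OF f s0, of "m-1"] jump_time_le_iff[OF f s0, of m] s by auto
    then show ?thesis using k m by auto
  qed
  \<comment> \<open>Masses are known for half-open intervals only, so the open interval is exhausted
    by these.\<close>
  let ?A = "\<Union>k. {?R<..?T - (?T - ?R) / real (Suc k)}"
  have eq: "{?R<..<?T} = ?A"
  proof safe
    fix x assume x: "x \<in> {?R<..<?T}"
    then obtain k where "(?T - ?R) / (?T - x) < real k" using reals_Archimedean2 by blast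
    then have "(?T - ?R) / (?T - x) \<le> real (Suc k)" by simp
    then have "(?T - ?R) / real (Suc k) \<le> ?T - x" using x by (simp add: field_simps)
    then have "x \<in> {?R<..?T - (?T - ?R) / real (Suc k)}" using x by auto
    then show "x \<in> ?A" by blast
  next
    fix x k assume x: "x \<in> {?R<..?T - (?T - ?R) / real (Suc k)}"
    have "0 < (?T - ?R) / real (Suc k)" using RT by simp
    then show "x \<in> {?R<..<?T}" using x by auto
  qed
  have null: "?A \<in> null_sets ?\<mu>"
  proof (intro null_sets_UN' null_setsI)
    fix k
    have "0 < (?T - ?R) / real (Suc k)" using RT by simp
    moreover have "(?T - ?R) / real (Suc k) \<le> (?T - ?R) / 1"
      by (rule divide_left_mono) (use RT in auto)
    ultimately show "emeasure ?\<mu> {?R<..?T - (?T - ?R) / real (Suc k)} = 0"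
      by (subst emeasure_counting_path[OF f R0]) (auto simp: fv RT)
  qed auto
  have "emeasure ?\<mu> {?R<..?T} = ennreal (real m - (real m - 1))"
    using emeasure_counting_path[OF f R0, of ?T] RT jump_time_value[OF f K m lt] fv[of ?R] by simp
  moreover have "{?R<..?T} = {?T} \<union> ?A" unfolding eq[symmetric] using RT by auto
  ultimately have "emeasure ?\<mu> ({?T} \<union> ?A) = 1" by simp
  then show ?thesis using emeasure_Un_null_set[OF _ null, of "{?T}"] by simp
qed

text \<open>The interval {0<..t} has mass \<open>k\<close>, and the first \<open>k\<close> jump
  times are distinct unit atoms in it, so the measure is carried by them and the integral is a
  finite sum. Since \<open>t < K\<close>, none of them is the cap.\<close>

lemma cp_integral_jump_times:
  assumes f: "counting_path f" and t: "0 \<le> t" "t < K" and N: "f t = real k"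
    and g: "set_borel_measurable borel {0<..t} g"
  shows "cp_integral f g t = (\<Sum>m\<in>{1..k}. g (jump_time K f m))"
proof -
  let ?\<mu> = "interval_measure (\<lambda>s. f (max 0 s))"
  let ?T = "jump_time K f"
  have K: "0 < K" using t by simp
  have Tt: "?T m \<le> t" if "m \<in> {1..k}" for m
    using jump_time_le_iff[OF f t, of m] that N by auto
  have Tm: "emeasure ?\<mu> {?T m} = 1" "0 < ?T m" if "m \<in> {1..k}" for m
    using that by (auto intro!: emeasure_jump_time[OF f K] jump_time_pos[OF f K] le_less_trans[OF Tt t(2)])
  have inj: "inj_on ?T {1..k}"
  proof (rule inj_onI)
    fix a b assume ab: "a \<in> {1..k}" "b \<in> {1..k}" "?T a = ?T b"
    then have "real a = real b"
      using jump_time_value[OF f K, of a] jump_time_value[OF f K, of b] Tt t(2)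
      by (metis atLeastAtMost_iff le_less_trans)
    then show "a = b" by simp
  qed
  let ?D = "?T ` {1..k}"
  have D: "?D \<subseteq> {0<..t}" using Tm Tt by auto
  have "emeasure ?\<mu> ?D = (\<Sum>x\<in>?D. emeasure ?\<mu> {x})"
    by (rule emeasure_eq_sum_singleton) auto
  also have "\<dots> = (\<Sum>m\<in>{1..k}. emeasure ?\<mu> {?T m})" by (rule sum.reindex_cong[OF inj refl refl])
  also have "\<dots> = of_nat k" using Tm by simp
  finally have eD: "emeasure ?\<mu> ?D = of_nat k" .
  have et: "emeasure ?\<mu> {0<..t} = of_nat k"
    using emeasure_counting_path[OF f order_refl t(1)] N f
    by (simp add: counting_path_def ennreal_of_nat_eq_real_of_nat)
  have Dm: "?D \<in> sets borel" by (intro borel_closed finite_imp_closed) simp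
  have "emeasure ?\<mu> ({0<..t} - ?D) = emeasure ?\<mu> {0<..t} - emeasure ?\<mu> ?D"
    by (rule emeasure_Diff) (use D eD Dm in auto)
  also have "\<dots> = of_nat k - of_nat k" by (simp only: eD et)
  also have "\<dots> = 0" by (simp add: diff_eq_0_iff_ennreal)
  finally have "emeasure ?\<mu> ({0<..t} - ?D) = 0" .
  then have "{0<..t} - ?D \<in> null_sets ?\<mu>" by (intro null_setsI) (use Dm in auto)
  then have AE: "AE s in ?\<mu>. s \<notin> {0<..t} - ?D" by (rule AE_not_in)
  have "cp_integral f g t = (LINT s|?\<mu>. (\<Sum>m\<in>{1..k}. indicator {?T m} s * g (?T m)))"
    unfolding cp_integral_def set_lebesgue_integral_def
  proof (rule integral_cong_AE)
    show "AE s in ?\<mu>. indicator {0<..t} s *\<^sub>R g s = (\<Sum>m\<in>{1..k}. indicator {?T m} s * g (?T m))"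
      using AE
    proof eventually_elim
      case (elim s)
      show ?case
      proof (cases "s \<in> {0<..t}")
        case True
        then obtain m where m: "m \<in> {1..k}" "s = ?T m" using elim by auto
        have "(\<Sum>m'\<in>{1..k}. indicator {?T m'} s * g (?T m')) = (\<Sum>m'\<in>{1..k}. if m' = m then g s else 0)"
        proof (rule sum.cong[OF refl])
          fix m' assume "m' \<in> {1..k}"
          then have "s = ?T m' \<longleftrightarrow> m' = m" using m inj_onD[OF inj] by blast
          then show "indicator {?T m'} s * g (?T m') = (if m' = m then g s else 0)"
            by (cases "m' = m") simp_all
        qed
        also have "\<dots> = g s" using m by simp
        finally show ?thesis using True by simp
      next
        case False
        have "(\<Sum>m'\<in>{1..k}. indicator {?T m'} s * g (?T m')) = 0"
          by (rule sum.neutral) (use False D in \<open>force simp: indicator_def\<close>)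
        then show ?thesis using False by simp
      qed
    qed
    show "(\<lambda>s. indicator {0<..t} s *\<^sub>R g s) \<in> borel_measurable ?\<mu>"
      using g by (simp add: set_borel_measurable_def)
    show "(\<lambda>s. \<Sum>m\<in>{1..k}. indicator {?T m} s * g (?T m)) \<in> borel_measurable ?\<mu>"
      by measurable
  qed
  also have "\<dots> = (\<Sum>m\<in>{1..k}. (LINT s|?\<mu>. indicator {?T m} s * g (?T m)))"
    by (rule Bochner_Integration.integral_sum) (use Tm in \<open>auto intro!: integrable_mult_left\<close>)
  also have "\<dots> = (\<Sum>m\<in>{1..k}. g (?T m))"
    using Tm by (intro sum.cong) (auto simp: measure_def)
  finally show ?thesis .
qed

section \<open>Predictable processes\<close>

locale filtered_prob_space = prob_space M for M :: "'a measure" +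
  fixes F :: "real \<Rightarrow> 'a measure"
  assumes filtration: "filtration M F"
begin

abbreviation "predS \<equiv> predictable_sigma M F"

lemma space_F [simp]: "0 \<le> s \<Longrightarrow> space (F s) = space M"
  using filtration by (auto simp: filtration_def subalgebra_def)

lemma sets_F_subset: "0 \<le> s \<Longrightarrow> sets (F s) \<subseteq> sets M"
  using filtration by (auto simp: filtration_def subalgebra_def)

lemma sets_F_mono: "0 \<le> s \<Longrightarrow> s \<le> t \<Longrightarrow> A \<in> sets (F s) \<Longrightarrow> A \<in> sets (F t)"
  using filtration by (auto simp: filtration_def)

lemma sets_F_M: "0 \<le> s \<Longrightarrow> A \<in> sets (F s) \<Longrightarrow> A \<in> sets M"
  using sets_F_subset by blast

lemma measurable_F_M: "0 \<le> s \<Longrightarrow> f \<in> measurable (F s) N \<Longrightarrow> f \<in> measurable M N"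
  by (auto simp: measurable_def intro: sets_F_M)

abbreviation "pred_gens \<equiv> {{0} \<times> A | A. A \<in> sets (F 0)} \<union>
      {{s<..t} \<times> A | s t A. 0 \<le> s \<and> s \<le> t \<and> A \<in> sets (F s)}"

lemma pred_gens_Pow: "pred_gens \<subseteq> Pow ({0..} \<times> space M)"
  using sets.sets_into_space[of _ "F _"] by fastforce

lemma space_pred [simp]: "space predS = {0..} \<times> space M"
  unfolding predictable_sigma_def by (rule space_measure_of[OF pred_gens_Pow])

lemma sets_pred: "sets predS = sigma_sets ({0..} \<times> space M) pred_gens"
  unfolding predictable_sigma_def by (rule sets_measure_of[OF pred_gens_Pow])

lemma pred_zero: "A \<in> sets (F 0) \<Longrightarrow> {0} \<times> A \<in> sets predS"
  unfolding sets_pred by (rule sigma_sets.Basic) auto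

lemma pred_Ioc: "0 \<le> s \<Longrightarrow> s \<le> t \<Longrightarrow> A \<in> sets (F s) \<Longrightarrow> {s<..t} \<times> A \<in> sets predS"
  unfolding sets_pred by (rule sigma_sets.Basic) blast

lemma pred_Ioi:
  assumes "0 \<le> s" "A \<in> sets (F s)" shows "{s<..} \<times> A \<in> sets predS"
proof -
  have "{s<..} \<times> A = (\<Union>n::nat. {s<..s + real n} \<times> A)"
  proof -
    have "{s<..} = (\<Union>n::nat. {s<..s + real n})"
    proof safe
      fix x assume "s < x"
      obtain n where "x - s < real n" using reals_Archimedean2 by blast
      with \<open>s < x\<close> have "x \<in> {s<..s + real n}" by auto
      then show "x \<in> (\<Union>n::nat. {s<..s + real n})" by blast
    qed auto
    then show ?thesis by auto
  qed
  also have "\<dots> \<in> sets predS"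
    by (intro sets.countable_UN) (use assms in \<open>auto intro!: pred_Ioc\<close>)
  finally show ?thesis .
qed

lemma pred_Ici:
  assumes "A \<in> sets (F 0)" shows "{0..} \<times> A \<in> sets predS"
proof -
  have "{0::real..} \<times> A = {0} \<times> A \<union> {0<..} \<times> A" by force
  then show ?thesis using pred_zero[OF assms] pred_Ioi[OF order_refl assms] by auto
qed

lemma measurable_predI:
  assumes "\<And>x. x \<in> space N \<Longrightarrow> f x \<in> {0..} \<times> space M"
    and "\<And>A. A \<in> sets (F 0) \<Longrightarrow> f -` ({0} \<times> A) \<inter> space N \<in> sets N"
    and "\<And>s t A. 0 \<le> s \<Longrightarrow> s \<le> t \<Longrightarrow> A \<in> sets (F s) \<Longrightarrow> f -` ({s<..t} \<times> A) \<inter> space N \<in> sets N"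
  shows "f \<in> measurable N predS"
  unfolding predictable_sigma_def
  by (rule measurable_measure_of[OF pred_gens_Pow]) (use assms in auto)

section \<open>Predictable processes at random times and along paths\<close>

text \<open>A random time bounded by \<open>s\<close> can meet a generator
  \<open>{a<..c} \<times> A\<close> only if \<open>a \<le> s\<close>, and then \<open>A\<close>
  already belongs to \<open>F s\<close>.\<close>

lemma measurable_stopped:
  assumes s: "0 \<le> s" and T: "T \<in> borel_measurable (F s)"
    and b: "\<And>w. w \<in> space M \<Longrightarrow> 0 \<le> T w \<and> T w \<le> s"
  shows "(\<lambda>w. (T w, w)) \<in> measurable (F s) predS"
proof (rule measurable_predI)
  fix A assume A: "A \<in> sets (F 0)"
  have "(\<lambda>w. (T w, w)) -` ({0} \<times> A) \<inter> space (F s) = (T -` {0} \<inter> space (F s)) \<inter> A"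
    using sets.sets_into_space[OF A] s by auto
  then show "(\<lambda>w. (T w, w)) -` ({0} \<times> A) \<inter> space (F s) \<in> sets (F s)"
    using measurable_sets[OF T, of "{0}"] sets_F_mono[OF order_refl s A] by auto
next
  fix a c A assume a: "0 \<le> a" "a \<le> c" and A: "A \<in> sets (F a)"
  show "(\<lambda>w. (T w, w)) -` ({a<..c} \<times> A) \<inter> space (F s) \<in> sets (F s)"
  proof (cases "a \<le> s")
    case True
    have "(\<lambda>w. (T w, w)) -` ({a<..c} \<times> A) \<inter> space (F s) = (T -` {a<..c} \<inter> space (F s)) \<inter> A"
      using sets.sets_into_space[OF A] s a by auto
    then show ?thesis
      using measurable_sets[OF T, of "{a<..c}"] sets_F_mono[OF a(1) True A] by auto
  next
    case False
    then have "(\<lambda>w. (T w, w)) -` ({a<..c} \<times> A) \<inter> space (F s) = {}"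
      using b s by force
    then show ?thesis by simp
  qed
qed (use b s in auto)

text \<open>Predictable processes are progressively measurable. Freezing time at \<open>s\<close> is
  what makes integrals over {0<..s} measurable for \<open>F s\<close> by Fubini.\<close>

lemma measurable_progressive:
  assumes s: "0 \<le> s"
  shows "(\<lambda>(w, r). (max 0 (min s r), w)) \<in> measurable (F s \<Otimes>\<^sub>M borel) predS"
proof (rule measurable_predI)
  fix A assume A: "A \<in> sets (F 0)"
  have "(\<lambda>(w, r). (max 0 (min s r), w)) -` ({0} \<times> A) \<inter> space (F s \<Otimes>\<^sub>M borel)
    = A \<times> {r. max 0 (min s r) = 0}"
    using sets.sets_into_space[OF A] s by (auto simp: space_pair_measure)
  also have "\<dots> \<in> sets (F s \<Otimes>\<^sub>M borel)"
    by (intro pair_measureI sets_F_mono[OF order_refl s A]) measurable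
  finally show "(\<lambda>(w, r). (max 0 (min s r), w)) -` ({0} \<times> A) \<inter> space (F s \<Otimes>\<^sub>M borel)
    \<in> sets (F s \<Otimes>\<^sub>M borel)" .
next
  fix a c A assume a: "0 \<le> a" "a \<le> c" and A: "A \<in> sets (F a)"
  show "(\<lambda>(w, r). (max 0 (min s r), w)) -` ({a<..c} \<times> A) \<inter> space (F s \<Otimes>\<^sub>M borel)
    \<in> sets (F s \<Otimes>\<^sub>M borel)"
  proof (cases "a \<le> s")
    case True
    have "(\<lambda>(w, r). (max 0 (min s r), w)) -` ({a<..c} \<times> A) \<inter> space (F s \<Otimes>\<^sub>M borel)
      = A \<times> {r. a < max 0 (min s r) \<and> max 0 (min s r) \<le> c}"
      using sets.sets_into_space[OF A] s a by (auto simp: space_pair_measure)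
    also have "\<dots> \<in> sets (F s \<Otimes>\<^sub>M borel)"
      by (intro pair_measureI sets_F_mono[OF a(1) True A]) measurable
    finally show ?thesis .
  next
    case False
    then have "(\<lambda>(w, r). (max 0 (min s r), w)) -` ({a<..c} \<times> A) \<inter> space (F s \<Otimes>\<^sub>M borel) = {}"
      using s a by auto
    then show ?thesis by simp
  qed
qed (use s in \<open>auto simp: space_pair_measure\<close>)

text \<open>\<open>predS\<close> lives on nonnegative times; clamping with \<open>max 0\<close>
  allows product measurability to be used with Lebesgue measure on the whole line.\<close>

lemma measurable_pred_pair:
  "(\<lambda>(w, r::real). (max 0 r, w)) \<in> measurable (M \<Otimes>\<^sub>M borel) predS"
proof (rule measurable_predI)
  fix A assume A: "A \<in> sets (F 0)"
  have "(\<lambda>(w, r::real). (max 0 r, w)) -` ({0} \<times> A) \<inter> space (M \<Otimes>\<^sub>M borel) = A \<times> {r::real. max 0 r = 0}"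
    using sets.sets_into_space[OF A] by (auto simp: space_pair_measure)
  also have "\<dots> \<in> sets (M \<Otimes>\<^sub>M borel)"
    by (intro pair_measureI sets_F_M[OF order_refl A]) measurable
  finally show "(\<lambda>(w, r::real). (max 0 r, w)) -` ({0} \<times> A) \<inter> space (M \<Otimes>\<^sub>M borel) \<in> sets (M \<Otimes>\<^sub>M borel)" .
next
  fix a c A assume a: "0 \<le> a" "a \<le> c" and A: "A \<in> sets (F a)"
  have "(\<lambda>(w, r::real). (max 0 r, w)) -` ({a<..c} \<times> A) \<inter> space (M \<Otimes>\<^sub>M borel)
      = A \<times> {r. a < max 0 r \<and> max 0 r \<le> c}"
    using sets.sets_into_space[OF A] a by (auto simp: space_pair_measure)
  also have "\<dots> \<in> sets (M \<Otimes>\<^sub>M borel)"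
    by (intro pair_measureI sets_F_M[OF a(1) A]) measurable
  finally show "(\<lambda>(w, r::real). (max 0 r, w)) -` ({a<..c} \<times> A) \<inter> space (M \<Otimes>\<^sub>M borel) \<in> sets (M \<Otimes>\<^sub>M borel)" .
qed (auto simp: space_pair_measure)

lemma measurable_pred_section:
  assumes "w \<in> space M" shows "(\<lambda>r. (max 0 r, w)) \<in> measurable borel predS"
  using measurable_compose[OF measurable_Pair1'[OF assms, of borel] measurable_pred_pair] by simp

lemma measurable_stopped_M:
  assumes T: "T \<in> borel_measurable M" and b: "\<And>w. w \<in> space M \<Longrightarrow> 0 \<le> T w"
  shows "(\<lambda>w. (T w, w)) \<in> measurable M predS"
proof -
  have "(\<lambda>w. (w, T w)) \<in> measurable M (M \<Otimes>\<^sub>M borel)" using T by simp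
  from measurable_compose[OF this measurable_pred_pair]
  have "(\<lambda>w. (max 0 (T w), w)) \<in> measurable M predS" by simp
  then show ?thesis
    by (subst measurable_cong[where g="\<lambda>w. (max 0 (T w), w)"]) (use b in auto)
qed

lemma pred_section_borel:
  assumes G: "G \<in> measurable predS N" and w: "w \<in> space M"
  shows "(\<lambda>r. G (max 0 r, w)) \<in> measurable borel N"
  using measurable_compose[OF measurable_pred_section[OF w] G] by simp

lemma pred_section_indicator:
  fixes G :: "real \<times> 'a \<Rightarrow> real"
  assumes G: "G \<in> borel_measurable predS" and w: "w \<in> space M" and S: "S \<in> sets borel" "\<forall>x\<in>S. 0 \<le> x"
  shows "(\<lambda>r. indicator S r * G (r, w)) \<in> borel_measurable borel"
proof -
  have "(\<lambda>r. indicator S r * G (max 0 r, w)) \<in> borel_measurable borel"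
    using pred_section_borel[OF G w] S(1) by simp
  also have "(\<lambda>r. indicator S r * G (max 0 r, w)) = (\<lambda>r. indicator S r * G (r, w))"
    using S(2) by (auto simp: indicator_def fun_eq_iff)
  finally show ?thesis .
qed

lemma pred_section_indicator_ennreal:
  fixes G :: "real \<times> 'a \<Rightarrow> ennreal"
  assumes G: "G \<in> borel_measurable predS" and w: "w \<in> space M" and S: "S \<in> sets borel" "\<forall>x\<in>S. 0 \<le> x"
  shows "(\<lambda>r. indicator S r * G (r, w)) \<in> borel_measurable borel"
proof -
  have "(\<lambda>r. indicator S r * G (max 0 r, w)) \<in> borel_measurable borel"
    using pred_section_borel[OF G w] S(1) by simp
  also have "(\<lambda>r. indicator S r * G (max 0 r, w)) = (\<lambda>r. indicator S r * G (r, w))"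
    using S(2) by (auto simp: indicator_def fun_eq_iff)
  finally show ?thesis .
qed

lemma nn_integral_adapted:
  assumes s: "0 \<le> s" and G: "G \<in> borel_measurable predS"
  shows "(\<lambda>w. \<integral>\<^sup>+r. indicator {0<..s} r * G (r, w) \<partial>lborel) \<in> borel_measurable (F s)"
proof -
  have [measurable]: "(\<lambda>(w, r). G (max 0 (min s r), w)) \<in> borel_measurable (F s \<Otimes>\<^sub>M borel)"
    using measurable_compose[OF measurable_progressive[OF s] G] by (simp add: split_def)
  have "(\<lambda>w. \<integral>\<^sup>+r. indicator {0<..s} r * G (max 0 (min s r), w) \<partial>lborel) \<in> borel_measurable (F s)"
    by measurable
  also have "(\<lambda>w. \<integral>\<^sup>+r. indicator {0<..s} r * G (max 0 (min s r), w) \<partial>lborel)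
    = (\<lambda>w. \<integral>\<^sup>+r. indicator {0<..s} r * G (r, w) \<partial>lborel)"
    by (intro ext nn_integral_cong) (auto simp: indicator_def)
  finally show ?thesis .
qed

lemma integral_adapted:
  fixes G :: "real \<times> 'a \<Rightarrow> real"
  assumes s: "0 \<le> s" and G: "G \<in> borel_measurable predS"
  shows "(\<lambda>w. LINT r:{0<..s}|lborel. G (r, w)) \<in> borel_measurable (F s)"
proof -
  have [measurable]: "(\<lambda>(w, r). G (max 0 (min s r), w)) \<in> borel_measurable (F s \<Otimes>\<^sub>M borel)"
    using measurable_compose[OF measurable_progressive[OF s] G] by (simp add: split_def)
  have "(\<lambda>w. LINT r|lborel. indicator {0<..s} r * G (max 0 (min s r), w)) \<in> borel_measurable (F s)"
    by measurable
  also have "(\<lambda>w. LINT r|lborel. indicator {0<..s} r * G (max 0 (min s r), w))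
    = (\<lambda>w. LINT r:{0<..s}|lborel. G (r, w))"
    unfolding set_lebesgue_integral_def
    by (intro ext Bochner_Integration.integral_cong) (auto simp: indicator_def)
  finally show ?thesis .
qed

section \<open>Predictable sets obtained from adapted events\<close>

text \<open>A form of the fact that adapted left-continuous processes are predictable: by
  \<open>iff\<close> the set is a countable union of rectangles that start just after a rational
  time.\<close>

lemma predictable_left_limit_set:
  assumes P: "\<And>q. 0 \<le> q \<Longrightarrow> {w\<in>space M. P q w} \<in> sets (F q)"
    and iff: "\<And>s w. 0 \<le> s \<Longrightarrow> w \<in> space M \<Longrightarrow> P s w \<longleftrightarrow> (\<exists>q\<in>\<rat>. 0 \<le> q \<and> q < s \<and> P q w)"
  shows "{x\<in>{0..} \<times> space M. P (fst x) (snd x)} \<in> sets predS"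
proof -
  have "{x\<in>{0..} \<times> space M. P (fst x) (snd x)} = (\<Union>q\<in>\<rat> \<inter> {0..}. {q<..} \<times> {w\<in>space M. P q w})"
  proof (rule set_eqI)
    fix x show "x \<in> {x\<in>{0..} \<times> space M. P (fst x) (snd x)}
      \<longleftrightarrow> x \<in> (\<Union>q\<in>\<rat> \<inter> {0..}. {q<..} \<times> {w\<in>space M. P q w})"
    proof (cases x)
      case (Pair s w)
      show ?thesis
        unfolding Pair using iff[of s w] by (cases "0 \<le> s \<and> w \<in> space M") auto
    qed
  qed
  also have "\<dots> \<in> sets predS"
    by (intro sets.countable_UN' countable_Int1 countable_rat) (auto intro!: pred_Ioi P)
  finally show ?thesis .
qed

text \<open>The open stochastic interval after a stopping time; a rational number between
  \<open>T w\<close> and the current time provides the rectangle.\<close>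

lemma predictable_after:
  assumes T: "\<And>q. 0 \<le> q \<Longrightarrow> {w\<in>space M. T w \<le> q} \<in> sets (F q)"
    and T0: "\<And>w. w \<in> space M \<Longrightarrow> 0 \<le> T w"
  shows "{x\<in>{0..} \<times> space M. T (snd x) < fst x} \<in> sets predS"
proof -
  have "{x\<in>{0..} \<times> space M. T (snd x) < fst x} = (\<Union>q\<in>\<rat> \<inter> {0..}. {q<..} \<times> {w\<in>space M. T w \<le> q})"
  proof (rule set_eqI)
    fix x show "x \<in> {x\<in>{0..} \<times> space M. T (snd x) < fst x}
      \<longleftrightarrow> x \<in> (\<Union>q\<in>\<rat> \<inter> {0..}. {q<..} \<times> {w\<in>space M. T w \<le> q})"
    proof (cases x)
      case (Pair s w)
      have "T w < s \<Longrightarrow> \<exists>q\<in>\<rat>. T w < q \<and> q < s" using Rats_dense_in_real[of "T w" s] by auto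
      then show ?thesis
        unfolding Pair using T0[of w] by (cases "w \<in> space M") force+
    qed
  qed
  also have "\<dots> \<in> sets predS"
    by (intro sets.countable_UN' countable_Int1 countable_rat) (auto intro!: pred_Ioi T)
  finally show ?thesis .
qed

lemma measurable_fst_pred: "fst \<in> borel_measurable predS"
proof (rule borel_measurableI_greater)
  fix a :: real
  have "{x\<in>space predS. a < fst x} = (if a < 0 then {0..} \<times> space M else {a<..} \<times> space M)"
    by auto
  also have "\<dots> \<in> sets predS"
    using pred_Ici[of "space M"] pred_Ioi[of a "space M"] sets.top[of "F 0"] sets.top[of "F a"] space_F[of a]
    by (cases "a < 0") simp_all
  finally show "{x\<in>space predS. a < fst x} \<in> sets predS" .
qed

lemma measurable_snd_pred: "snd \<in> measurable predS (F 0)"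
proof (rule measurableI)
  fix A assume A: "A \<in> sets (F 0)"
  have "snd -` A \<inter> space predS = {0..} \<times> A" using sets.sets_into_space[OF A] by auto
  then show "snd -` A \<inter> space predS \<in> sets predS" using pred_Ici[OF A] by simp
qed auto

text \<open>The building block by which a quantity known at \<open>u\<close>, later the exponential
  at the left end of a grid cell, enters the compensator formula as a predictable factor.\<close>

lemma predictable_step:
  assumes u: "0 \<le> u" "u \<le> v" and \<xi>: "\<xi> \<in> borel_measurable (F u)" and nn: "\<And>w. 0 \<le> \<xi> w"
  shows "(\<lambda>x. indicator {u<..v} (fst x) * \<xi> (snd x) :: real) \<in> borel_measurable predS"
proof (rule borel_measurableI_greater)
  fix a :: real
  have "{x\<in>space predS. a < indicator {u<..v} (fst x) * \<xi> (snd x)}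
    = (if a < 0 then {0..} \<times> space M else {u<..v} \<times> {w\<in>space M. a < \<xi> w})"
    using u by (auto simp: indicator_def nn less_le_trans split: if_splits)
  moreover have "{w\<in>space M. a < \<xi> w} \<in> sets (F u)"
    using \<xi> u by (simp add: borel_measurable_iff_greater)
  ultimately show "{x\<in>space predS. a < indicator {u<..v} (fst x) * \<xi> (snd x)} \<in> sets predS"
    using pred_Ici[of "space M"] pred_Ioc[OF u] sets.top[of "F 0"] by auto
qed

end

section \<open>Optional stopping\<close>

text \<open>The hypothesis on \<open>f\<close> is the form of uniform integrability that
  optional stopping provides, because \<open>max 0 (\<bar>x\<bar> - c)\<close> is convex in \<open>x\<close>. Uniform integrability
  cannot be replaced by domination below: only the martingale is integrable, not the counting
  process and its compensator separately.\<close>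

lemma (in finite_measure) integral_convergence_clipped:
  fixes f :: "nat \<Rightarrow> 'a \<Rightarrow> real" and g f' :: "'a \<Rightarrow> real"
  assumes f: "\<And>m. integrable M (f m)" and f': "f' \<in> borel_measurable M"
    and lim: "AE w in M. (\<lambda>m. f m w) \<longlonglongrightarrow> f' w"
    and g: "integrable M g"
    and le: "\<And>m c. 0 \<le> c \<Longrightarrow> (LINT w|M. max 0 (\<bar>f m w\<bar> - c)) \<le> (LINT w|M. max 0 (\<bar>g w\<bar> - c))"
  shows "integrable M f'" "(\<lambda>m. LINT w|M. f m w) \<longlonglongrightarrow> (LINT w|M. f' w)"
proof -
  note [measurable] = f' borel_measurable_integrable[OF f] borel_measurable_integrable[OF g]
  have int: "integrable M (\<lambda>w. max 0 (\<bar>k w\<bar> - c))" if "integrable M k" "0 \<le> c" for k :: "'a \<Rightarrow> real" and c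
    by (rule Bochner_Integration.integrable_bound[OF that(1)]) (use that in auto)
  have fatou: "(\<integral>\<^sup>+w. ennreal (max 0 (\<bar>f' w\<bar> - c)) \<partial>M) \<le> ennreal (LINT w|M. max 0 (\<bar>g w\<bar> - c))"
    if c: "0 \<le> c" for c
  proof -
    have "(\<integral>\<^sup>+w. ennreal (max 0 (\<bar>f' w\<bar> - c)) \<partial>M)
      = (\<integral>\<^sup>+w. liminf (\<lambda>m. ennreal (max 0 (\<bar>f m w\<bar> - c))) \<partial>M)"
    proof (rule nn_integral_cong_AE, use lim in eventually_elim)
      case (elim w)
      have "(\<lambda>m. ennreal (max 0 (\<bar>f m w\<bar> - c))) \<longlonglongrightarrow> ennreal (max 0 (\<bar>f' w\<bar> - c))"
        by (intro tendsto_intros elim)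
      then show ?case by (metis lim_imp_Liminf trivial_limit_sequentially)
    qed
    also have "\<dots> \<le> liminf (\<lambda>m. \<integral>\<^sup>+w. ennreal (max 0 (\<bar>f m w\<bar> - c)) \<partial>M)"
      by (rule nn_integral_liminf) measurable
    also have "\<dots> \<le> ennreal (LINT w|M. max 0 (\<bar>g w\<bar> - c))"
    proof (rule order_trans[OF Liminf_le_Limsup Limsup_bounded], simp, rule always_eventually, rule allI)
      fix m
      show "(\<integral>\<^sup>+w. ennreal (max 0 (\<bar>f m w\<bar> - c)) \<partial>M) \<le> ennreal (LINT w|M. max 0 (\<bar>g w\<bar> - c))"
        by (subst nn_integral_eq_integral[OF int[OF f c]]) (use le[OF c] in \<open>auto intro: ennreal_leI\<close>)
    qed
    finally show ?thesis .
  qed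
  show f'int: "integrable M f'"
  proof (rule integrableI_bounded)
    have "(\<integral>\<^sup>+w. ennreal (norm (f' w)) \<partial>M) \<le> ennreal (LINT w|M. max 0 (\<bar>g w\<bar> - 0))"
      using fatou[of 0] by simp
    also have "\<dots> < \<infinity>" by simp
    finally show "(\<integral>\<^sup>+w. ennreal (norm (f' w)) \<partial>M) < \<infinity>" .
  qed simp
  have f'le: "(LINT w|M. max 0 (\<bar>f' w\<bar> - c)) \<le> (LINT w|M. max 0 (\<bar>g w\<bar> - c))" if c: "0 \<le> c" for c
    using fatou[OF c] by (subst (asm) nn_integral_eq_integral[OF int[OF f'int c]]) (auto simp: integral_nonneg_AE)
  have tail: "(\<lambda>k. LINT w|M. max 0 (\<bar>g w\<bar> - real k)) \<longlonglongrightarrow> (LINT w|M. 0)"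
  proof (rule integral_dominated_convergence[where w="\<lambda>w. \<bar>g w\<bar>"])
    show "AE w in M. (\<lambda>k. max 0 (\<bar>g w\<bar> - real k)) \<longlonglongrightarrow> 0"
    proof (rule AE_I2)
      fix w
      obtain n where n: "\<bar>g w\<bar> \<le> real n" using real_arch_simple by blast
      have "\<forall>\<^sub>F k in sequentially. 0 = max 0 (\<bar>g w\<bar> - real k)"
        using eventually_ge_at_top[of n] by eventually_elim (use n in auto)
      then show "(\<lambda>k. max 0 (\<bar>g w\<bar> - real k)) \<longlonglongrightarrow> 0"
        by (rule Lim_transform_eventually[OF tendsto_const])
    qed
  qed (use g in auto)
  show "(\<lambda>m. LINT w|M. f m w) \<longlonglongrightarrow> (LINT w|M. f' w)"
  proof (rule LIMSEQ_I)
    fix r :: real assume r: "0 < r"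
    have "\<forall>\<^sub>F k in sequentially. (LINT w|M. max 0 (\<bar>g w\<bar> - real k)) < r / 3"
      using order_tendstoD(2)[OF tail, of "r/3"] r by simp
    then obtain k where k: "(LINT w|M. max 0 (\<bar>g w\<bar> - real k)) < r / 3"
      by (auto simp: eventually_sequentially)
    \<comment> \<open>Clipping changes the integral of \<open>q\<close> by at most that of
      \<open>max 0 (\<bar>q\<bar> - k)\<close>, which is small for all \<open>f m\<close> and for
      \<open>f'\<close> at once. The clipped functions converge by domination with the constant
      \<open>k\<close>.\<close>
    define clip where "clip x = max (- real k) (min (real k) x)" for x :: real
    have [measurable]: "clip \<in> borel_measurable borel" unfolding clip_def by measurable
    have clip_b: "\<bar>clip x\<bar> \<le> real k" for x by (auto simp: clip_def)
    have iclip: "integrable M (\<lambda>w. clip (q w))" if "q \<in> borel_measurable M" for q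
      by (rule integrable_const_bound[of _ "real k"]) (use that clip_b in auto)
    have dist: "\<bar>(LINT w|M. q w) - (LINT w|M. clip (q w))\<bar> < r / 3"
      if q: "integrable M q" "(LINT w|M. max 0 (\<bar>q w\<bar> - real k)) \<le> (LINT w|M. max 0 (\<bar>g w\<bar> - real k))" for q
    proof -
      have "\<bar>(LINT w|M. q w) - (LINT w|M. clip (q w))\<bar> = \<bar>LINT w|M. q w - clip (q w)\<bar>"
        using q iclip by (subst Bochner_Integration.integral_diff) auto
      also have "\<dots> \<le> (LINT w|M. \<bar>q w - clip (q w)\<bar>)" by (rule integral_abs_bound)
      also have "\<dots> = (LINT w|M. max 0 (\<bar>q w\<bar> - real k))"
        by (rule Bochner_Integration.integral_cong) (auto simp: clip_def)
      finally show ?thesis using q(2) k by simp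
    qed
    have "(\<lambda>m. LINT w|M. clip (f m w)) \<longlonglongrightarrow> (LINT w|M. clip (f' w))"
    proof (rule integral_dominated_convergence[where w="\<lambda>_. real k"])
      show "AE w in M. (\<lambda>m. clip (f m w)) \<longlonglongrightarrow> clip (f' w)"
        using lim unfolding clip_def by eventually_elim (intro tendsto_intros)
    qed (use clip_b in auto)
    then obtain m0 where m0: "\<And>m. m \<ge> m0 \<Longrightarrow> \<bar>(LINT w|M. clip (f m w)) - (LINT w|M. clip (f' w))\<bar> < r / 3"
      using LIMSEQ_D[of _ _ "r/3"] r by (metis divide_pos_pos real_norm_def zero_less_numeral)
    show "\<exists>no. \<forall>m\<ge>no. norm ((LINT w|M. f m w) - (LINT w|M. f' w)) < r"
    proof (intro exI allI impI)
      fix m assume "m \<ge> m0"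
      from m0[OF this] dist[OF f le, of m] dist[OF f'int f'le]
      show "norm ((LINT w|M. f m w) - (LINT w|M. f' w)) < r"
        unfolding real_norm_def by linarith
    qed
  qed
qed

context filtered_prob_space
begin

text \<open>On each event \<open>D w = s\<close>, which lies in \<open>F s\<close>, the martingale
  equality between \<open>s\<close> and \<open>v\<close> applies, and the finitely many events are
  added up. The third claim is the submartingale property of
  \<open>max 0 (\<bar>Z\<bar> - c)\<close>, which serves as the uniform integrability hypothesis of
  \<open>integral_convergence_clipped\<close>.\<close>

lemma optional_stopping_finite:
  fixes Z :: "real \<Rightarrow> 'a \<Rightarrow> real"
  assumes Z: "martingale M F Z" and S: "finite S" "\<And>s. s \<in> S \<Longrightarrow> 0 \<le> s \<and> s \<le> v"
    and D: "\<And>s. s \<in> S \<Longrightarrow> {w\<in>space M. D w = s} \<in> sets (F s)"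
    and DS: "\<And>w. w \<in> space M \<Longrightarrow> D w \<in> S"
  shows "integrable M (\<lambda>w. Z (D w) w)"
    and "0 \<le> u \<Longrightarrow> (\<And>s. s \<in> S \<Longrightarrow> u \<le> s) \<Longrightarrow> A \<in> sets (F u) \<Longrightarrow>
      (LINT w:A|M. Z (D w) w) = (LINT w:A|M. Z v w)"
    and "0 \<le> c \<Longrightarrow> (LINT w|M. max 0 (\<bar>Z (D w) w\<bar> - c)) \<le> (LINT w|M. max 0 (\<bar>Z v w\<bar> - c))"
proof -
  have v: "0 \<le> v" if "space M \<noteq> {}" using S(2) DS that by force
  have v0: "0 \<le> v" using v not_empty by blast
  have Zint: "integrable M (Z s)" if "0 \<le> s" for s using Z that by (auto simp: martingale_def)
  have Zad: "Z s \<in> borel_measurable (F s)" if "0 \<le> s" for s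
    using Z that by (auto simp: martingale_def adapted_def)
  have Zeq: "(LINT w:A|M. Z s w) = (LINT w:A|M. Z v w)" if "0 \<le> s" "s \<le> v" "A \<in> sets (F s)" for s A
    using Z that unfolding martingale_def by metis
  let ?B = "\<lambda>s. {w\<in>space M. D w = s}"
  have BM: "?B s \<in> sets M" if "s \<in> S" for s using D[OF that] S(2)[OF that] sets_F_M by blast
  have decomp: "k (D w) w = (\<Sum>s\<in>S. indicator (?B s) w * k s w)" if "w \<in> space M"
    for k :: "real \<Rightarrow> 'a \<Rightarrow> real" and w
  proof -
    have "(\<Sum>s\<in>S. indicator (?B s) w * k s w) = (\<Sum>s\<in>S. if s = D w then k s w else 0)"
      by (rule sum.cong) (use that in \<open>auto simp: indicator_def\<close>)
    then show ?thesis using DS[OF that] S(1) by simp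
  qed
  have iB: "integrable M (\<lambda>w. indicator B w * k w)" if "B \<in> sets M" "integrable M k" for B and k :: "'a \<Rightarrow> real"
    using integrable_mult_indicator[OF that] by simp
  show "integrable M (\<lambda>w. Z (D w) w)"
    by (subst Bochner_Integration.integrable_cong[OF refl decomp], assumption,
        rule Bochner_Integration.integrable_sum, rule iB) (use S BM Zint in auto)
  show "(LINT w:A|M. Z (D w) w) = (LINT w:A|M. Z v w)"
    if u: "0 \<le> u" "\<And>s. s \<in> S \<Longrightarrow> u \<le> s" "A \<in> sets (F u)"
  proof -
    have AM: "A \<in> sets M" using u sets_F_M by blast
    have gen: "(LINT w:A|M. k (D w) w) = (\<Sum>s\<in>S. LINT w:A \<inter> ?B s|M. k s w)"
      if k: "\<And>s. s \<in> S \<Longrightarrow> integrable M (k s)" for k :: "real \<Rightarrow> 'a \<Rightarrow> real"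
    proof -
      have "(LINT w:A|M. k (D w) w) = (LINT w|M. (\<Sum>s\<in>S. indicator (A \<inter> ?B s) w * k s w))"
        unfolding set_lebesgue_integral_def
      proof (rule Bochner_Integration.integral_cong)
        fix w assume w: "w \<in> space M"
        show "indicator A w *\<^sub>R k (D w) w = (\<Sum>s\<in>S. indicator (A \<inter> ?B s) w * k s w)"
          unfolding decomp[OF w] by (simp add: sum_distrib_left indicator_inter_arith mult.assoc)
      qed simp
      also have "\<dots> = (\<Sum>s\<in>S. LINT w:A \<inter> ?B s|M. k s w)"
        unfolding set_lebesgue_integral_def
        by (subst Bochner_Integration.integral_sum) (use k BM AM in \<open>auto intro!: iB\<close>)
      finally show ?thesis .
    qed
    have "(LINT w:A|M. Z (D w) w) = (\<Sum>s\<in>S. LINT w:A \<inter> ?B s|M. Z s w)"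
      by (rule gen) (use S Zint in auto)
    also have "\<dots> = (\<Sum>s\<in>S. LINT w:A \<inter> ?B s|M. Z v w)"
    proof (rule sum.cong[OF refl Zeq])
      fix s assume s: "s \<in> S"
      have "A \<in> sets (F s)" by (rule sets_F_mono[OF u(1) u(2)[OF s] u(3)])
      then show "A \<inter> ?B s \<in> sets (F s)" using D[OF s] by auto
    qed (use S in auto)
    also have "\<dots> = (LINT w:A|M. Z v w)"
      by (rule gen[symmetric]) (use v0 Zint in auto)
    finally show ?thesis .
  qed
  show "(LINT w|M. max 0 (\<bar>Z (D w) w\<bar> - c)) \<le> (LINT w|M. max 0 (\<bar>Z v w\<bar> - c))" if c: "0 \<le> c"
  proof -
    have int: "integrable M (\<lambda>w. max 0 (\<bar>k w\<bar> - c))" if "integrable M k" for k :: "'a \<Rightarrow> real"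
      by (rule Bochner_Integration.integrable_bound[OF that(1)])
        (use c borel_measurable_integrable[OF that] in auto)
    have le: "(LINT w|M. indicator (?B s) w * max 0 (\<bar>Z s w\<bar> - c))
        \<le> (LINT w|M. indicator (?B s) w * max 0 (\<bar>Z v w\<bar> - c))" if s: "s \<in> S" for s
    proof -
      have s0: "0 \<le> s" "s \<le> v" using S(2)[OF s] by auto
      \<comment> \<open>On \<open>P\<close> and \<open>Q\<close> the truncated excess is affine in
        \<open>Z\<close>. Both sets belong to \<open>F s\<close>, so \<open>Z s\<close> may be
        exchanged for \<open>Z v\<close> in the affine expression, which the truncated excess of
        \<open>Z v\<close> dominates.\<close>
      define P where "P = {w\<in>space M. D w = s \<and> c < Z s w}"
      define Q where "Q = {w\<in>space M. D w = s \<and> Z s w < - c}"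
      have "P = ?B s \<inter> (Z s -` {c<..} \<inter> space (F s))" unfolding P_def using s0 by auto
      then have P: "P \<in> sets (F s)" using D[OF s] measurable_sets[OF Zad[OF s0(1)], of "{c<..}"] by auto
      have "Q = ?B s \<inter> (Z s -` {..<-c} \<inter> space (F s))" unfolding Q_def using s0 by auto
      then have Q: "Q \<in> sets (F s)" using D[OF s] measurable_sets[OF Zad[OF s0(1)], of "{..<-c}"] by auto
      have PM: "P \<in> sets M" "Q \<in> sets M" using P Q s0 sets_F_M by blast+
      have i[simp]: "integrable M (\<lambda>w. indicator P w * c)" "integrable M (\<lambda>w. indicator Q w * c)"
        by (rule iB[OF PM(1)], simp) (rule iB[OF PM(2)], simp)
      have iP[simp]: "integrable M (\<lambda>w. indicator P w * Z r w)" "integrable M (\<lambda>w. indicator Q w * Z r w)"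
        if "0 \<le> r" for r using PM Zint[OF that] by (auto intro!: iB)
      have eqP: "(LINT w|M. indicator P w * Z s w) = (LINT w|M. indicator P w * Z v w)"
        "(LINT w|M. indicator Q w * Z s w) = (LINT w|M. indicator Q w * Z v w)"
        using Zeq[OF s0 P] Zeq[OF s0 Q] by (simp_all add: set_lebesgue_integral_def)
      have expand: "(LINT w|M. indicator P w * Z r w - indicator P w * c - indicator Q w * Z r w - indicator Q w * c)
        = (LINT w|M. indicator P w * Z r w) - (LINT w|M. indicator P w * c)
        - (LINT w|M. indicator Q w * Z r w) - (LINT w|M. indicator Q w * c)" if "0 \<le> r" for r
        using that i iP by (simp only: Bochner_Integration.integral_diff Bochner_Integration.integrable_diff)
      have "(LINT w|M. indicator (?B s) w * max 0 (\<bar>Z s w\<bar> - c))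
        = (LINT w|M. indicator P w * Z s w - indicator P w * c - indicator Q w * Z s w - indicator Q w * c)"
        by (rule Bochner_Integration.integral_cong) (use c in \<open>auto simp: P_def Q_def indicator_def\<close>)
      also have "\<dots> = (LINT w|M. indicator P w * Z v w - indicator P w * c - indicator Q w * Z v w - indicator Q w * c)"
        unfolding expand[OF s0(1)] expand[OF v0] eqP ..
      also have "\<dots> \<le> (LINT w|M. indicator (?B s) w * max 0 (\<bar>Z v w\<bar> - c))"
      proof (rule integral_mono)
        show "integrable M (\<lambda>w. indicator (?B s) w * max 0 (\<bar>Z v w\<bar> - c))"
          using BM[OF s] int[OF Zint[OF v0]] by (rule iB)
        show "indicator P w * Z v w - indicator P w * c - indicator Q w * Z v w - indicator Q w * c
          \<le> indicator (?B s) w * max 0 (\<bar>Z v w\<bar> - c)" if "w \<in> space M" for w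
          using that c by (auto simp: P_def Q_def indicator_def)
        show "integrable M (\<lambda>w. indicator P w * Z v w - indicator P w * c - indicator Q w * Z v w - indicator Q w * c)"
          by (intro Bochner_Integration.integrable_diff i iP v0)
      qed
      finally show ?thesis .
    qed
    have "(LINT w|M. max 0 (\<bar>Z (D w) w\<bar> - c))
      = (LINT w|M. (\<Sum>s\<in>S. indicator (?B s) w * max 0 (\<bar>Z s w\<bar> - c)))"
      by (rule Bochner_Integration.integral_cong[OF refl decomp[of _ "\<lambda>s w. max 0 (\<bar>Z s w\<bar> - c)"]])
    also have "\<dots> = (\<Sum>s\<in>S. LINT w|M. indicator (?B s) w * max 0 (\<bar>Z s w\<bar> - c))"
      by (intro Bochner_Integration.integral_sum iB BM int Zint) (use S in auto)
    also have "\<dots> \<le> (\<Sum>s\<in>S. LINT w|M. indicator (?B s) w * max 0 (\<bar>Z v w\<bar> - c))"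
      by (rule sum_mono) (rule le)
    also have "\<dots> = (LINT w|M. (\<Sum>s\<in>S. indicator (?B s) w * max 0 (\<bar>Z v w\<bar> - c)))"
      by (intro Bochner_Integration.integral_sum[symmetric] iB BM int Zint v0)
    also have "\<dots> = (LINT w|M. max 0 (\<bar>Z v w\<bar> - c))"
      by (rule Bochner_Integration.integral_cong[OF refl decomp[of _ "\<lambda>s w. max 0 (\<bar>Z v w\<bar> - c)", symmetric]])
    finally show ?thesis .
  qed
qed

text \<open>\<open>T\<close> is approximated from the right by the next point \<open>D m\<close> of
  a uniform grid on [u, v]; right continuity gives pointwise convergence, and the bound on truncated
  excesses by those of \<open>Z v\<close> passes to the integrals.\<close>

lemma optional_stopping:
  fixes Z :: "real \<Rightarrow> 'a \<Rightarrow> real"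
  assumes Z: "martingale M F Z" and u: "0 \<le> u" "u \<le> v"
    and T: "\<And>s. u \<le> s \<Longrightarrow> s \<le> v \<Longrightarrow> {w\<in>space M. T w \<le> s} \<in> sets (F s)"
    and Tb: "\<And>w. w \<in> space M \<Longrightarrow> u \<le> T w \<and> T w \<le> v"
    and rc: "AE w in M. \<forall>s. u \<le> s \<longrightarrow> s < v \<longrightarrow> ((\<lambda>r. Z r w) \<longlongrightarrow> Z s w) (at_right s)"
    and meas: "(\<lambda>w. Z (T w) w) \<in> borel_measurable M"
    and A: "A \<in> sets (F u)"
  shows "integrable M (\<lambda>w. Z (T w) w)" "(LINT w:A|M. Z (T w) w) = (LINT w:A|M. Z v w)"
proof -
  define \<delta> where "\<delta> m = (v - u) / real (Suc m)" for m :: nat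
  have \<delta>0: "0 \<le> \<delta> m" for m using u by (simp add: \<delta>_def)
  define t where "t m j = u + \<delta> m * real j" for m j :: nat
  define J where "J m w = (LEAST j. T w \<le> t m j)" for m w
  define D where "D m w = t m (J m w)" for m w
  have tlast: "t m (Suc m) = v" for m by (simp add: t_def \<delta>_def)
  have tmono: "t m i \<le> t m j" if "i \<le> j" for m i j
    using that \<delta>0[of m] by (simp add: t_def mult_left_mono)
  have t_u: "u \<le> t m j" for m j using \<delta>0[of m] by (simp add: t_def)
  have TJ: "T w \<le> D m w" and J_le: "J m w \<le> Suc m" if "w \<in> space M" for m w
  proof -
    have "T w \<le> t m (Suc m)" using tlast Tb[OF that] by simp
    then show "T w \<le> D m w" "J m w \<le> Suc m" unfolding D_def J_def by (rule LeastI, rule Least_le)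
  qed
  have D_le: "D m w \<le> T w + \<delta> m" if w: "w \<in> space M" for m w
  proof (cases "J m w")
    case 0
    then show ?thesis using Tb[OF w] \<delta>0[of m] by (simp add: D_def t_def)
  next
    case (Suc j)
    then have "\<not> T w \<le> t m j" using not_less_Least[of j "\<lambda>j. T w \<le> t m j"] by (simp add: J_def)
    then show ?thesis using Suc by (simp add: D_def t_def algebra_simps)
  qed
  have DJ: "{w\<in>space M. D m w = s} \<in> sets (F s)" if s: "s \<in> t m ` {..Suc m}" for m s
  proof -
    have s_uv: "u \<le> s" "s \<le> v" using s t_u tmono[of _ "Suc m" m] tlast by auto
    \<comment> \<open>Grid points coincide when \<open>u = v\<close>, so the event is described by
      the grid values below \<open>s\<close> and not by the preceding index.\<close>
    have "{w\<in>space M. D m w = s}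
      = {w\<in>space M. T w \<le> s} - (\<Union>j\<in>{j. j \<le> Suc m \<and> t m j < s}. {w\<in>space M. T w \<le> t m j})" (is "?L = ?R")
    proof (rule set_eqI)
      fix w show "w \<in> ?L \<longleftrightarrow> w \<in> ?R"
      proof
        assume L: "w \<in> ?L"
        then have w: "w \<in> space M" and e: "t m (J m w) = s" by (auto simp: D_def)
        have "\<not> T w \<le> t m j" if "t m j < s" for j
        proof -
          have "j < J m w" using that e tmono[of "J m w" j m] by (metis leI linorder_not_less)
          then show ?thesis unfolding J_def by (rule not_less_Least)
        qed
        then show "w \<in> ?R" using w TJ[OF w, of m] e by (auto simp: D_def)
      next
        assume R: "w \<in> ?R"
        then have w: "w \<in> space M" by auto
        obtain j where j: "s = t m j" "j \<le> Suc m" using s by auto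
        have "J m w \<le> j" unfolding J_def by (rule Least_le) (use R j in auto)
        then have "D m w \<le> s" using tmono j by (simp add: D_def)
        moreover have "\<not> D m w < s" using R J_le[OF w] TJ[OF w, of m] by (auto simp: D_def)
        ultimately show "w \<in> ?L" using w by auto
      qed
    qed
    moreover have "{w\<in>space M. T w \<le> t m j} \<in> sets (F s)" if "t m j < s" for j
      by (rule sets_F_mono[OF _ _ T]) (use that t_u[of m j] u s_uv in auto)
    ultimately show ?thesis using T[OF s_uv] by auto
  qed
  have DS: "D m w \<in> t m ` {..Suc m}" if "w \<in> space M" for m w
    using J_le[OF that] by (auto simp: D_def)
  have Sb: "0 \<le> s \<and> s \<le> v" if sS: "s \<in> t m ` {..Suc m}" for m s
  proof -
    obtain j where "j \<in> {..Suc m}" and s: "s = t m j" using sS by blast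
    then have j: "j \<le> Suc m" by (simp only: atMost_iff)
    with s show ?thesis using t_u[of m j] u(1) tmono[OF j, of m] tlast[of m] by auto
  qed
  have fin_int: "integrable M (\<lambda>w. Z (D m w) w)" for m
    by (rule optional_stopping_finite(1)[OF Z finite_imageI[OF finite_atMost] Sb[of _ m] DJ[of _ m] DS[of _ m]])
  have fin_eq: "(LINT w:A|M. Z (D m w) w) = (LINT w:A|M. Z v w)" for m
    by (rule optional_stopping_finite(2)[OF Z finite_imageI[OF finite_atMost] Sb[of _ m] DJ[of _ m] DS[of _ m] u(1) _ A])
      (use t_u in auto)
  have AM: "A \<in> sets M" using A u sets_F_M by blast
  have Zv: "integrable M (Z v)" using Z u by (auto simp: martingale_def)
  have lim: "AE w in M. (\<lambda>m. Z (D m w) w) \<longlonglongrightarrow> Z (T w) w"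
    using rc AE_space
  proof eventually_elim
    case (elim w)
    note w = elim(2)
    show ?case
    proof (cases "T w < v")
      case False
      then have "D m w = T w" for m
        using TJ[OF w, of m] Tb[OF w] Sb[OF DS[OF w], of m] by linarith
      then show ?thesis by simp
    next
      case True
      have r: "((\<lambda>r. Z r w) \<longlongrightarrow> Z (T w) w) (at_right (T w))" using elim(1) Tb[OF w] True by auto
      show ?thesis
      proof (rule LIMSEQ_I)
        fix e :: real assume e: "0 < e"
        have "\<forall>\<^sub>F r in at_right (T w). dist (Z r w) (Z (T w) w) < e" using tendstoD[OF r e] .
        then obtain b where b: "b > T w" "\<And>r. T w < r \<Longrightarrow> r < b \<Longrightarrow> dist (Z r w) (Z (T w) w) < e"
          unfolding eventually_at_right_field by auto
        obtain no where no: "(v - u) / (b - T w) < real no" using reals_Archimedean2 by blast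
        show "\<exists>no. \<forall>m\<ge>no. norm (Z (D m w) w - Z (T w) w) < e"
        proof (intro exI allI impI)
          fix m assume "no \<le> m"
          then have "(v - u) / (b - T w) < real (Suc m)" using no by simp
          then have "\<delta> m < b - T w" using b(1) by (simp add: \<delta>_def field_simps)
          then have "D m w < b" using D_le[OF w, of m] by simp
          then show "norm (Z (D m w) w - Z (T w) w) < e"
            using b(2)[of "D m w"] TJ[OF w, of m] e by (cases "D m w = T w") (auto simp: dist_norm)
        qed
      qed
    qed
  qed
  have bound: "(LINT w|M. max 0 (\<bar>Z (D m w) w\<bar> - c)) \<le> (LINT w|M. max 0 (\<bar>Z v w\<bar> - c))" if "0 \<le> c" for m c
    by (rule optional_stopping_finite(3)[OF Z finite_imageI[OF finite_atMost] Sb[of _ m] DJ[of _ m] DS[of _ m] that])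
  show int: "integrable M (\<lambda>w. Z (T w) w)"
    by (rule integral_convergence_clipped(1)[OF fin_int meas lim Zv bound])
  \<comment> \<open>Multiplying by an indicator only lowers the truncated excess, so the bound by
    \<open>Z v\<close> applies again.\<close>
  have "(\<lambda>m. LINT w|M. indicator A w * Z (D m w) w) \<longlonglongrightarrow> (LINT w|M. indicator A w * Z (T w) w)"
  proof (rule integral_convergence_clipped(2)[OF _ _ _ Zv])
    show iD: "integrable M (\<lambda>w. indicator A w * Z (D m w) w)" for m
      using integrable_mult_indicator[OF AM fin_int] by simp
    show "(\<lambda>w. indicator A w * Z (T w) w) \<in> borel_measurable M" using AM meas by simp
    show "AE w in M. (\<lambda>m. indicator A w * Z (D m w) w) \<longlonglongrightarrow> indicator A w * Z (T w) w"
      using lim by eventually_elim (intro tendsto_intros)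
    show "(LINT w|M. max 0 (\<bar>indicator A w * Z (D m w) w\<bar> - c)) \<le> (LINT w|M. max 0 (\<bar>Z v w\<bar> - c))"
      if c: "0 \<le> c" for m c
    proof (rule order_trans[OF integral_mono bound[OF c, of m]])
      have "integrable M (\<lambda>w. max 0 (\<bar>k w\<bar> - c))" if "integrable M k" for k :: "'a \<Rightarrow> real"
        by (rule Bochner_Integration.integrable_bound[OF that(1)])
          (use c borel_measurable_integrable[OF that] in auto)
      then show "integrable M (\<lambda>w. max 0 (\<bar>indicator A w * Z (D m w) w\<bar> - c))"
        "integrable M (\<lambda>w. max 0 (\<bar>Z (D m w) w\<bar> - c))" using iD fin_int by blast+
    qed (use c in \<open>auto simp: indicator_def\<close>)
  qed
  moreover have "(LINT w|M. indicator A w * Z (D m w) w) = (LINT w:A|M. Z v w)" for m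
    using fin_eq[of m] by (simp add: set_lebesgue_integral_def)
  ultimately have "(\<lambda>m::nat. LINT w:A|M. Z v w) \<longlonglongrightarrow> (LINT w|M. indicator A w * Z (T w) w)" by simp
  then show "(LINT w:A|M. Z (T w) w) = (LINT w:A|M. Z v w)"
    by (simp add: LIMSEQ_const_iff set_lebesgue_integral_def)
qed

end

section \<open>The compensator of a single jump\<close>

lemma tendsto_at_right_set_integral:
  fixes f :: "real \<Rightarrow> real"
  assumes f: "set_integrable lborel {0..v} f" and s: "0 \<le> s" "s < v"
  shows "((\<lambda>r. LINT x:{0..r}|lborel. f x) \<longlongrightarrow> (LINT x:{0..s}|lborel. f x)) (at_right s)"
proof -
  have eq: "(LINT x:{0..r}|lborel. f x) = integral {0..r} f" if "r \<le> v" for r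
    by (rule set_borel_integral_eq_integral(2), rule set_integrable_subset[OF f]) (use that in auto)
  have "f integrable_on {0..v}" using set_borel_integral_eq_integral(1)[OF f] .
  then have "continuous_on {0..v} (\<lambda>x. integral {0..x} f)" by (rule indefinite_integral_continuous_1)
  then have "((\<lambda>x. integral {0..x} f) \<longlongrightarrow> integral {0..s} f) (at s within {0..v})"
    using s by (auto simp: continuous_on_def)
  then have "((\<lambda>x. integral {0..x} f) \<longlongrightarrow> integral {0..s} f) (at s within {s..v})"
    by (rule tendsto_within_subset) (use s in auto)
  then have "((\<lambda>x. integral {0..x} f) \<longlongrightarrow> integral {0..s} f) (at_right s)"
    using s by (simp add: at_within_Icc_at_right)
  moreover have "\<forall>\<^sub>F r in at_right s. integral {0..r} f = (LINT x:{0..r}|lborel. f x)"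
    unfolding eventually_at_right_field by (intro exI[of _ v]) (use s eq in auto)
  ultimately show ?thesis using eq[of s] s by (auto intro: Lim_transform_eventually)
qed

locale counting_intensity = filtered_prob_space M F for M :: "'a measure" and F +
  fixes N :: "real \<Rightarrow> 'a \<Rightarrow> real" and a :: "real \<times> 'a \<Rightarrow> real" and t :: real
  assumes N: "counting_process F M N"
    and a_meas [measurable]: "a \<in> borel_measurable predS"
    and a_nonneg: "\<And>s w. 0 \<le> s \<Longrightarrow> w \<in> space M \<Longrightarrow> 0 \<le> a (s, w)"
    and a_int: "\<And>u. 0 \<le> u \<Longrightarrow> AE w in M. set_integrable lborel {0..u} (\<lambda>s. a (s, w))"
    and mart: "martingale M F (\<lambda>u w. N u w - (LINT s:{0..u}|lborel. a (s, w)))"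
    and t: "0 \<le> t"
begin

text \<open>The horizon \<open>t + 1\<close> lies beyond \<open>t\<close>, so
  \<open>T m w \<le> t\<close> means a genuine jump (or \<open>m = 0\<close>) and never the
  cap.\<close>

definition T :: "nat \<Rightarrow> 'a \<Rightarrow> real" where "T m w = jump_time (t + 1) (\<lambda>s. N s w) m"

lemma path: "w \<in> space M \<Longrightarrow> counting_path (\<lambda>s. N s w)"
  using N by (auto simp: counting_process_def)

lemma N_meas: "0 \<le> s \<Longrightarrow> N s \<in> borel_measurable (F s)"
  using N by (auto simp: counting_process_def adapted_def)

lemma T_le_iff: "w \<in> space M \<Longrightarrow> 0 \<le> s \<Longrightarrow> s \<le> t \<Longrightarrow> T m w \<le> s \<longleftrightarrow> real m \<le> N s w"
  unfolding T_def by (rule jump_time_le_iff[OF path]) auto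

lemma T_bounds: "0 \<le> T m w" "T m w \<le> t + 1"
  unfolding T_def using jump_time_bounds[of "t + 1"] t by auto

lemma T_0: "w \<in> space M \<Longrightarrow> T 0 w = 0"
  unfolding T_def using jump_time_0[OF path] t by auto

lemma T_pos: "w \<in> space M \<Longrightarrow> 0 < T (Suc m) w"
  unfolding T_def using jump_time_pos[OF path] t by auto

lemma T_mono: "w \<in> space M \<Longrightarrow> m \<le> m' \<Longrightarrow> T m w \<le> T m' w"
  unfolding T_def using jump_time_mono[OF path] t by auto

lemma T_strict_mono: "w \<in> space M \<Longrightarrow> m < m' \<Longrightarrow> T m' w \<le> t \<Longrightarrow> T m w < T m' w"
  unfolding T_def using jump_time_strict_mono[OF path] t by auto

lemma N_T: "w \<in> space M \<Longrightarrow> T (Suc m) w \<le> t \<Longrightarrow> N (T (Suc m) w) w = real (Suc m)"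
  unfolding T_def using jump_time_value[OF path, of w "t + 1" "Suc m"] t by auto

lemma T_stopping:
  assumes q: "0 \<le> q" shows "{w\<in>space M. T m w \<le> q} \<in> sets (F q)"
proof -
  consider "q \<le> t" | "t < q" "q < t + 1" | "t + 1 \<le> q" by linarith
  then show ?thesis
  proof cases
    case 3
    then have "{w\<in>space M. T m w \<le> q} = space (F q)" using T_bounds(2)[of m] q by (auto intro: order_trans)
    then show ?thesis by simp
  next
    case 1
    then have "{w\<in>space M. T m w \<le> q} = N q -` {real m..} \<inter> space (F q)" using T_le_iff q by auto
    then show ?thesis using measurable_sets[OF N_meas[OF q], of "{real m..}"] by simp
  next
    case 2
    then have "{w\<in>space M. T m w \<le> q} = N q -` {real m..} \<inter> space (F q)"
      unfolding T_def using jump_time_le_iff[OF path q] q by auto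
    then show ?thesis using measurable_sets[OF N_meas[OF q], of "{real m..}"] by simp
  qed
qed

lemma T_meas [measurable]: "T m \<in> borel_measurable M"
proof (rule borel_measurableI_le)
  fix q show "{w\<in>space M. T m w \<le> q} \<in> sets M"
  proof (cases "0 \<le> q")
    case True
    show ?thesis by (rule sets_F_M[OF True T_stopping[OF True]])
  next
    case False
    then have "\<not> T m w \<le> q" for w using T_bounds(1)[of m w] by linarith
    then have "{w\<in>space M. T m w \<le> q} = {}" by blast
    then show ?thesis by (simp only: sets.empty_sets)
  qed
qed

lemma a_pair [measurable]: "(\<lambda>(w, r). a (max 0 r, w)) \<in> borel_measurable (M \<Otimes>\<^sub>M borel)"
  using measurable_compose[OF measurable_pred_pair a_meas] by (simp add: split_def)

text \<open>Optional stopping is applied at \<open>T m\<close> and \<open>T (Suc m)\<close>, both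
  clamped to [u, v]. Between the clamped times \<open>N\<close> rises by one if the jump falls into
  {u<..v} and is constant otherwise, so on \<open>A\<close> the increment of the compensator has the
  probability of that jump as its mean.\<close>

lemma compensator_rectangle:
  assumes uv: "0 \<le> u" "u \<le> v" "v \<le> t" and A: "A \<in> sets (F u)"
  shows "(\<integral>\<^sup>+w. indicator A w * indicator {u<..v} (T (Suc m) w) \<partial>M)
    = (\<integral>\<^sup>+w. indicator A w * (\<integral>\<^sup>+s. indicator {u<..v} s * indicator {T m w<..T (Suc m) w} s * ennreal (a (max 0 s, w)) \<partial>lborel) \<partial>M)"
proof -
  define L where "L s w = (LINT x:{0..s}|lborel. a (x, w))" for s w
  define Z where "Z s w = N s w - L s w" for s w
  define S where "S k w = max u (min v (T k w))" for k w
  have Zm: "martingale M F Z" unfolding Z_def L_def using mart .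
  have S_meas [measurable]: "S k \<in> borel_measurable M" for k unfolding S_def by measurable
  have S_b: "u \<le> S k w \<and> S k w \<le> v" for k w using uv by (auto simp: S_def)
  have S_mono: "w \<in> space M \<Longrightarrow> S m w \<le> S (Suc m) w" for w using T_mono[of w m "Suc m"] by (auto simp: S_def)
  have [measurable]: "A \<in> sets M" using A uv sets_F_M by blast
  have v0: "0 \<le> v" using uv by simp
  have [measurable]: "N u \<in> borel_measurable M" "N v \<in> borel_measurable M"
    by (rule measurable_F_M[OF uv(1) N_meas[OF uv(1)]], rule measurable_F_M[OF v0 N_meas[OF v0]])
  \<comment> \<open>Clamping the time to [u, v] amounts to clamping the count \<open>k\<close> to
    the interval from \<open>N u w\<close> to \<open>N v w\<close>.\<close>
  have NS: "N (S k w) w = max (N u w) (min (N v w) (real k))" if w: "w \<in> space M" for k w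
  proof -
    have Nuv: "N u w \<le> N v w" using counting_path_mono[OF path[OF w]] uv by auto
    have iu: "T k w \<le> u \<longleftrightarrow> real k \<le> N u w" and iv: "T k w \<le> v \<longleftrightarrow> real k \<le> N v w"
      using T_le_iff[OF w, of u k] T_le_iff[OF w, of v k] uv by auto
    show ?thesis
    proof (cases "T k w \<le> u")
      case True then show ?thesis using uv iu Nuv by (auto simp: S_def)
    next
      case False
      show ?thesis
      proof (cases "T k w \<le> v")
        case True
        have "k \<noteq> 0" using False T_0[OF w] uv by (cases k) auto
        then obtain k' where k': "k = Suc k'" by (cases k) auto
        have "N (T k w) w = real k" unfolding k' by (rule N_T[OF w]) (use True uv k' in auto)
        then show ?thesis using False True iu iv by (auto simp: S_def)
      next
        case False
        then show ?thesis using uv iv Nuv by (auto simp: S_def)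
      qed
    qed
  qed
  have ind: "N (S (Suc m) w) w - N (S m w) w = indicator {u<..v} (T (Suc m) w)" if w: "w \<in> space M" for w
  proof -
    obtain i where i: "N u w = real i" using counting_path_nat[OF path[OF w]] uv by auto
    obtain j where j: "N v w = real j" using counting_path_nat[OF path[OF w], of v] uv by auto
    have "T (Suc m) w \<le> u \<longleftrightarrow> Suc m \<le> i" "T (Suc m) w \<le> v \<longleftrightarrow> Suc m \<le> j"
      using T_le_iff[OF w, of u "Suc m"] T_le_iff[OF w, of v "Suc m"] uv i j by auto
    moreover have "i \<le> j" using counting_path_mono[OF path[OF w], of u v] uv i j by auto
    ultimately show ?thesis unfolding NS[OF w] i j by (auto simp: indicator_def)
  qed
  have L_meas [measurable]: "(\<lambda>w. L (S k w) w) \<in> borel_measurable M" for k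
  proof -
    have "(\<lambda>w. LINT x|lborel. (if 0 \<le> x \<and> x \<le> S k w then 1 else 0) * a (max 0 x, w)) \<in> borel_measurable M"
      by measurable
    moreover have "L (S k w) w = (LINT x|lborel. (if 0 \<le> x \<and> x \<le> S k w then 1 else 0) * a (max 0 x, w))" for w
      unfolding L_def set_lebesgue_integral_def
      by (rule Bochner_Integration.integral_cong) (auto simp: indicator_def)
    ultimately show ?thesis by simp
  qed
  have Z_meas: "(\<lambda>w. Z (S k w) w) \<in> borel_measurable M" for k
    unfolding Z_def by (rule borel_measurable_diff[OF _ L_meas]) (simp add: NS cong: measurable_cong)
  have rc: "AE w in M. \<forall>s. u \<le> s \<longrightarrow> s < v \<longrightarrow> ((\<lambda>r. Z r w) \<longlongrightarrow> Z s w) (at_right s)"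
    using a_int[OF v0] AE_space
  proof eventually_elim
    case (elim w)
    show ?case
    proof (intro allI impI)
      fix s assume s: "u \<le> s" "s < v"
      then have s0: "0 \<le> s" using uv by auto
      show "((\<lambda>r. Z r w) \<longlongrightarrow> Z s w) (at_right s)"
        unfolding Z_def L_def
        by (intro tendsto_diff tendsto_at_right_set_integral[OF _ s0 s(2)]
              counting_path_right[OF path[OF elim(2)] s0] elim(1))
    qed
  qed
  have S_stop: "{w\<in>space M. S k w \<le> s} \<in> sets (F s)" if s: "u \<le> s" "s \<le> v" for k s
  proof (cases "s = v")
    case True
    then have "{w\<in>space M. S k w \<le> s} = space (F s)" using S_b uv by auto
    then show ?thesis by simp
  next
    case False
    then have "{w\<in>space M. S k w \<le> s} = {w\<in>space M. T k w \<le> s}" using s by (auto simp: S_def)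
    then show ?thesis using T_stopping[of s] s uv by simp
  qed
  note os = optional_stopping[OF Zm uv(1,2) S_stop S_b rc Z_meas A]
  have iZ: "integrable M (\<lambda>w. indicator A w * Z (S k w) w)" for k
    using integrable_mult_indicator[OF \<open>A \<in> sets M\<close> os(1)] by simp
  have iN: "integrable M (\<lambda>w. indicator A w * indicator {u<..v} (T (Suc m) w) :: real)"
    by (rule integrable_const_bound[of _ 1]) (auto simp: indicator_def)
  have Ldiff: "indicator A w * (L (S (Suc m) w) w - L (S m w) w)
    = indicator A w * indicator {u<..v} (T (Suc m) w)
      - (indicator A w * Z (S (Suc m) w) w - indicator A w * Z (S m w) w)" if "w \<in> space M" for w
    unfolding ind[OF that, symmetric] Z_def by (simp add: algebra_simps)
  \<comment> \<open>\<open>L\<close> itself may fail to be integrable; its increment over one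
    interjump interval equals a bounded indicator minus a difference of stopped martingales.\<close>
  have iL: "integrable M (\<lambda>w. indicator A w * (L (S (Suc m) w) w - L (S m w) w))"
    by (subst Bochner_Integration.integrable_cong[OF refl Ldiff], assumption)
      (intro Bochner_Integration.integrable_diff iN iZ)
  have "(LINT w|M. indicator A w * (L (S (Suc m) w) w - L (S m w) w))
    = (LINT w|M. indicator A w * indicator {u<..v} (T (Suc m) w)
      - (indicator A w * Z (S (Suc m) w) w - indicator A w * Z (S m w) w))"
    by (rule Bochner_Integration.integral_cong[OF refl Ldiff])
  also have "\<dots> = (LINT w|M. indicator A w * indicator {u<..v} (T (Suc m) w))"
    using os(2) by (simp add: Bochner_Integration.integral_diff iN iZ set_lebesgue_integral_def)
  finally have eqI: "(LINT w|M. indicator A w * (L (S (Suc m) w) w - L (S m w) w))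
    = (LINT w|M. indicator A w * indicator {u<..v} (T (Suc m) w))" .
  have inner: "AE w in M.
      (\<integral>\<^sup>+s. indicator {u<..v} s * indicator {T m w<..T (Suc m) w} s * ennreal (a (max 0 s, w)) \<partial>lborel)
      = ennreal (L (S (Suc m) w) w - L (S m w) w) \<and> 0 \<le> L (S (Suc m) w) w - L (S m w) w"
    using a_int[OF v0] AE_space
  proof eventually_elim
    case (elim w)
    note w = elim(2)
    have sub: "set_integrable lborel B (\<lambda>s. a (s, w))" if "B \<in> sets lborel" "B \<subseteq> {0..v}" for B
      by (rule set_integrable_subset[OF elim(1) that])
    have Sb: "0 \<le> S m w" "S m w \<le> S (Suc m) w" "S (Suc m) w \<le> v"
      using S_b[of m w] S_b[of "Suc m" w] S_mono[OF w] uv by auto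
    have un: "{0..S (Suc m) w} = {0..S m w} \<union> {S m w<..S (Suc m) w}" using Sb by auto
    have "L (S (Suc m) w) w = L (S m w) w + (LINT s:{S m w<..S (Suc m) w}|lborel. a (s, w))"
      unfolding L_def un by (rule set_integral_Un) (use Sb in \<open>auto intro!: sub\<close>)
    then have d: "L (S (Suc m) w) w - L (S m w) w = (LINT s:{S m w<..S (Suc m) w}|lborel. a (s, w))" by simp
    have nn: "0 \<le> indicator {S m w<..S (Suc m) w} s *\<^sub>R a (s, w)" for s
      using a_nonneg[OF _ w, of s] Sb by (auto simp: indicator_def)
    have "(\<integral>\<^sup>+s. indicator {u<..v} s * indicator {T m w<..T (Suc m) w} s * ennreal (a (max 0 s, w)) \<partial>lborel)
      = (\<integral>\<^sup>+s. ennreal (indicator {S m w<..S (Suc m) w} s *\<^sub>R a (s, w)) \<partial>lborel)"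
    proof (rule nn_integral_cong)
      fix s
      have "u < s \<and> s \<le> v \<and> T m w < s \<and> s \<le> T (Suc m) w \<longleftrightarrow> S m w < s \<and> s \<le> S (Suc m) w"
        using uv unfolding S_def by linarith
      moreover have "s > 0" if "u < s" using that uv by simp
      ultimately show "indicator {u<..v} s * indicator {T m w<..T (Suc m) w} s * ennreal (a (max 0 s, w))
        = ennreal (indicator {S m w<..S (Suc m) w} s *\<^sub>R a (s, w))"
        by (cases "u < s \<and> s \<le> v \<and> T m w < s \<and> s \<le> T (Suc m) w") (auto simp: indicator_def)
    qed
    also have "\<dots> = ennreal (LINT s:{S m w<..S (Suc m) w}|lborel. a (s, w))"
      unfolding set_lebesgue_integral_def
    proof (rule nn_integral_eq_integral)
      have "{S m w<..S (Suc m) w} \<subseteq> {0..v}" using Sb by auto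
      then show "integrable lborel (\<lambda>s. indicator {S m w<..S (Suc m) w} s *\<^sub>R a (s, w))"
        using sub[of "{S m w<..S (Suc m) w}"] by (simp add: set_integrable_def)
    qed (use nn in auto)
    finally show ?case unfolding d using nn by (auto simp: set_lebesgue_integral_def intro!: integral_nonneg_AE)
  qed
  have "(\<integral>\<^sup>+w. indicator A w * (\<integral>\<^sup>+s. indicator {u<..v} s * indicator {T m w<..T (Suc m) w} s * ennreal (a (max 0 s, w)) \<partial>lborel) \<partial>M)
    = (\<integral>\<^sup>+w. ennreal (indicator A w * (L (S (Suc m) w) w - L (S m w) w)) \<partial>M)"
    by (rule nn_integral_cong_AE, use inner in eventually_elim) (auto simp: indicator_def)
  also have "\<dots> = ennreal (LINT w|M. indicator A w * (L (S (Suc m) w) w - L (S m w) w))"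
    by (rule nn_integral_eq_integral[OF iL], use inner in eventually_elim) (auto simp: indicator_def)
  also have "\<dots> = (\<integral>\<^sup>+w. ennreal (indicator A w * indicator {u<..v} (T (Suc m) w)) \<partial>M)"
    unfolding eqI by (rule nn_integral_eq_integral[symmetric, OF iN]) auto
  also have "\<dots> = (\<integral>\<^sup>+w. indicator A w * indicator {u<..v} (T (Suc m) w) \<partial>M)"
    by (rule nn_integral_cong) (auto simp: indicator_def)
  finally show ?thesis ..
qed

section \<open>From rectangles to all predictable sets\<close>

lemma Int_stable_pred_gens: "Int_stable pred_gens"
proof (rule Int_stableI)
  fix A B assume A: "A \<in> pred_gens" and B: "B \<in> pred_gens"
  have z: "{0::real} \<times> C \<inter> {0} \<times> D = {0} \<times> (C \<inter> D)" "{0::real} \<times> C \<inter> {s<..r} \<times> D = {0} \<times> {}"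
    "{s<..r} \<times> D \<inter> {0::real} \<times> C = {0} \<times> {}" if "0 \<le> s" for C D :: "'a set" and s r using that by auto
  \<comment> \<open>The outer \<open>max\<close> keeps the right end from falling below the left
    one, so that an empty intersection is a generator as well.\<close>
  have i: "{s<..r} \<times> C \<inter> {s'<..r'} \<times> D = {max s s'<..max (max s s') (min r r')} \<times> (C \<inter> D)"
    for C D :: "'a set" and s r s' r' :: real by (auto simp: max_def min_def)
  have m: "C \<inter> D \<in> sets (F (max s s'))" if "0 \<le> s" "0 \<le> s'" "C \<in> sets (F s)" "D \<in> sets (F s')" for s s' C D
    using sets_F_mono[OF that(1) _ that(3), of "max s s'"] sets_F_mono[OF that(2) _ that(4), of "max s s'"] by auto
  from A consider A1 where "A = {0} \<times> A1" "A1 \<in> sets (F 0)"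
    | s1 t1 A1 where "A = {s1<..t1} \<times> A1" "0 \<le> s1" "s1 \<le> t1" "A1 \<in> sets (F s1)" by blast
  note cA = this
  from B consider A1 where "B = {0} \<times> A1" "A1 \<in> sets (F 0)"
    | s1 t1 A1 where "B = {s1<..t1} \<times> A1" "0 \<le> s1" "s1 \<le> t1" "A1 \<in> sets (F s1)" by blast
  note cB = this
  have gen0: "{0} \<times> C \<in> pred_gens" if "C \<in> sets (F 0)" for C using that by blast
  have gen1: "{s<..r} \<times> C \<in> pred_gens" if "0 \<le> s" "s \<le> r" "C \<in> sets (F s)" for s r C using that by blast
  have e: "{} \<in> sets (F 0)" by simp
  show "A \<inter> B \<in> pred_gens"
  proof (cases rule: cA)
    case (1 A1)
    note a = 1
    show ?thesis
    proof (cases rule: cB)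
      case (1 B1)
      show ?thesis unfolding a(1) 1(1) z(1)[OF order_refl]
        by (rule gen0) (rule sets.Int[OF a(2) 1(2)])
    next
      case (2 s2 t2 B1)
      show ?thesis unfolding a(1) 2(1) z(2)[OF 2(2)] by (rule gen0[OF e])
    qed
  next
    case (2 s1 t1 A1)
    note a = 2
    show ?thesis
    proof (cases rule: cB)
      case (1 B1)
      show ?thesis unfolding a(1) 1(1) z(3)[OF a(2)] by (rule gen0[OF e])
    next
      case (2 s2 t2 B1)
      show ?thesis unfolding a(1) 2(1) i
        by (rule gen1[OF _ _ m[OF a(2) 2(2) a(4) 2(4)]]) (use a(2) in simp_all)
    qed
  qed
qed

text \<open>The Doleans measure of a single jump on the predictable sigma-algebra. Its equality with
  \<open>intensity_measure\<close> is the compensator formula for all nonnegative predictable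
  integrands at once.\<close>

definition jump_measure :: "nat \<Rightarrow> (real \<times> 'a) measure" where
  "jump_measure m = distr (density M (\<lambda>w. indicator {..t} (T (Suc m) w))) predS (\<lambda>w. (T (Suc m) w, w))"

definition intensity_measure :: "nat \<Rightarrow> (real \<times> 'a) measure" where
  "intensity_measure m = distr (density (M \<Otimes>\<^sub>M lborel)
     (\<lambda>(w, s). indicator {T m w<..min t (T (Suc m) w)} s * ennreal (a (max 0 s, w)))) predS
     (\<lambda>(w, s). (max 0 s, w))"

lemma density_meas [measurable]:
  "(\<lambda>(w, s). indicator {T m w<..min t (T (Suc m) w)} s * ennreal (a (max 0 s, w)))
    \<in> borel_measurable (M \<Otimes>\<^sub>M lborel)"
proof -
  have "(\<lambda>(w, s). (if T m w < s \<and> s \<le> min t (T (Suc m) w) then 1 else 0) * ennreal (a (max 0 s, w)))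
    \<in> borel_measurable (M \<Otimes>\<^sub>M borel)" by measurable
  also have "(\<lambda>(w, s). (if T m w < s \<and> s \<le> min t (T (Suc m) w) then 1 else 0) * ennreal (a (max 0 s, w)))
    = (\<lambda>(w, s). indicator {T m w<..min t (T (Suc m) w)} s * ennreal (a (max 0 s, w)))"
    by (auto simp: indicator_def fun_eq_iff)
  finally show ?thesis by (simp cong: measurable_cong_sets)
qed

lemma T_pred: "(\<lambda>w. (T m w, w)) \<in> measurable M predS"
  by (rule measurable_stopped_M) (auto simp: T_bounds)

lemma pred_pair_lborel: "(\<lambda>(w, r). (max 0 r, w)) \<in> measurable (M \<Otimes>\<^sub>M lborel) predS"
  using measurable_pred_pair by (simp cong: measurable_cong_sets)

lemma nn_integral_jump_measure:
  assumes P: "P \<in> borel_measurable predS"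
  shows "(\<integral>\<^sup>+x. P x \<partial>jump_measure m) = (\<integral>\<^sup>+w. indicator {..t} (T (Suc m) w) * P (T (Suc m) w, w) \<partial>M)"
proof -
  note [measurable] = measurable_compose[OF T_pred P]
  show ?thesis
    unfolding jump_measure_def
    by (subst nn_integral_distr) (use T_pred P in \<open>auto simp: nn_integral_density\<close>)
qed

lemma nn_integral_intensity_measure:
  assumes P: "P \<in> borel_measurable predS"
  shows "(\<integral>\<^sup>+x. P x \<partial>intensity_measure m)
    = (\<integral>\<^sup>+w. \<integral>\<^sup>+s. indicator {T m w<..min t (T (Suc m) w)} s * ennreal (a (s, w)) * P (s, w) \<partial>lborel \<partial>M)"
proof -
  note PP [measurable] = measurable_compose[OF pred_pair_lborel P]
  have "(\<integral>\<^sup>+x. P x \<partial>intensity_measure m)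
    = (\<integral>\<^sup>+x. (case x of (w, s) \<Rightarrow> indicator {T m w<..min t (T (Suc m) w)} s * ennreal (a (max 0 s, w)))
        * P (case x of (w, s) \<Rightarrow> (max 0 s, w)) \<partial>(M \<Otimes>\<^sub>M lborel))"
    unfolding intensity_measure_def
    by (subst nn_integral_distr) (use pred_pair_lborel P PP density_meas in \<open>auto simp: nn_integral_density\<close>)
  also have "\<dots> = (\<integral>\<^sup>+w. \<integral>\<^sup>+s. indicator {T m w<..min t (T (Suc m) w)} s * ennreal (a (max 0 s, w))
      * P (max 0 s, w) \<partial>lborel \<partial>M)"
    by (subst lborel.nn_integral_fst[symmetric]) (use density_meas PP in \<open>auto intro!: borel_measurable_times\<close>)
  also have "\<dots> = (\<integral>\<^sup>+w. \<integral>\<^sup>+s. indicator {T m w<..min t (T (Suc m) w)} s * ennreal (a (s, w)) * P (s, w) \<partial>lborel \<partial>M)"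
  proof (intro nn_integral_cong)
    fix w s
    have "0 \<le> s" if "T m w < s" using T_bounds(1)[of m w] that by linarith
    then show "indicator {T m w<..min t (T (Suc m) w)} s * ennreal (a (max 0 s, w)) * P (max 0 s, w)
      = indicator {T m w<..min t (T (Suc m) w)} s * ennreal (a (s, w)) * P (s, w)"
      by (cases "T m w < s") (simp_all add: indicator_def)
  qed
  finally show ?thesis .
qed

text \<open>Both measures agree on an intersection-stable generator: on rectangles by
  \<open>compensator_rectangle\<close>, and on {0} \<times> A both vanish because jump times are
  positive. Each jump has total mass at most one, which gives the finiteness needed for
  uniqueness.\<close>

lemma jump_measure_eq: "jump_measure m = intensity_measure m"
proof (rule measure_eqI_generator_eq[OF Int_stable_pred_gens pred_gens_Pow])
  show "sets (jump_measure m) = sigma_sets ({0..} \<times> space M) pred_gens"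
    "sets (intensity_measure m) = sigma_sets ({0..} \<times> space M) pred_gens"
    by (simp_all add: jump_measure_def intensity_measure_def sets_pred)
  have em: "emeasure (jump_measure m) X = (\<integral>\<^sup>+w. indicator {..t} (T (Suc m) w) * indicator X (T (Suc m) w, w) \<partial>M)"
    "emeasure (intensity_measure m) X = (\<integral>\<^sup>+w. \<integral>\<^sup>+s. indicator {T m w<..min t (T (Suc m) w)} s * ennreal (a (s, w)) * indicator X (s, w) \<partial>lborel \<partial>M)"
    if X: "X \<in> sets predS" for X
    using nn_integral_jump_measure[of "indicator X" m] nn_integral_intensity_measure[of "indicator X" m] X
    by (auto simp: jump_measure_def intensity_measure_def)
  show "emeasure (jump_measure m) X = emeasure (intensity_measure m) X" if X: "X \<in> pred_gens" for X
  proof -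
    have Xs: "X \<in> sets predS" unfolding sets_pred using X by (rule sigma_sets.Basic)
    from X consider A1 where "X = {0} \<times> A1" "A1 \<in> sets (F 0)"
      | s1 t1 A1 where "X = {s1<..t1} \<times> A1" "0 \<le> s1" "s1 \<le> t1" "A1 \<in> sets (F s1)" by blast
    then show ?thesis
    proof cases
      case (1 A)
      have "emeasure (jump_measure m) X = (\<integral>\<^sup>+w. 0 \<partial>M)"
        unfolding em(1)[OF Xs]
      proof (rule nn_integral_cong)
        fix w assume "w \<in> space M"
        from T_pos[OF this, of m] have "(T (Suc m) w, w) \<notin> X" using 1 by auto
        then show "indicator {..t} (T (Suc m) w) * indicator X (T (Suc m) w, w) = (0::ennreal)" by simp
      qed
      moreover have "emeasure (intensity_measure m) X = (\<integral>\<^sup>+w. \<integral>\<^sup>+s. 0 \<partial>(lborel::real measure) \<partial>M)"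
        unfolding em(2)[OF Xs]
      proof (intro nn_integral_cong)
        fix w s
        have "\<not> T m w < 0" using T_bounds(1)[of m w] by simp
        then show "indicator {T m w<..min t (T (Suc m) w)} s * ennreal (a (s, w)) * indicator X (s, w) = 0"
          using 1 by (auto simp: indicator_def)
      qed
      ultimately show ?thesis by simp
    next
      case (2 u v A)
      \<comment> \<open>Neither measure charges times after \<open>t\<close>, so the rectangle is
        cut there; the outer \<open>max\<close> keeps it ordered.\<close>
      let ?v = "max u (min v t)"
      show ?thesis
      proof (cases "u \<le> t")
        case True
        have v: "u \<le> ?v" "?v \<le> t" using True by auto
        have "emeasure (jump_measure m) X = (\<integral>\<^sup>+w. indicator A w * indicator {u<..?v} (T (Suc m) w) \<partial>M)"
          unfolding em(1)[OF Xs] by (rule nn_integral_cong) (use 2 in \<open>auto simp: indicator_def\<close>)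
        also have "\<dots> = (\<integral>\<^sup>+w. indicator A w * (\<integral>\<^sup>+s. indicator {u<..?v} s * indicator {T m w<..T (Suc m) w} s * ennreal (a (max 0 s, w)) \<partial>lborel) \<partial>M)"
          by (rule compensator_rectangle[OF 2(2) v 2(4)])
        also have "\<dots> = emeasure (intensity_measure m) X"
          unfolding em(2)[OF Xs]
        proof (rule nn_integral_cong)
          fix w assume w: "w \<in> space M"
          show "indicator A w * (\<integral>\<^sup>+s. indicator {u<..?v} s * indicator {T m w<..T (Suc m) w} s * ennreal (a (max 0 s, w)) \<partial>lborel)
            = (\<integral>\<^sup>+s. indicator {T m w<..min t (T (Suc m) w)} s * ennreal (a (s, w)) * indicator X (s, w) \<partial>lborel)"
          proof (cases "w \<in> A")
            case True
            then show ?thesis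
              by simp (intro nn_integral_cong, use 2 in \<open>auto simp: indicator_def max_def\<close>)
          next
            case False
            then show ?thesis using 2 by simp
          qed
        qed
        finally show ?thesis .
      next
        case False
        have "emeasure (jump_measure m) X = (\<integral>\<^sup>+w. 0 \<partial>M)"
          unfolding em(1)[OF Xs] by (rule nn_integral_cong) (use 2 False in \<open>auto simp: indicator_def\<close>)
        moreover have "emeasure (intensity_measure m) X = (\<integral>\<^sup>+w. \<integral>\<^sup>+s. 0 \<partial>(lborel::real measure) \<partial>M)"
          unfolding em(2)[OF Xs]
          by (intro nn_integral_cong) (use 2 False in \<open>auto simp: indicator_def\<close>)
        ultimately show ?thesis by simp
      qed
    qed
  qed
  \<comment> \<open>Half-open rectangles miss time 0, which therefore needs a set of its own in the
    exhausting sequence.\<close>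
  define C where "C k = (if k = 0 then {0} \<times> space M else {0<..real k} \<times> space M)" for k :: nat
  have C: "C k \<in> pred_gens" for k
  proof -
    have "space M \<in> sets (F 0)" using sets.top[of "F 0"] by simp
    then show ?thesis unfolding C_def by (cases "k = 0") (force, simp, metis of_nat_0_le_iff order_refl)
  qed
  show "range C \<subseteq> pred_gens" using C by blast
  show "(\<Union>k. C k) = {0..} \<times> space M"
  proof (intro equalityI subsetI)
    fix x :: "real \<times> 'a" assume x: "x \<in> {0..} \<times> space M"
    obtain k where k: "fst x \<le> real k" using real_arch_simple by blast
    have "x \<in> C (if fst x = 0 then 0 else k)" using k x by (auto simp: C_def)
    then show "x \<in> (\<Union>k. C k)" by blast
  qed (auto simp: C_def split: if_splits)
  show "emeasure (jump_measure m) (C k) \<noteq> \<infinity>" for k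
  proof -
    have Xs: "C k \<in> sets predS" unfolding sets_pred using C by (rule sigma_sets.Basic)
    have "emeasure (jump_measure m) (C k) \<le> (\<integral>\<^sup>+w. 1 \<partial>M)"
      unfolding em(1)[OF Xs] by (rule nn_integral_mono) (auto simp: indicator_def)
    also have "\<dots> = 1" by (simp add: emeasure_space_1)
    finally show ?thesis by (auto simp: top_unique)
  qed
qed

theorem compensator_jump:
  assumes P: "P \<in> borel_measurable predS"
  shows "(\<integral>\<^sup>+w. indicator {..t} (T (Suc m) w) * P (T (Suc m) w, w) \<partial>M)
    = (\<integral>\<^sup>+w. \<integral>\<^sup>+s. indicator {T m w<..min t (T (Suc m) w)} s * ennreal (a (s, w)) * P (s, w) \<partial>lborel \<partial>M)"
  using nn_integral_jump_measure[OF P, of m] nn_integral_intensity_measure[OF P, of m]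
  by (simp add: jump_measure_eq)

text \<open>With the indicator of {s} as integrand the compensator side is a Lebesgue integral over
  one point, hence zero.\<close>

lemma no_atoms:
  assumes s: "0 \<le> s" "s \<le> t" shows "AE w in M. T (Suc m) w \<noteq> s"
proof -
  let ?X = "{s} \<times> space M"
  have X: "?X \<in> sets predS"
  proof -
    have "?X = fst -` {s} \<inter> space predS" using s by auto
    then show ?thesis using measurable_sets[OF measurable_fst_pred, of "{s}"] by simp
  qed
  have "(\<integral>\<^sup>+w. indicator {..t} (T (Suc m) w) * indicator ?X (T (Suc m) w, w) \<partial>M)
    = (\<integral>\<^sup>+w. \<integral>\<^sup>+r. indicator {T m w<..min t (T (Suc m) w)} r * ennreal (a (r, w)) * indicator ?X (r, w) \<partial>lborel \<partial>M)"
    by (rule compensator_jump) (use X in auto)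
  also have "\<dots> = (\<integral>\<^sup>+w. \<integral>\<^sup>+r. 0 \<partial>(lborel::real measure) \<partial>M)"
  proof (rule nn_integral_cong, rule nn_integral_cong_AE)
    fix w
    show "AE r in lborel. indicator {T m w<..min t (T (Suc m) w)} r * ennreal (a (r, w)) * indicator ?X (r, w) = 0"
      using AE_lborel_singleton[of s] by eventually_elim (auto simp: indicator_def)
  qed
  finally have "(\<integral>\<^sup>+w. indicator {..t} (T (Suc m) w) * indicator ?X (T (Suc m) w, w) \<partial>M) = 0" by simp
  then have "AE w in M. indicator {..t} (T (Suc m) w) * indicator ?X (T (Suc m) w, w) = (0::ennreal)"
    by (subst (asm) nn_integral_0_iff_AE) (use measurable_compose[OF T_pred borel_measurable_indicator[OF X]] in auto)
  then show ?thesis using AE_space by eventually_elim (use s in \<open>auto simp: indicator_def split: if_splits\<close>)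
qed

end

section \<open>The exponential identity\<close>

lemma abs_exp_minus_one_le: "\<bar>exp y - 1\<bar> \<le> \<bar>y\<bar> * exp \<bar>y\<bar>" for y :: real
proof (cases "0 \<le> y")
  case True
  have "exp y * (1 - y) \<le> exp y * exp (- y)" using exp_ge_add_one_self[of "- y"] by (intro mult_left_mono) auto
  then have "exp y - 1 \<le> y * exp y" by (simp add: exp_minus algebra_simps)
  then show ?thesis using True by simp
next
  case False
  have "1 - exp y \<le> - y * 1" using exp_ge_add_one_self[of y] by linarith
  also have "\<dots> \<le> - y * exp (- y)" using False by (intro mult_left_mono) auto
  finally show ?thesis using False by simp
qed

lemma abs_exp_remainder_le: "\<bar>exp y - 1 - y\<bar> \<le> y\<^sup>2 * exp \<bar>y\<bar>" for y :: real
proof -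
  have "exp y * (1 - y) \<le> exp y * exp (- y)" using exp_ge_add_one_self[of "- y"] by (intro mult_left_mono) auto
  then have 1: "exp y - 1 - y \<le> y * (exp y - 1)" by (simp add: exp_minus algebra_simps)
  have 0: "0 \<le> exp y - 1 - y" using exp_ge_add_one_self[of y] by linarith
  have "y * (exp y - 1) \<le> \<bar>y\<bar> * \<bar>exp y - 1\<bar>" by (metis abs_ge_self abs_mult)
  also have "\<dots> \<le> \<bar>y\<bar> * (\<bar>y\<bar> * exp \<bar>y\<bar>)" by (intro mult_left_mono abs_exp_minus_one_le) auto
  finally show ?thesis using 0 1 by (simp add: power2_eq_square mult.assoc[symmetric] flip: abs_mult)
qed

lemma sum_indicator_partition:
  fixes w :: "nat \<Rightarrow> real"
  assumes "mono w"
  shows "(\<Sum>j<m. indicator {w j<..w (Suc j)} x) = (indicator {w 0<..w m} x :: real)"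
proof (induction m)
  case (Suc m)
  have "w 0 \<le> w m" "w m \<le> w (Suc m)" using assms by (auto simp: mono_def)
  then show ?case unfolding sum.lessThan_Suc Suc by (auto simp: indicator_def)
qed simp

lemma set_integral_partition:
  fixes w :: "nat \<Rightarrow> real" and f :: "real \<Rightarrow> real"
  assumes w: "mono w" and f: "set_integrable lborel {w 0<..w m} f"
  shows "(\<Sum>j<m. LINT s:{w j<..w (Suc j)}|lborel. f s) = (LINT s:{w 0<..w m}|lborel. f s)"
  using f
proof (induction m)
  case (Suc m)
  have w1: "w 0 \<le> w m" "w m \<le> w (Suc m)" using w by (auto simp: mono_def)
  have un: "{w 0<..w (Suc m)} = {w 0<..w m} \<union> {w m<..w (Suc m)}" using w1 by auto
  have i: "set_integrable lborel {w 0<..w m} f" "set_integrable lborel {w m<..w (Suc m)} f"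
    by (rule set_integrable_subset[OF Suc.prems]; use w1 in auto)+
  show ?case unfolding sum.lessThan_Suc Suc.IH[OF i(1)] un
    by (rule set_integral_Un[symmetric]) (use i in auto)
qed (simp add: set_lebesgue_integral_def)

text \<open>On a fine grid each cell contains at most one jump, so \<open>exp (x n j) - 1 = X n j\<close>, and the
  remainder of a cell is of second order in the continuous part \<open>\<beta> n j\<close>.\<close>

lemma grid_remainder:
  fixes b :: "real \<Rightarrow> real" and \<tau> g :: "'i \<Rightarrow> real"
  assumes I: "finite I" and t: "0 \<le> t" and b: "set_integrable lborel {0<..t} b"
    and ties: "\<And>p q. p \<in> I \<Longrightarrow> q \<in> I \<Longrightarrow> p \<noteq> q \<Longrightarrow> \<tau> p \<in> {0<..t} \<Longrightarrow> \<tau> p \<noteq> \<tau> q"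
    and gB: "\<And>p. p \<in> I \<Longrightarrow> \<bar>g p\<bar> \<le> B" and bK: "(LINT s:{0<..t}|lborel. \<bar>b s\<bar>) \<le> K"
  defines "w \<equiv> \<lambda>n j. t * real j / real (Suc n)"
  defines "x \<equiv> \<lambda>n j. \<Sum>p\<in>I. indicator {w n j<..w n (Suc j)} (\<tau> p) * g p"
  defines "X \<equiv> \<lambda>n j. \<Sum>p\<in>I. indicator {w n j<..w n (Suc j)} (\<tau> p) * (exp (g p) - 1)"
  defines "\<beta> \<equiv> \<lambda>n j. LINT s:{w n j<..w n (Suc j)}|lborel. b s"
  defines "R \<equiv> \<lambda>n. \<Sum>j<Suc n. \<bar>exp (x n j - \<beta> n j) - 1 - X n j + \<beta> n j\<bar>"
  shows "R \<longlonglongrightarrow> 0"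
    and "R n \<le> (B * card I + K) * exp (B * card I + K) + (exp B + 1) * card I + K"
proof -
  have wmono: "mono (w n)" for n
    unfolding w_def mono_def by (auto intro!: divide_right_mono mult_left_mono t)
  have w0: "w n 0 = 0" and wl: "w n (Suc n) = t" for n by (auto simp: w_def)
  have wb: "0 \<le> w n j \<and> w n (Suc j) \<le> t \<and> w n j \<le> w n (Suc j)" if "j < Suc n" for n j
    using monoD[OF wmono[of n], of 0 j] monoD[OF wmono[of n], of "Suc j" "Suc n"]
      monoD[OF wmono[of n], of j "Suc j"] that w0[of n] wl[of n] by auto
  have babs: "set_integrable lborel {0<..t} (\<lambda>s. \<bar>b s\<bar>)" by (rule set_integrable_abs[OF b])
  have bsub: "set_integrable lborel {w n j<..w n (Suc j)} b"
    "set_integrable lborel {w n j<..w n (Suc j)} (\<lambda>s. \<bar>b s\<bar>)" if "j < Suc n" for n j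
    by (rule set_integrable_subset[OF b] set_integrable_subset[OF babs]; use wb[OF that] in auto)+
  let ?\<beta>a = "\<lambda>n j. LINT s:{w n j<..w n (Suc j)}|lborel. \<bar>b s\<bar>"
  have \<beta>a: "\<bar>\<beta> n j\<bar> \<le> ?\<beta>a n j" if "j < Suc n" for n j
    unfolding \<beta>_def set_lebesgue_integral_def
    by (rule order_trans[OF integral_abs_bound]) (simp add: abs_mult)
  have sum_\<beta>a: "(\<Sum>j<Suc n. ?\<beta>a n j) \<le> K" for n
    using set_integral_partition[OF wmono[of n], of "Suc n" "\<lambda>s. \<bar>b s\<bar>"] babs bK w0[of n] wl[of n] by simp
  have \<beta>a0: "0 \<le> ?\<beta>a n j" for n j by (auto simp: set_lebesgue_integral_def intro!: integral_nonneg_AE)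
  have sum_\<beta>: "(\<Sum>j<Suc n. \<bar>\<beta> n j\<bar>) \<le> K" for n
    by (rule order_trans[OF sum_mono sum_\<beta>a[of n]]) (use \<beta>a in auto)
  have K0: "0 \<le> K" using sum_\<beta>[of 0] by (meson abs_ge_zero order_trans sum_nonneg)
  have \<beta>K: "\<bar>\<beta> n j\<bar> \<le> K" if "j < Suc n" for n j
    using member_le_sum[of j "{..<Suc n}" "\<lambda>j. \<bar>\<beta> n j\<bar>"] that sum_\<beta>[of n] by auto
  have part: "(\<Sum>j<Suc n. \<bar>\<Sum>p\<in>I. indicator {w n j<..w n (Suc j)} (\<tau> p) * c p\<bar>) \<le> C * card I"
    if c: "\<And>p. p \<in> I \<Longrightarrow> \<bar>c p\<bar> \<le> C" for n C and c :: "'i \<Rightarrow> real"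
  proof -
    have "(\<Sum>j<Suc n. \<bar>\<Sum>p\<in>I. indicator {w n j<..w n (Suc j)} (\<tau> p) * c p\<bar>)
      \<le> (\<Sum>j<Suc n. \<Sum>p\<in>I. indicator {w n j<..w n (Suc j)} (\<tau> p) * \<bar>c p\<bar>)"
      by (intro sum_mono order_trans[OF sum_abs]) (simp add: abs_mult)
    also have "\<dots> = (\<Sum>p\<in>I. (\<Sum>j<Suc n. indicator {w n j<..w n (Suc j)} (\<tau> p)) * \<bar>c p\<bar>)"
      by (subst sum.swap) (simp only: sum_distrib_right)
    also have "\<dots> \<le> (\<Sum>p\<in>I. C)"
    proof (rule sum_mono)
      fix p assume p: "p \<in> I"
      have "indicator {w n 0<..w n (Suc n)} (\<tau> p) * \<bar>c p\<bar> \<le> C"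
        using c[OF p] by (auto simp: indicator_def)
      then show "(\<Sum>j<Suc n. indicator {w n j<..w n (Suc j)} (\<tau> p)) * \<bar>c p\<bar> \<le> C"
        by (simp only: sum_indicator_partition[OF wmono])
    qed
    finally show ?thesis by (simp add: mult.commute)
  qed
  have sum_x: "(\<Sum>j<Suc n. \<bar>x n j\<bar>) \<le> B * card I" for n
    unfolding x_def by (rule part[OF gB])
  have eB: "\<bar>exp (g p) - 1\<bar> \<le> exp B + 1" if "p \<in> I" for p
  proof -
    have "exp (g p) \<le> exp B" "0 < exp (g p)" using gB[OF that] by auto
    then show ?thesis by linarith
  qed
  have sum_X: "(\<Sum>j<Suc n. \<bar>X n j\<bar>) \<le> (exp B + 1) * card I" for n
    unfolding X_def by (rule part[OF eB])
  have xB: "\<bar>x n j\<bar> \<le> B * card I" if "j < Suc n" for n j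
    using member_le_sum[of j "{..<Suc n}" "\<lambda>j. \<bar>x n j\<bar>"] that sum_x[of n] by auto
  \<comment> \<open>A crude bound uniform in \<open>n\<close>; it serves as dominating constant when
    the grid is refined under the expectation.\<close>
  show "R n \<le> (B * card I + K) * exp (B * card I + K) + (exp B + 1) * card I + K"
  proof -
    have "R n \<le> (\<Sum>j<Suc n. (\<bar>x n j\<bar> + \<bar>\<beta> n j\<bar>) * exp (B * card I + K) + \<bar>X n j\<bar> + \<bar>\<beta> n j\<bar>)"
      unfolding R_def
    proof (rule sum_mono)
      fix j assume "j \<in> {..<Suc n}"
      then have j: "j < Suc n" by simp
      have "\<bar>exp (x n j - \<beta> n j) - 1\<bar> \<le> \<bar>x n j - \<beta> n j\<bar> * exp \<bar>x n j - \<beta> n j\<bar>" by (rule abs_exp_minus_one_le)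
      also have "\<dots> \<le> (\<bar>x n j\<bar> + \<bar>\<beta> n j\<bar>) * exp (B * card I + K)"
        by (rule mult_mono) (use xB[OF j] \<beta>K[OF j] in auto)
      finally show "\<bar>exp (x n j - \<beta> n j) - 1 - X n j + \<beta> n j\<bar>
        \<le> (\<bar>x n j\<bar> + \<bar>\<beta> n j\<bar>) * exp (B * card I + K) + \<bar>X n j\<bar> + \<bar>\<beta> n j\<bar>" by linarith
    qed
    also have "\<dots> = ((\<Sum>j<Suc n. \<bar>x n j\<bar>) + (\<Sum>j<Suc n. \<bar>\<beta> n j\<bar>)) * exp (B * card I + K)
        + (\<Sum>j<Suc n. \<bar>X n j\<bar>) + (\<Sum>j<Suc n. \<bar>\<beta> n j\<bar>)"
      by (simp only: sum.distrib sum_distrib_right[symmetric])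
    also have "\<dots> \<le> (B * card I + K) * exp (B * card I + K) + (exp B + 1) * card I + K"
      by (intro add_mono mult_right_mono sum_x sum_\<beta> sum_X) auto
    finally show ?thesis .
  qed
  show "R \<longlonglongrightarrow> 0"
  proof (rule LIMSEQ_I)
    fix e :: real assume e: "0 < e"
    \<comment> \<open>The constant of the last estimate; the summand 1 keeps it positive and makes
      the final comparison strict.\<close>
    define C where "C = exp K * ((exp B + 1) * card I + K) + 1"
    have C: "0 < C" using K0 by (auto simp: C_def intro!: add_nonneg_pos mult_nonneg_nonneg add_nonneg_nonneg)
    define \<eta> where "\<eta> = e / C"
    have \<eta>: "0 < \<eta>" using e C by (simp add: \<eta>_def)
    obtain \<delta>1 where \<delta>1: "0 < \<delta>1"
      "\<And>u v. 0 \<le> u \<Longrightarrow> u \<le> v \<Longrightarrow> v \<le> t \<Longrightarrow> v - u < \<delta>1 \<Longrightarrow> (LINT s:{u<..v}|lborel. \<bar>b s\<bar>) < \<eta>"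
    proof -
      have i: "(\<lambda>s. \<bar>b s\<bar>) integrable_on {0<..t}" using set_borel_integral_eq_integral(1)[OF babs] .
      then have i': "(\<lambda>s. \<bar>b s\<bar>) integrable_on {0..t}"
        by (rule integrable_spike_set) (auto intro!: negligible_subset[OF negligible_sing[of 0]])
      have "continuous_on {0..t} (\<lambda>s. integral {0..s} (\<lambda>s. \<bar>b s\<bar>))" by (rule indefinite_integral_continuous_1[OF i'])
      then have "uniformly_continuous_on {0..t} (\<lambda>s. integral {0..s} (\<lambda>s. \<bar>b s\<bar>))"
        by (rule compact_uniformly_continuous) simp
      then obtain d where d: "0 < d" "\<And>u v. u \<in> {0..t} \<Longrightarrow> v \<in> {0..t} \<Longrightarrow> dist u v < d \<Longrightarrow>
        dist (integral {0..u} (\<lambda>s. \<bar>b s\<bar>)) (integral {0..v} (\<lambda>s. \<bar>b s\<bar>)) < \<eta>"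
        unfolding uniformly_continuous_on_def using \<eta> by metis
      show thesis
      proof (rule that[OF d(1)])
        fix u v assume uv: "0 \<le> u" "u \<le> v" "v \<le> t" "v - u < d"
        have "(LINT s:{u<..v}|lborel. \<bar>b s\<bar>) = integral {u<..v} (\<lambda>s. \<bar>b s\<bar>)"
          by (rule set_borel_integral_eq_integral(2), rule set_integrable_subset[OF babs]) (use uv in auto)
        also have "\<dots> = integral {u..v} (\<lambda>s. \<bar>b s\<bar>)"
          by (rule integral_spike_set) (auto intro!: negligible_subset[OF negligible_sing[of u]])
        also have "\<dots> = integral {0..v} (\<lambda>s. \<bar>b s\<bar>) - integral {0..u} (\<lambda>s. \<bar>b s\<bar>)"
        proof -
          have "(\<lambda>s. \<bar>b s\<bar>) integrable_on {0..v}" by (rule integrable_on_subinterval[OF i']) (use uv in auto)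
          from Henstock_Kurzweil_Integration.integral_combine[OF uv(1,2) this] show ?thesis by simp
        qed
        also have "\<dots> < \<eta>" using d(2)[of u v] uv by (auto simp: dist_real_def)
        finally show "(LINT s:{u<..v}|lborel. \<bar>b s\<bar>) < \<eta>" .
      qed
    qed
    obtain \<delta>2 where \<delta>2: "0 < \<delta>2"
      "\<And>p q. p \<in> I \<Longrightarrow> q \<in> I \<Longrightarrow> p \<noteq> q \<Longrightarrow> \<tau> p \<in> {0<..t} \<Longrightarrow> \<delta>2 \<le> \<bar>\<tau> p - \<tau> q\<bar>"
    proof -
      \<comment> \<open>The element 1 keeps the minimum defined when there is no pair of distinct
        indices to compare.\<close>
      let ?D = "insert 1 ((\<lambda>(p, q). \<bar>\<tau> p - \<tau> q\<bar>) ` {(p, q)\<in>I \<times> I. p \<noteq> q \<and> \<tau> p \<in> {0<..t}})"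
      have fin: "finite ?D" using I by (auto intro: finite_subset[of _ "I \<times> I"])
      have "0 < Min ?D" using ties fin by (subst Min_gr_iff) auto
      moreover have "Min ?D \<le> \<bar>\<tau> p - \<tau> q\<bar>" if "p \<in> I" "q \<in> I" "p \<noteq> q" "\<tau> p \<in> {0<..t}" for p q
        by (rule Min_le[OF fin]) (use that in auto)
      ultimately show thesis by (rule that)
    qed
    obtain n0 where n0: "t / min \<delta>1 \<delta>2 < real n0" using reals_Archimedean2 by blast
    show "\<exists>no. \<forall>n\<ge>no. norm (R n - 0) < e"
    proof (intro exI allI impI)
      fix n assume n: "n \<ge> n0"
      have step: "w n (Suc j) - w n j < min \<delta>1 \<delta>2" for j
      proof -
        have "t / min \<delta>1 \<delta>2 < real (Suc n)" using n0 n by simp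
        moreover have "0 < min \<delta>1 \<delta>2" using \<delta>1(1) \<delta>2(1) by simp
        ultimately have "t < real (Suc n) * min \<delta>1 \<delta>2" by (simp only: pos_divide_less_eq)
        then have "t / real (Suc n) < min \<delta>1 \<delta>2"
          by (subst pos_divide_less_eq) (simp_all only: mult.commute of_nat_0_less_iff zero_less_Suc)
        moreover have "w n (Suc j) - w n j = t / real (Suc n)"
          by (simp add: w_def diff_divide_distrib[symmetric] algebra_simps del: of_nat_Suc) (simp add: algebra_simps)
        ultimately show ?thesis by simp
      qed
      have "R n \<le> (\<Sum>j<Suc n. \<eta> * exp K * (\<bar>X n j\<bar> + \<bar>\<beta> n j\<bar>))"
        unfolding R_def
      proof (rule sum_mono)
        fix j assume "j \<in> {..<Suc n}"
        then have j: "j < Suc n" by simp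
        let ?J = "{w n j<..w n (Suc j)}"
        have small: "\<bar>\<beta> n j\<bar> \<le> \<eta>"
          using \<beta>a[OF j] \<delta>1(2)[of "w n j" "w n (Suc j)"] wb[OF j] step[of j] by auto
        have xX: "exp (x n j) - 1 = X n j"
        proof (cases "\<exists>p\<in>I. \<tau> p \<in> ?J")
          case True
          then obtain p where p: "p \<in> I" "\<tau> p \<in> ?J" by auto
          have other: "\<tau> q \<notin> ?J" if q: "q \<in> I" "q \<noteq> p" for q
          proof
            assume "\<tau> q \<in> ?J"
            then have "\<bar>\<tau> p - \<tau> q\<bar> < \<delta>2" using p(2) step[of j] by auto
            moreover have "\<tau> p \<in> {0<..t}" using p(2) wb[OF j] by auto
            ultimately show False using \<delta>2(2)[of p q] p q by auto
          qed
          have "(\<Sum>q\<in>I. indicator ?J (\<tau> q) * c q) = c p" for c :: "'i \<Rightarrow> real"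
          proof -
            have "(\<Sum>q\<in>I. indicator ?J (\<tau> q) * c q) = (\<Sum>q\<in>I. if q = p then c p else 0)"
              by (rule sum.cong) (use other p in \<open>auto simp: indicator_def\<close>)
            then show ?thesis using p I by simp
          qed
          then show ?thesis unfolding x_def X_def by simp
        next
          case False
          then have "(\<Sum>q\<in>I. indicator ?J (\<tau> q) * c q) = 0" for c :: "'i \<Rightarrow> real"
            by (intro sum.neutral) auto
          then show ?thesis unfolding x_def X_def by simp
        qed
        let ?b = "\<beta> n j"
        have e1: "\<bar>exp (- ?b) - 1\<bar> \<le> \<eta> * exp K"
          by (rule order_trans[OF abs_exp_minus_one_le]) (use small \<beta>K[OF j] in \<open>auto intro!: mult_mono\<close>)
        have "\<bar>exp (- ?b) - 1 - (- ?b)\<bar> \<le> ?b\<^sup>2 * exp \<bar>- ?b\<bar>"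
          using abs_exp_remainder_le[of "- ?b"] by (simp only: power2_minus)
        also have "\<dots> = \<bar>?b\<bar> * exp \<bar>?b\<bar> * \<bar>?b\<bar>" by (simp add: power2_eq_square)
        also have "\<dots> \<le> \<eta> * exp K * \<bar>?b\<bar>"
          using small \<beta>K[OF j] \<eta> by (intro mult_right_mono mult_mono) auto
        finally have e2: "\<bar>exp (- ?b) - 1 + ?b\<bar> \<le> \<eta> * exp K * \<bar>?b\<bar>" by simp
        \<comment> \<open>Because \<open>exp (x n j) = 1 + X n j\<close>, the remainder splits into
          a product with the small factor \<open>exp (- ?b) - 1\<close> and a second-order term.
          Each is at most a multiple of \<eta> times a quantity whose sum over the grid is
          bounded.\<close>
        have "exp (x n j - ?b) - 1 - X n j + ?b = X n j * (exp (- ?b) - 1) + (exp (- ?b) - 1 + ?b)"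
          unfolding xX[symmetric] by (simp add: algebra_simps exp_diff exp_minus field_simps)
        also have "\<bar>\<dots>\<bar> \<le> \<bar>X n j\<bar> * (\<eta> * exp K) + \<eta> * exp K * \<bar>?b\<bar>"
          by (rule order_trans[OF abs_triangle_ineq add_mono[OF _ e2]])
            (use e1 in \<open>auto simp: abs_mult intro!: mult_left_mono\<close>)
        finally show "\<bar>exp (x n j - ?b) - 1 - X n j + ?b\<bar> \<le> \<eta> * exp K * (\<bar>X n j\<bar> + \<bar>\<beta> n j\<bar>)"
          by (simp add: algebra_simps)
      qed
      also have "\<dots> = \<eta> * exp K * ((\<Sum>j<Suc n. \<bar>X n j\<bar>) + (\<Sum>j<Suc n. \<bar>\<beta> n j\<bar>))"
        by (simp only: sum.distrib sum_distrib_left[symmetric])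
      also have "\<dots> \<le> \<eta> * exp K * ((exp B + 1) * card I + K)"
        using \<eta> by (intro mult_left_mono add_mono sum_X sum_\<beta>) auto
      also have "\<dots> < \<eta> * C" using \<eta> by (simp add: C_def algebra_simps)
      also have "\<dots> = e" using C by (simp add: \<eta>_def)
      finally have "R n < e" .
      moreover have "0 \<le> R n" by (simp add: R_def sum_nonneg)
      ultimately show "norm (R n - 0) < e" by simp
    qed
  qed
qed

context filtered_prob_space
begin

section \<open>The compensated exponential on a grid\<close>

text \<open>\<open>ennreal\<close> sends negative numbers to 0, so \<open>ennreal (D x)\<close> and
  \<open>ennreal (- D x)\<close> are the positive and negative parts. The uniform bound
  \<open>K\<close> makes both compensators finite, so that they may be subtracted.\<close>

lemma compensator_real:
  fixes r D :: "real \<times> 'a \<Rightarrow> real"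
  assumes \<tau>: "\<tau> \<in> borel_measurable M" "\<And>w. w \<in> space M \<Longrightarrow> 0 \<le> \<tau> w"
    and r: "r \<in> borel_measurable predS" "\<And>s w. 0 \<le> s \<Longrightarrow> w \<in> space M \<Longrightarrow> 0 \<le> r (s, w)"
    and comp: "\<And>P. P \<in> borel_measurable predS \<Longrightarrow>
      (\<integral>\<^sup>+w. indicator {..t} (\<tau> w) * P (\<tau> w, w) \<partial>M)
      = (\<integral>\<^sup>+w. \<integral>\<^sup>+s. indicator {0<..t} s * ennreal (r (s, w)) * P (s, w) \<partial>lborel \<partial>M)"
    and D: "D \<in> borel_measurable predS" "\<And>s w. 0 \<le> s \<Longrightarrow> w \<in> space M \<Longrightarrow> \<bar>D (s, w)\<bar> \<le> c"
    and K: "0 \<le> K" "\<And>w. w \<in> space M \<Longrightarrow>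
      (\<integral>\<^sup>+s. indicator {0<..t} s * ennreal (r (s, w) * \<bar>D (s, w)\<bar>) \<partial>lborel) \<le> ennreal K"
  shows "(LINT w|M. indicator {..t} (\<tau> w) * D (\<tau> w, w))
    = (LINT w|M. (LINT s:{0<..t}|lborel. r (s, w) * D (s, w)))"
proof -
  define J where "J P w = (\<integral>\<^sup>+s. indicator {0<..t} s * ennreal (r (s, w)) * ennreal (P (s, w)) \<partial>lborel)"
    for P :: "real \<times> 'a \<Rightarrow> real" and w
  have Jm [measurable]: "J P \<in> borel_measurable M" if P: "P \<in> borel_measurable predS" for P
  proof -
    have [measurable]: "(\<lambda>(w, s). r (max 0 s, w)) \<in> borel_measurable (M \<Otimes>\<^sub>M borel)"
      "(\<lambda>(w, s). P (max 0 s, w)) \<in> borel_measurable (M \<Otimes>\<^sub>M borel)"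
      using measurable_compose[OF measurable_pred_pair r(1)] measurable_compose[OF measurable_pred_pair P]
      by (simp_all add: split_def)
    have "(\<lambda>w. \<integral>\<^sup>+s. indicator {0<..t} s * ennreal (r (max 0 s, w)) * ennreal (P (max 0 s, w)) \<partial>lborel) \<in> borel_measurable M"
      by measurable
    moreover have "J P = (\<lambda>w. \<integral>\<^sup>+s. indicator {0<..t} s * ennreal (r (max 0 s, w)) * ennreal (P (max 0 s, w)) \<partial>lborel)"
      unfolding J_def by (intro ext nn_integral_cong) (auto simp: indicator_def)
    ultimately show ?thesis by (simp only:)
  qed
  have Dm: "(\<lambda>x. - D x) \<in> borel_measurable predS" using D(1) by simp
  have JK: "J P w \<le> ennreal K" if w: "w \<in> space M" and P: "\<And>x. P x \<le> \<bar>D x\<bar>" for P w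
  proof -
    have "J P w \<le> (\<integral>\<^sup>+s. indicator {0<..t} s * ennreal (r (s, w) * \<bar>D (s, w)\<bar>) \<partial>lborel)"
      unfolding J_def
    proof (rule nn_integral_mono)
      fix s
      show "indicator {0<..t} s * ennreal (r (s, w)) * ennreal (P (s, w))
        \<le> indicator {0<..t} s * ennreal (r (s, w) * \<bar>D (s, w)\<bar>)"
        using r(2)[OF _ w, of s] P[of "(s, w)"]
        by (auto simp: indicator_def ennreal_mult intro!: mult_left_mono ennreal_leI)
    qed
    then show ?thesis using K(2)[OF w] by (rule order_trans)
  qed
  have JKD: "J D w \<le> ennreal K" "J (\<lambda>x. - D x) w \<le> ennreal K" if "w \<in> space M" for w
    by (rule JK[OF that], simp, rule JK[OF that], simp)
  have enn: "ennreal (enn2real (J P w)) = J P w" if "J P w \<le> ennreal K" for P w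
    using that by (intro ennreal_enn2real) (auto intro: le_less_trans)
  have tm: "(\<lambda>w. D (\<tau> w, w)) \<in> borel_measurable M"
    using measurable_compose[OF measurable_stopped_M[OF \<tau>] D(1)] .
  have int: "integrable M (\<lambda>w. indicator {..t} (\<tau> w) * D (\<tau> w, w))"
  proof (rule integrable_const_bound[of _ "\<bar>c\<bar>"])
    show "AE w in M. norm (indicator {..t} (\<tau> w) * D (\<tau> w, w)) \<le> \<bar>c\<bar>"
    proof (rule AE_I2)
      fix w assume "w \<in> space M"
      from D(2)[OF \<tau>(2)[OF this] this]
      show "norm (indicator {..t} (\<tau> w) * D (\<tau> w, w)) \<le> \<bar>c\<bar>" by (auto simp: indicator_def)
    qed
  qed (use tm \<tau>(1) in simp)
  have "(LINT w|M. indicator {..t} (\<tau> w) * D (\<tau> w, w))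
    = enn2real (\<integral>\<^sup>+w. ennreal (indicator {..t} (\<tau> w) * D (\<tau> w, w)) \<partial>M)
      - enn2real (\<integral>\<^sup>+w. ennreal (- (indicator {..t} (\<tau> w) * D (\<tau> w, w))) \<partial>M)"
    by (rule real_lebesgue_integral_def[OF int])
  also have "(\<integral>\<^sup>+w. ennreal (indicator {..t} (\<tau> w) * D (\<tau> w, w)) \<partial>M)
    = (\<integral>\<^sup>+w. indicator {..t} (\<tau> w) * ennreal (D (\<tau> w, w)) \<partial>M)"
    by (rule nn_integral_cong) (auto simp: indicator_def)
  also have "\<dots> = (\<integral>\<^sup>+w. J D w \<partial>M)" unfolding J_def by (rule comp) (use D(1) in simp)
  also have "(\<integral>\<^sup>+w. ennreal (- (indicator {..t} (\<tau> w) * D (\<tau> w, w))) \<partial>M)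
    = (\<integral>\<^sup>+w. indicator {..t} (\<tau> w) * ennreal (- D (\<tau> w, w)) \<partial>M)"
    by (rule nn_integral_cong) (auto simp: indicator_def)
  also have "\<dots> = (\<integral>\<^sup>+w. J (\<lambda>x. - D x) w \<partial>M)" unfolding J_def by (rule comp) (use D(1) in simp)
  also have "enn2real (\<integral>\<^sup>+w. J D w \<partial>M) - enn2real (\<integral>\<^sup>+w. J (\<lambda>x. - D x) w \<partial>M)
    = (LINT w|M. enn2real (J D w)) - (LINT w|M. enn2real (J (\<lambda>x. - D x) w))"
  proof -
    have "(LINT w|M. enn2real (J P w)) = enn2real (\<integral>\<^sup>+w. J P w \<partial>M)"
      if P: "P \<in> borel_measurable predS" "\<And>w. w \<in> space M \<Longrightarrow> J P w \<le> ennreal K" for P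
    proof -
      have "(LINT w|M. enn2real (J P w)) = enn2real (\<integral>\<^sup>+w. ennreal (enn2real (J P w)) \<partial>M)"
        by (rule integral_eq_nn_integral) (use Jm[OF P(1)] in auto)
      also have "(\<integral>\<^sup>+w. ennreal (enn2real (J P w)) \<partial>M) = (\<integral>\<^sup>+w. J P w \<partial>M)"
        by (rule nn_integral_cong) (rule enn[OF P(2)])
      finally show ?thesis .
    qed
    from this[OF D(1) JKD(1)] this[OF Dm JKD(2)] show ?thesis by simp
  qed
  also have "\<dots> = (LINT w|M. enn2real (J D w) - enn2real (J (\<lambda>x. - D x) w))"
  proof (rule Bochner_Integration.integral_diff[symmetric])
    have "integrable M (\<lambda>w. enn2real (J P w))"
      if P: "P \<in> borel_measurable predS" "\<And>w. w \<in> space M \<Longrightarrow> J P w \<le> ennreal K" for P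
      by (rule integrable_const_bound[of _ K])
        (use Jm[OF P(1)] enn2real_mono[OF P(2)] K(1) in auto)
    from this[OF D(1) JKD(1)] this[OF Dm JKD(2)]
    show "integrable M (\<lambda>w. enn2real (J D w))" "integrable M (\<lambda>w. enn2real (J (\<lambda>x. - D x) w))" by simp_all
  qed
  also have "\<dots> = (LINT w|M. (LINT s:{0<..t}|lborel. r (s, w) * D (s, w)))"
  proof (rule Bochner_Integration.integral_cong[OF refl])
    fix w assume w: "w \<in> space M"
    have m: "(\<lambda>s. indicator {0<..t} s * (r (s, w) * D (s, w))) \<in> borel_measurable borel"
      by (rule pred_section_indicator[OF borel_measurable_times[OF r(1) D(1)] w]) auto
    have i: "integrable lborel (\<lambda>s. indicator {0<..t} s * (r (s, w) * D (s, w)))"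
    proof (rule integrableI_bounded)
      have "(\<integral>\<^sup>+s. ennreal (norm (indicator {0<..t} s * (r (s, w) * D (s, w)))) \<partial>lborel)
        = (\<integral>\<^sup>+s. indicator {0<..t} s * ennreal (r (s, w) * \<bar>D (s, w)\<bar>) \<partial>lborel)"
        by (rule nn_integral_cong) (use r(2)[OF _ w] in \<open>auto simp: indicator_def abs_mult\<close>)
      also have "\<dots> \<le> ennreal K" by (rule K(2)[OF w])
      finally show "(\<integral>\<^sup>+s. ennreal (norm (indicator {0<..t} s * (r (s, w) * D (s, w)))) \<partial>lborel) < \<infinity>"
        by (rule le_less_trans) simp
    qed (use m in simp)
    have "(LINT s:{0<..t}|lborel. r (s, w) * D (s, w))
      = enn2real (\<integral>\<^sup>+s. ennreal (indicator {0<..t} s * (r (s, w) * D (s, w))) \<partial>lborel)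
        - enn2real (\<integral>\<^sup>+s. ennreal (- (indicator {0<..t} s * (r (s, w) * D (s, w)))) \<partial>lborel)"
      unfolding set_lebesgue_integral_def real_scaleR_def by (rule real_lebesgue_integral_def[OF i])
    also have "(\<integral>\<^sup>+s. ennreal (indicator {0<..t} s * (r (s, w) * D (s, w))) \<partial>lborel) = J D w"
      unfolding J_def
    proof (rule nn_integral_cong)
      fix s show "ennreal (indicator {0<..t} s * (r (s, w) * D (s, w)))
        = indicator {0<..t} s * ennreal (r (s, w)) * ennreal (D (s, w))"
        using r(2)[OF _ w, of s] by (auto simp: indicator_def ennreal_mult')
    qed
    also have "(\<integral>\<^sup>+s. ennreal (- (indicator {0<..t} s * (r (s, w) * D (s, w)))) \<partial>lborel) = J (\<lambda>x. - D x) w"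
      unfolding J_def
    proof (rule nn_integral_cong)
      fix s show "ennreal (- (indicator {0<..t} s * (r (s, w) * D (s, w))))
        = indicator {0<..t} s * ennreal (r (s, w)) * ennreal (- D (s, w))"
        using r(2)[OF _ w, of s] ennreal_mult'[of "r (s, w)" "- D (s, w)"] by (auto simp: indicator_def)
    qed
    finally show "enn2real (J D w) - enn2real (J (\<lambda>x. - D x) w)
      = (LINT s:{0<..t}|lborel. r (s, w) * D (s, w))" ..
  qed
  finally show ?thesis .
qed

text \<open>\<open>exp (A t) - 1\<close> is telescoped over a grid. The first-order part of each increment is the
  exponential at the left end point times a compensated integral, hence centred; what is left
  tends to zero by \<open>grid_remainder\<close>.\<close>

theorem exponential_martingale_identity:
  fixes I :: "'i set" and \<tau> :: "'i \<Rightarrow> 'a \<Rightarrow> real" and r G :: "'i \<Rightarrow> real \<times> 'a \<Rightarrow> real"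
  assumes I: "finite I" and t: "0 \<le> t"
    and stop: "\<And>p q. p \<in> I \<Longrightarrow> 0 \<le> q \<Longrightarrow> {w\<in>space M. \<tau> p w \<le> q} \<in> sets (F q)"
    and pos: "\<And>p w. p \<in> I \<Longrightarrow> w \<in> space M \<Longrightarrow> 0 < \<tau> p w"
    and r: "\<And>p. p \<in> I \<Longrightarrow> r p \<in> borel_measurable predS"
      "\<And>p s w. p \<in> I \<Longrightarrow> 0 \<le> s \<Longrightarrow> w \<in> space M \<Longrightarrow> 0 \<le> r p (s, w)"
    and comp: "\<And>p P. p \<in> I \<Longrightarrow> P \<in> borel_measurable predS \<Longrightarrow>
      (\<integral>\<^sup>+w. indicator {..t} (\<tau> p w) * P (\<tau> p w, w) \<partial>M)
      = (\<integral>\<^sup>+w. \<integral>\<^sup>+s. indicator {0<..t} s * ennreal (r p (s, w)) * P (s, w) \<partial>lborel \<partial>M)"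
    and ties: "AE w in M. \<forall>p\<in>I. \<forall>q\<in>I. p \<noteq> q \<longrightarrow> \<tau> p w \<le> t \<longrightarrow> \<tau> p w \<noteq> \<tau> q w"
    and G: "\<And>p. p \<in> I \<Longrightarrow> G p \<in> borel_measurable predS"
      "\<And>p s w. p \<in> I \<Longrightarrow> 0 \<le> s \<Longrightarrow> w \<in> space M \<Longrightarrow> \<bar>G p (s, w)\<bar> \<le> B"
    and K: "0 \<le> K" "\<And>p w. p \<in> I \<Longrightarrow> w \<in> space M \<Longrightarrow>
      (\<integral>\<^sup>+s. indicator {0<..t} s * ennreal (r p (s, w) * \<bar>exp (G p (s, w)) - 1\<bar>) \<partial>lborel) \<le> ennreal K"
  defines "A \<equiv> \<lambda>u w. (\<Sum>p\<in>I. indicator {0<..u} (\<tau> p w) * G p (\<tau> p w, w))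
      - (LINT s:{0<..u}|lborel. (\<Sum>p\<in>I. r p (s, w) * (exp (G p (s, w)) - 1)))"
  shows "A t \<in> borel_measurable M" "(\<integral>\<^sup>+w. ennreal (exp (A t w)) \<partial>M) = 1"
proof -
  let ?q = "\<lambda>p w s. r p (s, w) * (exp (G p (s, w)) - 1)"
    and ?qa = "\<lambda>p w s. r p (s, w) * \<bar>exp (G p (s, w)) - 1\<bar>"
  define b where "b w s = (\<Sum>p\<in>I. ?q p w s)" for w s
  \<comment> \<open>A bound for \<open>A u w\<close> over all times up to \<open>t\<close> and all
    \<open>w\<close>, so that \<open>exp c\<close> dominates every exponential met along a
    grid.\<close>
  define c where "c = max 0 B * card I + K * card I"
  have Gexp: "(\<lambda>x. exp (G p x) - 1) \<in> borel_measurable predS" if "p \<in> I" for p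
    using G(1)[OF that] by simp
  have rG: "(\<lambda>x. r p x * (exp (G p x) - 1)) \<in> borel_measurable predS" if "p \<in> I" for p
    using r(1)[OF that] G(1)[OF that] by simp
  have \<tau>M [measurable]: "\<tau> p \<in> borel_measurable M" if p: "p \<in> I" for p
  proof (rule borel_measurableI_le)
    fix q show "{w\<in>space M. \<tau> p w \<le> q} \<in> sets M"
    proof (cases "0 \<le> q")
      case True
      show ?thesis by (rule sets_F_M[OF True stop[OF p True]])
    next
      case False
      then have "{w\<in>space M. \<tau> p w \<le> q} = {}" using pos[OF p] by force
      then show ?thesis by (simp only: sets.empty_sets)
    qed
  qed
  have ip: "set_integrable lborel {0<..t} (\<lambda>s. ?q p w s)"
    and ipK: "(LINT s:{0<..t}|lborel. \<bar>?q p w s\<bar>) \<le> K"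
    if p: "p \<in> I" and w: "w \<in> space M" for p w
  proof -
    have m: "(\<lambda>s. indicator {0<..t} s *\<^sub>R (?q p w s)) \<in> borel_measurable lborel"
      using pred_section_indicator[OF rG[OF p] w, of "{0<..t}"] by simp
    have "(\<integral>\<^sup>+s. ennreal (norm (indicator {0<..t} s *\<^sub>R (?q p w s))) \<partial>lborel)
      = (\<integral>\<^sup>+s. indicator {0<..t} s * ennreal (?qa p w s) \<partial>lborel)"
      by (rule nn_integral_cong) (use r(2)[OF p _ w] in \<open>auto simp: indicator_def abs_mult\<close>)
    also have "\<dots> \<le> ennreal K" by (rule K(2)[OF p w])
    finally have le: "(\<integral>\<^sup>+s. ennreal (norm (indicator {0<..t} s *\<^sub>R (?q p w s))) \<partial>lborel) \<le> ennreal K" .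
    show i: "set_integrable lborel {0<..t} (\<lambda>s. ?q p w s)"
      unfolding set_integrable_def
      by (rule integrableI_bounded[OF m]) (use le in \<open>auto intro: le_less_trans\<close>)
    have "(\<integral>\<^sup>+s. ennreal (norm (indicator {0<..t} s *\<^sub>R (?q p w s))) \<partial>lborel)
      = ennreal (LINT s|lborel. norm (indicator {0<..t} s *\<^sub>R (?q p w s)))"
      by (rule nn_integral_eq_integral) (use i in \<open>auto simp: set_integrable_def\<close>)
    with le have "(LINT s|lborel. norm (indicator {0<..t} s *\<^sub>R (?q p w s))) \<le> K"
      using K(1) by simp
    then show "(LINT s:{0<..t}|lborel. \<bar>?q p w s\<bar>) \<le> K"
      by (simp add: set_lebesgue_integral_def abs_mult)
  qed
  have bi: "set_integrable lborel {0<..t} (b w)" if "w \<in> space M" for w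
    unfolding b_def set_integrable_def scaleR_right.sum
    by (rule Bochner_Integration.integrable_sum) (use ip[OF _ that] in \<open>simp add: set_integrable_def\<close>)
  have bK: "(LINT s:{0<..t}|lborel. \<bar>b w s\<bar>) \<le> K * card I" if w: "w \<in> space M" for w
  proof -
    have ia: "set_integrable lborel {0<..t} (\<lambda>s. \<bar>?q p w s\<bar>)" if "p \<in> I" for p
      by (rule set_integrable_abs[OF ip[OF that w]])
    have "(LINT s:{0<..t}|lborel. \<bar>b w s\<bar>) \<le> (LINT s:{0<..t}|lborel. (\<Sum>p\<in>I. \<bar>?q p w s\<bar>))"
      by (rule set_integral_mono[OF set_integrable_abs[OF bi[OF w]]])
        (use ia in \<open>auto simp: b_def set_integrable_def sum_distrib_left sum_abs\<close>)
    also have "\<dots> = (\<Sum>p\<in>I. LINT s:{0<..t}|lborel. \<bar>?q p w s\<bar>)"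
      unfolding set_lebesgue_integral_def scaleR_right.sum
      by (rule Bochner_Integration.integral_sum) (use ia in \<open>auto simp: set_integrable_def\<close>)
    also have "\<dots> \<le> (\<Sum>p\<in>I. K)" by (rule sum_mono) (rule ipK[OF _ w])
    finally show ?thesis by (simp add: mult.commute)
  qed
  have A_alt: "A u w = (\<Sum>p\<in>I. indicator {0<..u} (\<tau> p w) * G p (\<tau> p w, w)) - (LINT s:{0<..u}|lborel. b w s)" for u w
    by (simp add: A_def b_def)
  have A_ad: "A u \<in> borel_measurable (F u)" if u: "0 \<le> u" for u
    unfolding A_def
  proof (intro borel_measurable_diff borel_measurable_sum)
    fix p assume p: "p \<in> I"
    \<comment> \<open>The jump term sees \<open>G p\<close> only at jumps up to \<open>u\<close>, so
      \<tau> may be replaced by its value frozen at \<open>u\<close>, which is known at that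
      time.\<close>
    have m: "(\<lambda>w. min u (\<tau> p w)) \<in> borel_measurable (F u)"
    proof (rule borel_measurableI_le)
      fix q show "{w\<in>space (F u). min u (\<tau> p w) \<le> q} \<in> sets (F u)"
      proof (cases "u \<le> q")
        case True
        then have "{w\<in>space (F u). min u (\<tau> p w) \<le> q} = space (F u)" by auto
        then show ?thesis by simp
      next
        case False
        note uq = False
        show ?thesis
        proof (cases "0 \<le> q")
          case True
          have "{w\<in>space (F u). min u (\<tau> p w) \<le> q} = {w\<in>space M. \<tau> p w \<le> q}" using uq u by auto
          then show ?thesis using sets_F_mono[OF True _ stop[OF p True], of u] uq by simp
        next
          case False
          then have "{w\<in>space (F u). min u (\<tau> p w) \<le> q} = {}" using pos[OF p] u by force
          then show ?thesis by (simp only: sets.empty_sets)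
        qed
      qed
    qed
    have "(\<lambda>w. (min u (\<tau> p w), w)) \<in> measurable (F u) predS"
    proof (rule measurable_stopped[OF u m])
      fix w assume "w \<in> space M"
      from pos[OF p this] u show "0 \<le> min u (\<tau> p w) \<and> min u (\<tau> p w) \<le> u" by auto
    qed
    note mc = measurable_compose[OF this G(1)[OF p]]
    have st: "{w\<in>space (F u). \<tau> p w \<le> u} \<in> sets (F u)" using stop[OF p u] u by simp
    have "(\<lambda>w. indicator {w\<in>space (F u). \<tau> p w \<le> u} w * G p (min u (\<tau> p w), w)) \<in> borel_measurable (F u)"
      using mc st by simp
    also have "?this \<longleftrightarrow> (\<lambda>w. indicator {0<..u} (\<tau> p w) * G p (\<tau> p w, w)) \<in> borel_measurable (F u)"
    proof (rule measurable_cong)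
      fix w assume "w \<in> space (F u)"
      then have w: "w \<in> space M" using u by simp
      show "indicator {w\<in>space (F u). \<tau> p w \<le> u} w * G p (min u (\<tau> p w), w) = indicator {0<..u} (\<tau> p w) * G p (\<tau> p w, w)"
        using pos[OF p w] w u by (cases "\<tau> p w \<le> u") (auto simp: indicator_def)
    qed
    finally show "(\<lambda>w. indicator {0<..u} (\<tau> p w) * G p (\<tau> p w, w)) \<in> borel_measurable (F u)" .
  next
    show "(\<lambda>w. LINT s:{0<..u}|lborel. (\<Sum>p\<in>I. ?q p w s)) \<in> borel_measurable (F u)"
      by (rule integral_adapted[OF u, of "\<lambda>x. \<Sum>p\<in>I. r p x * (exp (G p x) - 1)"])
        (intro borel_measurable_sum rG)
  qed
  have A_M: "A u \<in> borel_measurable M" if "0 \<le> u" for u by (rule measurable_F_M[OF that A_ad[OF that]])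
  then show "A t \<in> borel_measurable M" using t .
  have bint: "\<bar>LINT s:{u<..v}|lborel. b w s\<bar> \<le> K * card I" if w: "w \<in> space M" and uv: "0 \<le> u" "v \<le> t" for u v w
  proof -
    have "\<bar>LINT s:{u<..v}|lborel. b w s\<bar> \<le> (LINT s:{u<..v}|lborel. \<bar>b w s\<bar>)"
      unfolding set_lebesgue_integral_def by (rule order_trans[OF integral_abs_bound]) (simp add: abs_mult)
    also have "\<dots> \<le> (LINT s:{0<..t}|lborel. \<bar>b w s\<bar>)"
    proof -
      have i: "set_integrable lborel {0<..t} (\<lambda>s. \<bar>b w s\<bar>)" by (rule set_integrable_abs[OF bi[OF w]])
      have "set_integrable lborel {u<..v} (\<lambda>s. \<bar>b w s\<bar>)" by (rule set_integrable_subset[OF i]) (use uv in auto)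
      with i show ?thesis unfolding set_lebesgue_integral_def set_integrable_def
        by (intro integral_mono) (use uv in \<open>auto simp: indicator_def\<close>)
    qed
    finally show ?thesis using bK[OF w] by linarith
  qed
  have GB: "\<bar>G p (\<tau> p w, w)\<bar> \<le> max 0 B" if "p \<in> I" "w \<in> space M" for p w
    using G(2)[OF that(1) _ that(2), of "\<tau> p w"] pos[OF that] by auto
  have Ac: "\<bar>A u w\<bar> \<le> c" if w: "w \<in> space M" and u: "0 \<le> u" "u \<le> t" for u w
  proof -
    have "\<bar>\<Sum>p\<in>I. indicator {0<..u} (\<tau> p w) * G p (\<tau> p w, w)\<bar> \<le> (\<Sum>p\<in>I. max 0 B)"
      by (rule order_trans[OF sum_abs sum_mono]) (use GB[OF _ w] in \<open>auto simp: indicator_def\<close>)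
    also have "\<dots> = max 0 B * card I" by simp
    finally show ?thesis using bint[OF w order_refl u(2)] unfolding A_alt c_def by linarith
  qed
  define X where "X u v w = (\<Sum>p\<in>I. indicator {u<..v} (\<tau> p w) * (exp (G p (\<tau> p w, w)) - 1))" for u v w
  define \<beta> where "\<beta> u v w = (LINT s:{u<..v}|lborel. b w s)" for u v w
  have eB: "\<bar>exp (G p (s, w)) - 1\<bar> \<le> exp B + 1" if "p \<in> I" "0 \<le> s" "w \<in> space M" for p s w
  proof -
    have "exp (G p (s, w)) \<le> exp B" "0 < exp (G p (s, w))" using G(2)[OF that] by auto
    then show ?thesis by linarith
  qed
  \<comment> \<open>\<open>exp (A u)\<close> is known at \<open>u\<close>, hence a predictable
    factor on {u<..v}. Multiplied by \<open>exp (G p) - 1\<close> it is an admissible integrand for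
    each jump, whose compensated integral has mean zero.\<close>
  have step: "(LINT w|M. exp (A u w) * (X u v w - \<beta> u v w)) = 0"
    and step_int: "integrable M (\<lambda>w. exp (A u w) * (X u v w - \<beta> u v w))"
    if uv: "0 \<le> u" "u \<le> v" "v \<le> t" for u v
  proof -
    have ut: "u \<le> t" using uv by simp
    note [measurable] = A_M[OF uv(1)]
    let ?L = "\<lambda>p w. indicator {u<..v} (\<tau> p w) * exp (A u w) * (exp (G p (\<tau> p w, w)) - 1)"
    let ?D = "\<lambda>p x. indicator {u<..v} (fst x) * exp (A u (snd x)) * (exp (G p x) - 1)"
    let ?R = "\<lambda>p w. LINT s:{0<..t}|lborel. r p (s, w) * ?D p (s, w)"
    have eA: "exp (A u w) \<le> exp c" if "w \<in> space M" for w using Ac[OF that uv(1) ut] by auto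
    have Dm: "?D p \<in> borel_measurable predS" if p: "p \<in> I" for p
      by (rule borel_measurable_times[OF predictable_step[OF uv(1,2)] Gexp[OF p]]) (use A_ad[OF uv(1)] in auto)
    have Lm: "(\<lambda>w. G p (\<tau> p w, w)) \<in> borel_measurable M" if p: "p \<in> I" for p
      by (rule measurable_compose[OF measurable_stopped_M[OF \<tau>M[OF p]] G(1)[OF p]])
        (use pos[OF p] in \<open>auto intro: less_imp_le\<close>)
    have Lint: "integrable M (?L p)" if p: "p \<in> I" for p
    proof (rule integrable_const_bound[of _ "exp c * (exp B + 1)"])
      show "AE w in M. norm (?L p w) \<le> exp c * (exp B + 1)"
      proof (rule AE_I2)
        fix w assume w: "w \<in> space M"
        have "\<bar>?L p w\<bar> \<le> exp (A u w) * \<bar>exp (G p (\<tau> p w, w)) - 1\<bar>" by (auto simp: indicator_def abs_mult)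
        also have "\<dots> \<le> exp c * (exp B + 1)"
          by (rule mult_mono[OF eA[OF w] eB[OF p _ w]]) (use pos[OF p w] in auto)
        finally show "norm (?L p w) \<le> exp c * (exp B + 1)" by simp
      qed
      show "?L p \<in> borel_measurable M" using Lm[OF p] \<tau>M[OF p] by measurable
    qed
    have eq: "(LINT w|M. ?L p w) = (LINT w|M. ?R p w)" if p: "p \<in> I" for p
    proof -
      have "(LINT w|M. ?L p w) = (LINT w|M. indicator {..t} (\<tau> p w) * ?D p (\<tau> p w, w))"
        by (rule Bochner_Integration.integral_cong) (use uv in \<open>auto simp: indicator_def\<close>)
      also have "\<dots> = (LINT w|M. ?R p w)"
      proof (rule compensator_real[OF \<tau>M[OF p] _ r(1)[OF p] r(2)[OF p] comp[OF p] Dm[OF p], of "exp c * (exp B + 1)" "exp c * K"])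
        show "0 \<le> \<tau> p w" if "w \<in> space M" for w using pos[OF p that] by simp
        show "\<bar>?D p (s, w)\<bar> \<le> exp c * (exp B + 1)" if s: "0 \<le> s" and w: "w \<in> space M" for s w
        proof -
          have "\<bar>?D p (s, w)\<bar> \<le> exp (A u w) * \<bar>exp (G p (s, w)) - 1\<bar>" by (auto simp: indicator_def abs_mult)
          also have "\<dots> \<le> exp c * (exp B + 1)" by (rule mult_mono[OF eA[OF w] eB[OF p s w]]) auto
          finally show ?thesis .
        qed
        show "(\<integral>\<^sup>+s. indicator {0<..t} s * ennreal (r p (s, w) * \<bar>?D p (s, w)\<bar>) \<partial>lborel) \<le> ennreal (exp c * K)"
          if w: "w \<in> space M" for w
        proof -
          have mm: "(\<lambda>s. indicator {0<..t} s * ennreal (?qa p w s)) \<in> borel_measurable lborel"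
            using pred_section_indicator_ennreal[of "\<lambda>x. ennreal (r p x * \<bar>exp (G p x) - 1\<bar>)", OF _ w, of "{0<..t}"] r(1)[OF p] G(1)[OF p]
            by simp
          have "(\<integral>\<^sup>+s. indicator {0<..t} s * ennreal (r p (s, w) * \<bar>?D p (s, w)\<bar>) \<partial>lborel)
            \<le> (\<integral>\<^sup>+s. ennreal (exp c) * (indicator {0<..t} s * ennreal (?qa p w s)) \<partial>lborel)"
          proof (rule nn_integral_mono)
            fix s
            show "indicator {0<..t} s * ennreal (r p (s, w) * \<bar>?D p (s, w)\<bar>)
              \<le> ennreal (exp c) * (indicator {0<..t} s * ennreal (?qa p w s))"
            proof (cases "s \<in> {0<..t}")
              case True
              then have s: "0 \<le> s" by auto
              have "r p (s, w) * \<bar>?D p (s, w)\<bar> \<le> r p (s, w) * (exp (A u w) * \<bar>exp (G p (s, w)) - 1\<bar>)"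
                by (intro mult_left_mono r(2)[OF p s w]) (auto simp: indicator_def abs_mult)
              also have "\<dots> \<le> r p (s, w) * (exp c * \<bar>exp (G p (s, w)) - 1\<bar>)"
                by (intro mult_left_mono mult_right_mono eA[OF w] r(2)[OF p s w]) auto
              also have "\<dots> = exp c * (?qa p w s)" by simp
              finally show ?thesis using True r(2)[OF p s w]
                by (simp add: ennreal_mult'[symmetric] ennreal_leI)
            qed simp
          qed
          also have "\<dots> = ennreal (exp c) * (\<integral>\<^sup>+s. indicator {0<..t} s * ennreal (?qa p w s) \<partial>lborel)"
            by (rule nn_integral_cmult[OF mm])
          also have "\<dots> \<le> ennreal (exp c) * ennreal K" by (intro mult_left_mono K(2)[OF p w]) simp
          also have "\<dots> = ennreal (exp c * K)" using K(1) by (simp add: ennreal_mult')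
          finally show ?thesis .
        qed
      qed (use K(1) in auto)
      finally show ?thesis .
    qed
    have R_alt: "?R p w = exp (A u w) * (LINT s:{u<..v}|lborel. ?q p w s)" for p w
    proof -
      have "?R p w = (LINT s|lborel. exp (A u w) * (indicator {u<..v} s *\<^sub>R (?q p w s)))"
        unfolding set_lebesgue_integral_def
        by (rule Bochner_Integration.integral_cong) (use uv in \<open>auto simp: indicator_def\<close>)
      then show ?thesis by (simp add: set_lebesgue_integral_def)
    qed
    have Rm: "?R p \<in> borel_measurable M" if p: "p \<in> I" for p
      using integral_adapted[OF t borel_measurable_times[OF r(1)[OF p] Dm[OF p]]] measurable_F_M[OF t] by simp
    have Rint: "integrable M (?R p)" if p: "p \<in> I" for p
    proof (rule integrable_const_bound[of _ "exp c * K"])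
      show "AE w in M. norm (?R p w) \<le> exp c * K"
      proof (rule AE_I2)
        fix w assume w: "w \<in> space M"
        have i: "set_integrable lborel {0<..t} (\<lambda>s. \<bar>?q p w s\<bar>)" by (rule set_integrable_abs[OF ip[OF p w]])
        have i2: "set_integrable lborel {u<..v} (\<lambda>s. \<bar>?q p w s\<bar>)" by (rule set_integrable_subset[OF i]) (use uv in auto)
        have "\<bar>LINT s:{u<..v}|lborel. ?q p w s\<bar> \<le> (LINT s:{u<..v}|lborel. \<bar>?q p w s\<bar>)"
          unfolding set_lebesgue_integral_def by (rule order_trans[OF integral_abs_bound]) (simp add: abs_mult)
        also have "\<dots> \<le> (LINT s:{0<..t}|lborel. \<bar>?q p w s\<bar>)"
          using i i2 unfolding set_lebesgue_integral_def set_integrable_def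
          by (intro integral_mono) (use uv in \<open>auto simp: indicator_def\<close>)
        also have "\<dots> \<le> K" by (rule ipK[OF p w])
        finally show "norm (?R p w) \<le> exp c * K"
          unfolding R_alt using eA[OF w] by (auto simp: abs_mult intro!: mult_mono)
      qed
    qed (rule Rm[OF p])
    have \<beta>_sum: "exp (A u w) * \<beta> u v w = (\<Sum>p\<in>I. ?R p w)" if w: "w \<in> space M" for w
    proof -
      have "set_integrable lborel {u<..v} (\<lambda>s. ?q p w s)" if "p \<in> I" for p
        by (rule set_integrable_subset[OF ip[OF that w]]) (use uv in auto)
      then have "\<beta> u v w = (\<Sum>p\<in>I. LINT s:{u<..v}|lborel. ?q p w s)"
        unfolding \<beta>_def b_def set_lebesgue_integral_def scaleR_right.sum
        by (intro Bochner_Integration.integral_sum) (auto simp: set_integrable_def)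
      then show ?thesis unfolding R_alt by (simp add: sum_distrib_left)
    qed
    have X_sum: "exp (A u w) * X u v w = (\<Sum>p\<in>I. ?L p w)" for w
      unfolding X_def by (simp add: sum_distrib_left mult_ac)
    have d: "exp (A u w) * (X u v w - \<beta> u v w) = (\<Sum>p\<in>I. ?L p w) - (\<Sum>p\<in>I. ?R p w)" if "w \<in> space M" for w
      unfolding X_sum[symmetric] \<beta>_sum[OF that, symmetric] by (simp only: right_diff_distrib)
    have sums: "integrable M (\<lambda>w. \<Sum>p\<in>I. ?L p w)" "integrable M (\<lambda>w. \<Sum>p\<in>I. ?R p w)"
      by (rule Bochner_Integration.integrable_sum, erule Lint, rule Bochner_Integration.integrable_sum, erule Rint)
    have "integrable M (\<lambda>w. (\<Sum>p\<in>I. ?L p w) - (\<Sum>p\<in>I. ?R p w))" by (rule Bochner_Integration.integrable_diff[OF sums])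
    then show "integrable M (\<lambda>w. exp (A u w) * (X u v w - \<beta> u v w))"
      by (rule Bochner_Integration.integrable_cong[OF refl d, THEN iffD2, rotated])
    have "(LINT w|M. exp (A u w) * (X u v w - \<beta> u v w)) = (LINT w|M. (\<Sum>p\<in>I. ?L p w) - (\<Sum>p\<in>I. ?R p w))"
      by (rule Bochner_Integration.integral_cong[OF refl d])
    also have "\<dots> = (LINT w|M. (\<Sum>p\<in>I. ?L p w)) - (LINT w|M. (\<Sum>p\<in>I. ?R p w))"
      by (rule Bochner_Integration.integral_diff[OF sums])
    also have "(LINT w|M. (\<Sum>p\<in>I. ?L p w)) = (\<Sum>p\<in>I. LINT w|M. ?L p w)"
      by (rule Bochner_Integration.integral_sum, rule Lint)
    also have "(LINT w|M. (\<Sum>p\<in>I. ?R p w)) = (\<Sum>p\<in>I. LINT w|M. ?R p w)"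
      by (rule Bochner_Integration.integral_sum, rule Rint)
    also have "(\<Sum>p\<in>I. LINT w|M. ?L p w) = (\<Sum>p\<in>I. LINT w|M. ?R p w)" by (rule sum.cong[OF refl eq])
    finally show "(LINT w|M. exp (A u w) * (X u v w - \<beta> u v w)) = 0" by simp
  qed
  define grid where "grid n j = t * real j / real (Suc n)" for n j
  have grid_mono: "grid n i \<le> grid n j" if "i \<le> j" for n i j
    unfolding grid_def using that by (auto intro!: divide_right_mono mult_left_mono t)
  have w0: "grid n 0 = 0" and wl: "grid n (Suc n) = t" for n by (auto simp: grid_def)
  have wb: "0 \<le> grid n j" "grid n j \<le> grid n (Suc j)" "grid n (Suc j) \<le> t" if "j < Suc n" for n j
    using grid_mono[of 0 j n] grid_mono[of "Suc j" "Suc n" n] grid_mono[of j "Suc j" n] that w0[of n] wl[of n] by auto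
  define x where "x u v w = (\<Sum>p\<in>I. indicator {u<..v} (\<tau> p w) * G p (\<tau> p w, w))" for u v w
  have A_diff: "A v w - A u w = x u v w - \<beta> u v w" if w: "w \<in> space M" and uv: "0 \<le> u" "u \<le> v" "v \<le> t" for u v w
  proof -
    have un: "{0<..v} = {0<..u} \<union> {u<..v}" using uv by auto
    have "(LINT s:{0<..v}|lborel. b w s) = (LINT s:{0<..u}|lborel. b w s) + \<beta> u v w"
      unfolding un \<beta>_def by (rule set_integral_Un) (auto intro!: set_integrable_subset[OF bi[OF w]] simp: uv order_trans[OF _ uv(3)] order_trans[OF _ order_trans[OF uv(2,3)]] le_less_trans[OF uv(1)])
    moreover have "indicator {0<..v} y = indicator {0<..u} y + (indicator {u<..v} y :: real)" for y
      using uv by (auto simp: indicator_def)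
    then have "(\<Sum>p\<in>I. indicator {0<..v} (\<tau> p w) * G p (\<tau> p w, w))
      = (\<Sum>p\<in>I. indicator {0<..u} (\<tau> p w) * G p (\<tau> p w, w)) + x u v w"
      unfolding x_def by (simp only: distrib_right sum.distrib)
    ultimately show ?thesis unfolding A_alt by simp
  qed
  have A0: "A 0 w = 0" for w by (simp add: A_def set_lebesgue_integral_def)
  let ?inc = "\<lambda>n w j. exp (A (grid n j) w) * (X (grid n j) (grid n (Suc j)) w - \<beta> (grid n j) (grid n (Suc j)) w)"
  define S where "S n w = exp (A t w) - 1 - (\<Sum>j<Suc n. ?inc n w j)" for n w
  define Rm where "Rm n w = (\<Sum>j<Suc n. \<bar>exp (x (grid n j) (grid n (Suc j)) w - \<beta> (grid n j) (grid n (Suc j)) w) - 1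
     - X (grid n j) (grid n (Suc j)) w + \<beta> (grid n j) (grid n (Suc j)) w\<bar>)" for n w
  have S_le: "\<bar>S n w\<bar> \<le> exp c * Rm n w" if w: "w \<in> space M" for n w
  proof -
    let ?x = "\<lambda>j. x (grid n j) (grid n (Suc j)) w" and ?X = "\<lambda>j. X (grid n j) (grid n (Suc j)) w" and ?b = "\<lambda>j. \<beta> (grid n j) (grid n (Suc j)) w"
    have "exp (A t w) - 1 = (\<Sum>j<Suc n. exp (A (grid n (Suc j)) w) - exp (A (grid n j) w))"
      by (subst sum_lessThan_telescope) (simp add: w0 wl A0)
    also have "\<dots> = (\<Sum>j<Suc n. exp (A (grid n j) w) * (exp (?x j - ?b j) - 1))"
    proof (rule sum.cong[OF refl])
      fix j assume "j \<in> {..<Suc n}"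
      then have j: "j < Suc n" by simp
      have "A (grid n (Suc j)) w = A (grid n j) w + (?x j - ?b j)" using A_diff[OF w wb[OF j]] by simp
      then show "exp (A (grid n (Suc j)) w) - exp (A (grid n j) w) = exp (A (grid n j) w) * (exp (?x j - ?b j) - 1)"
        by (simp add: exp_add right_diff_distrib)
    qed
    finally have "S n w = (\<Sum>j<Suc n. exp (A (grid n j) w) * (exp (?x j - ?b j) - 1 - ?X j + ?b j))"
      unfolding S_def by (simp only: sum_subtractf[symmetric]) (simp only: right_diff_distrib distrib_left diff_diff_eq2 algebra_simps)
    then have "\<bar>S n w\<bar> \<le> (\<Sum>j<Suc n. \<bar>exp (A (grid n j) w) * (exp (?x j - ?b j) - 1 - ?X j + ?b j)\<bar>)" by (simp only: sum_abs)
    also have "\<dots> \<le> (\<Sum>j<Suc n. exp c * \<bar>exp (?x j - ?b j) - 1 - ?X j + ?b j\<bar>)"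
    proof (rule sum_mono)
      fix j assume "j \<in> {..<Suc n}"
      then have j: "j < Suc n" by simp
      have "A (grid n j) w \<le> c" using Ac[OF w, of "grid n j"] wb[OF j] by auto
      then show "\<bar>exp (A (grid n j) w) * (exp (?x j - ?b j) - 1 - ?X j + ?b j)\<bar> \<le> exp c * \<bar>exp (?x j - ?b j) - 1 - ?X j + ?b j\<bar>"
        by (simp add: abs_mult mult_right_mono)
    qed
    also have "\<dots> = exp c * Rm n w" unfolding Rm_def by (rule sum_distrib_left[symmetric])
    finally show ?thesis .
  qed
  have eA_int: "integrable M (\<lambda>w. exp (A t w))"
    by (rule integrable_const_bound[of _ "exp c"]) (use Ac t A_M[OF t] in \<open>auto simp: abs_le_iff\<close>)
  have terms_int: "integrable M (\<lambda>w. \<Sum>j<Suc n. ?inc n w j)" for n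
    by (intro Bochner_Integration.integrable_sum step_int wb) auto
  \<comment> \<open>The grid increments are centred, so the mean of \<open>S n\<close> is the same
    for all \<open>n\<close>; convergence of this constant sequence to 0 will determine it.\<close>
  have S_int: "(LINT w|M. S n w) = (LINT w|M. exp (A t w)) - 1" for n
  proof -
    have "(LINT w|M. S n w) = (LINT w|M. exp (A t w) - 1)
      - (LINT w|M. (\<Sum>j<Suc n. ?inc n w j))"
      unfolding S_def by (rule Bochner_Integration.integral_diff[OF _ terms_int]) (use eA_int in simp)
    also have "(LINT w|M. (\<Sum>j<Suc n. ?inc n w j))
      = (\<Sum>j<Suc n. LINT w|M. ?inc n w j)"
      by (intro Bochner_Integration.integral_sum step_int wb) auto
    also have "\<dots> = 0" by (intro sum.neutral ballI step wb) auto
    finally show ?thesis using eA_int by (simp add: prob_space)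
  qed
  define C where "C = (max 0 B * card I + K * card I) * exp (max 0 B * card I + K * card I) + (exp (max 0 B) + 1) * card I + K * card I"
  have Rm: "(\<lambda>n. Rm n w) \<longlonglongrightarrow> 0" "Rm n w \<le> C"
    if w: "w \<in> space M" and ti: "\<forall>p\<in>I. \<forall>q\<in>I. p \<noteq> q \<longrightarrow> \<tau> p w \<le> t \<longrightarrow> \<tau> p w \<noteq> \<tau> q w" for w n
  proof -
    have ties': "\<And>p q. p \<in> I \<Longrightarrow> q \<in> I \<Longrightarrow> p \<noteq> q \<Longrightarrow> \<tau> p w \<in> {0<..t} \<Longrightarrow> \<tau> p w \<noteq> \<tau> q w" using ti by auto
    note g = grid_remainder[OF I t bi[OF w], of "\<lambda>p. \<tau> p w" "\<lambda>p. G p (\<tau> p w, w)" "max 0 B" "K * card I", OF ties' GB[OF _ w] bK[OF w]]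
    show "(\<lambda>n. Rm n w) \<longlonglongrightarrow> 0" using g(1) unfolding Rm_def x_def X_def \<beta>_def grid_def by simp
    show "Rm n w \<le> C" using g(2)[of n] unfolding Rm_def x_def X_def \<beta>_def grid_def C_def by simp
  qed
  have "(\<lambda>n. LINT w|M. S n w) \<longlonglongrightarrow> (LINT w|M. 0)"
  proof (rule integral_dominated_convergence[where w="\<lambda>_. exp c * C"])
    show "S n \<in> borel_measurable M" for n
      unfolding S_def using borel_measurable_integrable[OF terms_int[of n]] A_M[OF t] by simp
    show "AE w in M. (\<lambda>n. S n w) \<longlonglongrightarrow> 0"
      using ties AE_space
    proof eventually_elim
      case (elim w)
      have "(\<lambda>n. exp c * Rm n w) \<longlonglongrightarrow> 0" using tendsto_mult_left[OF Rm(1)[OF elim(2,1)], of "exp c"] by simp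
      then show ?case by (rule Lim_null_comparison[rotated]) (use S_le[OF elim(2)] in auto)
    qed
    show "AE w in M. norm (S n w) \<le> exp c * C" for n
      using ties AE_space
    proof eventually_elim
      case (elim w)
      have "exp c * Rm n w \<le> exp c * C" using Rm(2)[OF elim(2,1), of n] by simp
      with S_le[OF elim(2), of n] show ?case unfolding real_norm_def by (rule order_trans)
    qed
  qed auto
  then have "(\<lambda>n::nat. (LINT w|M. exp (A t w)) - 1) \<longlonglongrightarrow> 0" by (simp add: S_int)
  then have "(LINT w|M. exp (A t w)) = 1" by (simp add: LIMSEQ_const_iff)
  then show "(\<integral>\<^sup>+w. ennreal (exp (A t w)) \<partial>M) = 1"
    by (subst nn_integral_eq_integral[OF eA_int]) auto
qed

end

section \<open>Several counting processes\<close>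

locale counting_system = filtered_prob_space M F for M :: "'a measure" and F +
  fixes I :: "'i set" and N :: "'i \<Rightarrow> real \<Rightarrow> 'a \<Rightarrow> real" and a :: "'i \<Rightarrow> real \<times> 'a \<Rightarrow> real" and t :: real
  assumes I: "finite I" and comps: "\<And>i. i \<in> I \<Longrightarrow> counting_intensity M F (N i) (a i) t"
    and t: "0 \<le> t"
    and ties: "\<And>i j m l. i \<in> I \<Longrightarrow> j \<in> I \<Longrightarrow> i \<noteq> j \<Longrightarrow> AE w in M.
      jump_time (t + 1) (\<lambda>s. N i s w) (Suc m) \<le> t \<longrightarrow>
      jump_time (t + 1) (\<lambda>s. N i s w) (Suc m) \<noteq> jump_time (t + 1) (\<lambda>s. N j s w) (Suc l)"
begin

definition T :: "'i \<Rightarrow> nat \<Rightarrow> 'a \<Rightarrow> real" where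
  "T i m w = jump_time (t + 1) (\<lambda>s. N i s w) m"

lemma T_eq: "i \<in> I \<Longrightarrow> counting_intensity.T (N i) t m w = T i m w"
  using counting_intensity.T_def[OF comps] by (simp add: T_def)

lemma a_meas: "i \<in> I \<Longrightarrow> a i \<in> borel_measurable predS"
  using counting_intensity.a_meas[OF comps] .

lemma a_nonneg: "i \<in> I \<Longrightarrow> 0 \<le> s \<Longrightarrow> w \<in> space M \<Longrightarrow> 0 \<le> a i (s, w)"
  using counting_intensity.a_nonneg[OF comps] .

section \<open>The total intensity and its truncation\<close>

text \<open>Extended-valued, because the intensities are integrable only almost surely, whereas
  measurability for \<open>F s\<close> and left continuity are wanted for every
  \<open>w\<close>.\<close>

definition \<Lambda> :: "real \<Rightarrow> 'a \<Rightarrow> ennreal" where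
  "\<Lambda> s w = (\<integral>\<^sup>+r. indicator {0<..s} r * (\<Sum>i\<in>I. ennreal (a i (r, w))) \<partial>lborel)"

lemma \<Lambda>_mono: "s \<le> s' \<Longrightarrow> \<Lambda> s w \<le> \<Lambda> s' w"
  unfolding \<Lambda>_def by (rule nn_integral_mono) (auto simp: indicator_def)

text \<open>Left continuity in the form required by \<open>predictable_left_limit_set\<close>. It is
  continuity from below of a measure with Lebesgue density, so it also holds where the total
  intensity becomes infinite.\<close>

lemma \<Lambda>_left:
  assumes s: "0 \<le> s" and w: "w \<in> space M"
  shows "k < \<Lambda> s w \<longleftrightarrow> (\<exists>q\<in>\<rat>. 0 \<le> q \<and> q < s \<and> k < \<Lambda> q w)"
proof
  assume "\<exists>q\<in>\<rat>. 0 \<le> q \<and> q < s \<and> k < \<Lambda> q w"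
  then show "k < \<Lambda> s w" using \<Lambda>_mono by (meson less_imp_le less_le_trans)
next
  assume k: "k < \<Lambda> s w"
  have s0: "0 < s"
  proof (rule ccontr)
    assume "\<not> 0 < s"
    then have "\<Lambda> s w = 0" using s by (simp add: \<Lambda>_def)
    with k show False by simp
  qed
  define \<mu> where "\<mu> = density lborel (\<lambda>r. indicator {0<..s} r * (\<Sum>i\<in>I. ennreal (a i (max 0 r, w))))"
  have m: "(\<lambda>r. indicator {0<..s} r * (\<Sum>i\<in>I. ennreal (a i (max 0 r, w)))) \<in> borel_measurable lborel"
    using pred_section_borel[OF a_meas w] by simp
  have \<mu>: "emeasure \<mu> {0<..q} = \<Lambda> q w" if "q \<le> s" for q
    unfolding \<mu>_def \<Lambda>_def
    by (subst emeasure_density[OF m]) (use that in \<open>auto simp: indicator_def intro!: nn_integral_cong\<close>)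
  define q where "q n = s - s / real (Suc n)" for n
  have q: "0 \<le> q n" "q n < s" for n using s0 by (auto simp: q_def field_simps)
  have inc: "incseq (\<lambda>n. {0<..q n})"
  proof (rule incseq_SucI)
    fix n
    have "s / real (Suc (Suc n)) \<le> s / real (Suc n)" by (rule divide_left_mono) (use s0 in auto)
    then show "{0<..q n} \<subseteq> {0<..q (Suc n)}" unfolding q_def by auto
  qed
  have un: "(\<Union>n. {0<..q n}) = {0<..<s}"
  proof safe
    fix x assume x: "x \<in> {0<..<s}"
    obtain n where "s / (s - x) < real n" using reals_Archimedean2 by blast
    then have "s / (s - x) < real (Suc n)" by simp
    then have "s / real (Suc n) < s - x" using x by (simp add: field_simps)
    then have "x \<in> {0<..q n}" using x by (simp add: q_def)
    then show "x \<in> (\<Union>n. {0<..q n})" by blast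
  next
    fix x n assume "x \<in> {0<..q n}" then show "x \<in> {0<..<s}" using q[of n] by auto
  qed
  have "{s} \<in> null_sets \<mu>"
    unfolding \<mu>_def null_sets_density_iff[OF m]
    by (intro conjI eventually_mono[OF AE_lborel_singleton[of s]]) auto
  then have "emeasure \<mu> ({0<..<s} \<union> {s}) = emeasure \<mu> {0<..<s}"
    by (intro emeasure_Un_null_set) (auto simp: \<mu>_def)
  moreover have "{0<..<s} \<union> {s} = {0<..s}" using s0 by auto
  ultimately have "\<Lambda> s w = emeasure \<mu> (\<Union>n. {0<..q n})" unfolding un using \<mu>[of s] by simp
  also have "\<dots> = (SUP n. emeasure \<mu> {0<..q n})"
    by (rule SUP_emeasure_incseq[symmetric, OF _ inc]) (auto simp: \<mu>_def)
  finally obtain n where n: "k < \<Lambda> (q n) w" using k \<mu> q(2) by (auto simp: less_SUP_iff less_imp_le)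
  obtain r where r: "r \<in> \<rat>" "q n < r" "r < s" using Rats_dense_in_real[OF q(2)] by blast
  have "k < \<Lambda> r w" using n \<Lambda>_mono[of "q n" r] r by (meson less_imp_le less_le_trans)
  then show "\<exists>q\<in>\<rat>. 0 \<le> q \<and> q < s \<and> k < \<Lambda> q w" using r q(1)[of n] by (intro bexI[of _ r]) auto
qed

text \<open>Left continuity of \<open>\<Lambda>\<close> makes this truncation predictable and leaves total intensity
  at most \<open>k\<close>, which is what \<open>exponential_martingale_identity\<close> needs; it is removed by Fatou's lemma.\<close>

definition Cut :: "nat \<Rightarrow> real \<times> 'a \<Rightarrow> real" where
  "Cut k x = (if of_nat k < \<Lambda> (fst x) (snd x) then 0 else 1)"

lemma \<Lambda>_adapted:
  assumes "0 \<le> s" shows "\<Lambda> s \<in> borel_measurable (F s)"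
  unfolding \<Lambda>_def[abs_def]
  by (rule nn_integral_adapted[OF assms, of "\<lambda>x. \<Sum>i\<in>I. ennreal (a i x)"]) (use a_meas in simp)

lemma Cut_meas: "Cut k \<in> borel_measurable predS"
proof -
  have "{x\<in>{0..} \<times> space M. of_nat k < \<Lambda> (fst x) (snd x)} \<in> sets predS"
  proof (rule predictable_left_limit_set[OF _ \<Lambda>_left])
    fix q :: real assume q: "0 \<le> q"
    show "{w\<in>space M. of_nat k < \<Lambda> q w} \<in> sets (F q)"
    proof -
      have "{w\<in>space M. of_nat k < \<Lambda> q w} = \<Lambda> q -` {of_nat k<..} \<inter> space (F q)" using q by auto
      then show ?thesis using measurable_sets[OF \<Lambda>_adapted[OF q], of "{of_nat k<..}"] by simp
    qed
  qed
  then have "{x\<in>space predS. of_nat k < \<Lambda> (fst x) (snd x)} \<in> sets predS" by simp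
  then show ?thesis unfolding Cut_def[abs_def] by (intro measurable_If) auto
qed

text \<open>Let \<sigma> be the last time at which the total intensity is at most \<open>k\<close>.
  Left continuity shows that the bound still holds at \<sigma> itself, and the truncated intensity
  vanishes after it.\<close>

lemma Cut_bound:
  assumes w: "w \<in> space M"
  shows "(\<integral>\<^sup>+s. indicator {0<..t} s * (ennreal (Cut k (s, w)) * (\<Sum>i\<in>I. ennreal (a i (s, w)))) \<partial>lborel) \<le> of_nat k"
proof (cases "{s\<in>{0<..t}. \<Lambda> s w \<le> of_nat k} = {}")
  case True
  have "(\<integral>\<^sup>+s. indicator {0<..t} s * (ennreal (Cut k (s, w)) * (\<Sum>i\<in>I. ennreal (a i (s, w)))) \<partial>lborel) = (\<integral>\<^sup>+s. 0 \<partial>(lborel::real measure))"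
    by (rule nn_integral_cong) (use True in \<open>auto simp: Cut_def indicator_def not_less\<close>)
  then show ?thesis by simp
next
  case False
  let ?S = "{s\<in>{0<..t}. \<Lambda> s w \<le> of_nat k}"
  define \<sigma> where "\<sigma> = Sup ?S"
  have bdd: "bdd_above ?S" by (intro bdd_aboveI[of _ t]) auto
  have S\<sigma>: "s \<le> \<sigma>" if "s \<in> ?S" for s unfolding \<sigma>_def by (rule cSup_upper[OF that bdd])
  have \<sigma>0: "0 \<le> \<sigma>"
  proof -
    obtain s where "s \<in> ?S" using False by blast
    then have "0 < s" "s \<le> \<sigma>" using S\<sigma>[of s] by auto
    then show ?thesis by linarith
  qed
  have "\<not> of_nat k < \<Lambda> \<sigma> w"
  proof
    assume "of_nat k < \<Lambda> \<sigma> w"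
    then obtain q where q: "q < \<sigma>" "of_nat k < \<Lambda> q w" using \<Lambda>_left[OF \<sigma>0 w] by blast
    then obtain s where s: "s \<in> ?S" "q < s" unfolding \<sigma>_def using less_cSup_iff[OF False bdd] by blast
    then have "\<Lambda> q w \<le> of_nat k" using \<Lambda>_mono[of q s w] by auto
    with q show False by auto
  qed
  then have "\<Lambda> \<sigma> w \<le> of_nat k" by simp
  moreover have "(\<integral>\<^sup>+s. indicator {0<..t} s * (ennreal (Cut k (s, w)) * (\<Sum>i\<in>I. ennreal (a i (s, w)))) \<partial>lborel) \<le> \<Lambda> \<sigma> w"
    unfolding \<Lambda>_def[of \<sigma>]
  proof (rule nn_integral_mono)
    fix s
    show "indicator {0<..t} s * (ennreal (Cut k (s, w)) * (\<Sum>i\<in>I. ennreal (a i (s, w))))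
      \<le> indicator {0<..\<sigma>} s * (\<Sum>i\<in>I. ennreal (a i (s, w)))"
    proof (cases "s \<in> ?S")
      case True
      then show ?thesis using S\<sigma>[OF True] by (auto simp: Cut_def indicator_def not_less)
    next
      case False
      then show ?thesis by (auto simp: Cut_def indicator_def)
    qed
  qed
  ultimately show ?thesis by (rule order_trans[rotated])
qed

text \<open>Jumps of one component are separated because its jump times increase strictly up to
  \<open>t\<close>; for two components the exceptional null sets are collected over countably many
  pairs of jump numbers.\<close>

lemma ties_all:
  "AE w in M. \<forall>i\<in>I. \<forall>j\<in>I. \<forall>m l. (i, m) \<noteq> (j, l) \<longrightarrow> T i (Suc m) w \<le> t \<longrightarrow> T i (Suc m) w \<noteq> T j (Suc l) w"
proof -
  have "AE w in M. (i, m) \<noteq> (j, l) \<longrightarrow> T i (Suc m) w \<le> t \<longrightarrow> T i (Suc m) w \<noteq> T j (Suc l) w"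
    if ij: "i \<in> I" "j \<in> I" for i j m l
  proof (cases "i = j")
    case True
    show ?thesis
    proof (rule AE_I2, intro impI notI)
      fix w assume w: "w \<in> space M" and ne: "(i, m) \<noteq> (j, l)" and le: "T i (Suc m) w \<le> t"
        and eq: "T i (Suc m) w = T j (Suc l) w"
      from ne True have "Suc m < Suc l \<or> Suc l < Suc m" by auto
      then show False
        using counting_intensity.T_strict_mono[OF comps[OF ij(1)] w, of "Suc m" "Suc l"]
          counting_intensity.T_strict_mono[OF comps[OF ij(1)] w, of "Suc l" "Suc m"]
          le eq unfolding True[symmetric] T_eq[OF ij(1)] by auto
    qed
  next
    case False
    from ties[OF ij False, of m l] show ?thesis unfolding T_def by eventually_elim auto
  qed
  then have "AE w in M. \<forall>m. \<forall>l. (i, m) \<noteq> (j, l) \<longrightarrow> T i (Suc m) w \<le> t \<longrightarrow> T i (Suc m) w \<noteq> T j (Suc l) w"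
    if ij: "i \<in> I" "j \<in> I" for i j
    using that by (simp add: AE_all_countable)
  then show ?thesis using I by (simp add: AE_finite_all)
qed

lemma \<Lambda>_finite: "AE w in M. \<Lambda> t w < \<infinity>"
proof -
  have "AE w in M. \<forall>i\<in>I. set_integrable lborel {0..t} (\<lambda>s. a i (s, w))"
    using I counting_intensity.a_int[OF comps t] by (simp add: AE_finite_all)
  then show ?thesis using AE_space
  proof eventually_elim
    case (elim w)
    have m: "(\<lambda>r. indicator {0<..t} r * ennreal (a i (r, w))) \<in> borel_measurable lborel" if i: "i \<in> I" for i
      using pred_section_indicator_ennreal[of "\<lambda>x. ennreal (a i x)", OF _ elim(2), of "{0<..t}"] a_meas[OF i] by simp
    have "\<Lambda> t w = (\<Sum>i\<in>I. \<integral>\<^sup>+r. indicator {0<..t} r * ennreal (a i (r, w)) \<partial>lborel)"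
      unfolding \<Lambda>_def sum_distrib_left by (rule nn_integral_sum) (rule m)
    also have "\<dots> < \<infinity>"
    proof -
      have "(\<integral>\<^sup>+r. indicator {0<..t} r * ennreal (a i (r, w)) \<partial>lborel) < \<infinity>" if i: "i \<in> I" for i
      proof -
        have "(\<integral>\<^sup>+r. indicator {0<..t} r * ennreal (a i (r, w)) \<partial>lborel)
          \<le> (\<integral>\<^sup>+r. ennreal (norm (indicator {0..t} r *\<^sub>R a i (r, w))) \<partial>lborel)"
          by (rule nn_integral_mono) (auto simp: indicator_def intro!: ennreal_leI)
        also have "\<dots> < \<infinity>" using elim(1) i unfolding set_integrable_def by (auto simp: integrable_iff_bounded)
        finally show ?thesis .
      qed
      then show ?thesis by (simp add: ennreal_sum_less_top I)
    qed
    finally show ?case .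
  qed
qed

section \<open>The joint exponential of all components\<close>

definition jumps :: "'i \<Rightarrow> 'a \<Rightarrow> nat set" where
  "jumps i w = {m. 1 \<le> m \<and> T i m w \<le> t}"

definition log_exponential :: "('i \<Rightarrow> real \<times> 'a \<Rightarrow> real) \<Rightarrow> 'a \<Rightarrow> real" where
  "log_exponential G w = (\<Sum>i\<in>I. (\<Sum>m\<in>jumps i w. G i (T i m w, w))
     - (LINT s:{0..t}|lborel. (exp (G i (s, w)) - 1) * a i (s, w)))"

text \<open>The bounded case is applied to the single jumps, indexed by component and jump number,
  with both the number of jumps and the intensity truncated at \<open>k\<close>. \<open>L\<close> is
  the lower limit as \<open>k\<close> grows, so Fatou's lemma leaves an inequality. It is a
  measurable version of the exponential, defined without reference to measurability of
  \<open>log_exponential\<close>.\<close>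

theorem exponential_supermartingale:
  assumes G: "\<And>i. i \<in> I \<Longrightarrow> G i \<in> borel_measurable predS"
      "\<And>i s w. i \<in> I \<Longrightarrow> 0 \<le> s \<Longrightarrow> w \<in> space M \<Longrightarrow> \<bar>G i (s, w)\<bar> \<le> B"
  obtains L :: "'a \<Rightarrow> ennreal" where "L \<in> borel_measurable M" "(\<integral>\<^sup>+w. L w \<partial>M) \<le> 1"
    "AE w in M. ennreal (exp (log_exponential G w)) = L w"
proof -
  let ?e = "\<lambda>i w s. (exp (G i (s, w)) - 1) * a i (s, w)"
    and ?ca = "\<lambda>k w s. ennreal (Cut k (s, w)) * (\<Sum>i\<in>I. ennreal (a i (s, w)))"
  define \<tau> where "\<tau> p w = T (fst p) (Suc (snd p)) w" for p :: "'i \<times> nat" and w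
  \<comment> \<open>The intensity of one jump: that of its component, switched on only between the
    previous jump and this one.\<close>
  define r where "r p x = indicator {T (fst p) (snd p) (snd x)<..T (fst p) (Suc (snd p)) (snd x)} (fst x) * a (fst p) x"
    for p :: "'i \<times> nat" and x
  define GC where "GC k p x = Cut k x * G (fst p) x" for k and p :: "'i \<times> nat" and x
  let ?q = "\<lambda>k p w s. r p (s, w) * (exp (GC k p (s, w)) - 1)"
    and ?qa = "\<lambda>k p w s. r p (s, w) * \<bar>exp (GC k p (s, w)) - 1\<bar>"
  \<comment> \<open>The same \<open>k\<close> limits the jump numbers and, through
    \<open>Cut k\<close> inside \<open>GC\<close>, the total intensity.\<close>
  define A where "A k w = (\<Sum>p\<in>I \<times> {..<k}. indicator {0<..t} (\<tau> p w) * GC k p (\<tau> p w, w))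
      - (LINT s:{0<..t}|lborel. (\<Sum>p\<in>I \<times> {..<k}. ?q k p w s))" for k w
  define B' where "B' = max 0 B"
  have Cut01: "Cut k x \<in> {0, 1}" for k x by (auto simp: Cut_def)
  have r_meas: "r p \<in> borel_measurable predS" if p: "fst p \<in> I" for p
  proof -
    note ci = comps[OF p]
    have after: "{x\<in>{0..} \<times> space M. T (fst p) m (snd x) < fst x} \<in> sets predS" for m
      by (rule predictable_after) (use counting_intensity.T_stopping[OF ci] counting_intensity.T_bounds(1)[OF ci] T_eq[OF p] in auto)
    have "{x\<in>{0..} \<times> space M. T (fst p) (snd p) (snd x) < fst x} - {x\<in>{0..} \<times> space M. T (fst p) (Suc (snd p)) (snd x) < fst x} \<in> sets predS"
      using after by auto
    also have "{x\<in>{0..} \<times> space M. T (fst p) (snd p) (snd x) < fst x} - {x\<in>{0..} \<times> space M. T (fst p) (Suc (snd p)) (snd x) < fst x}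
      = {x\<in>space predS. T (fst p) (snd p) (snd x) < fst x \<and> fst x \<le> T (fst p) (Suc (snd p)) (snd x)}" by auto
    finally have "(\<lambda>x. if T (fst p) (snd p) (snd x) < fst x \<and> fst x \<le> T (fst p) (Suc (snd p)) (snd x) then a (fst p) x else 0) \<in> borel_measurable predS"
      using a_meas[OF p] by (intro measurable_If) auto
    also have "(\<lambda>x. if T (fst p) (snd p) (snd x) < fst x \<and> fst x \<le> T (fst p) (Suc (snd p)) (snd x) then a (fst p) x else 0) = r p"
      by (auto simp: r_def fun_eq_iff indicator_def)
    finally show ?thesis .
  qed
  have AE_ties: "AE w in M. \<forall>p\<in>I \<times> {..<k}. \<forall>q\<in>I \<times> {..<k}. p \<noteq> q \<longrightarrow> \<tau> p w \<le> t \<longrightarrow> \<tau> p w \<noteq> \<tau> q w" for k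
    using ties_all by eventually_elim (auto simp: \<tau>_def)
  have GCb: "\<bar>GC k p (s, w)\<bar> \<le> B'" if "p \<in> I \<times> {..<k}" "0 \<le> s" "w \<in> space M" for k p s w
    using G(2)[of "fst p" s w] that Cut01[of k "(s, w)"] by (auto simp: GC_def B'_def)
  \<comment> \<open>The cut multiplies the exponent, but since it takes only the values 0 and 1 it
    also acts as a factor on \<open>exp - 1\<close>.\<close>
  have eGC: "\<bar>exp (GC k p (s, w)) - 1\<bar> \<le> Cut k (s, w) * (exp B' + 1)" if "p \<in> I \<times> {..<k}" "0 \<le> s" "w \<in> space M" for k p s w
  proof (cases "Cut k (s, w) = 0")
    case False
    then have 1: "Cut k (s, w) = 1" using Cut01[of k "(s, w)"] by auto
    have "exp (GC k p (s, w)) \<le> exp B'" "0 < exp (GC k p (s, w))" using GCb[OF that] by auto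
    then show ?thesis unfolding 1 mult_1_left by linarith
  qed (simp add: GC_def)
  have core: "A k \<in> borel_measurable M" "(\<integral>\<^sup>+w. ennreal (exp (A k w)) \<partial>M) = 1" for k
  proof -
    note prem = exponential_martingale_identity[of "I \<times> {..<k}" t \<tau> r "GC k" B' "(exp B' + 1) * real k"]
    have 1: "finite (I \<times> {..<k})" using I by simp
    have 2: "{w\<in>space M. \<tau> p w \<le> q} \<in> sets (F q)" if "p \<in> I \<times> {..<k}" "0 \<le> q" for p q
      using counting_intensity.T_stopping[OF comps, of "fst p" q "Suc (snd p)"] that by (auto simp: T_eq \<tau>_def)
    have 3: "0 < \<tau> p w" if "p \<in> I \<times> {..<k}" "w \<in> space M" for p w
      using counting_intensity.T_pos[OF comps, of "fst p" w "snd p"] that by (auto simp: T_eq \<tau>_def)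
    have 4: "r p \<in> borel_measurable predS" if "p \<in> I \<times> {..<k}" for p using r_meas that by auto
    have 5: "0 \<le> r p (s, w)" if "p \<in> I \<times> {..<k}" "0 \<le> s" "w \<in> space M" for p s w
      using a_nonneg[of "fst p" s w] that by (auto simp: r_def)
    have 6: "(\<integral>\<^sup>+w. indicator {..t} (\<tau> p w) * P (\<tau> p w, w) \<partial>M)
      = (\<integral>\<^sup>+w. \<integral>\<^sup>+s. indicator {0<..t} s * ennreal (r p (s, w)) * P (s, w) \<partial>lborel \<partial>M)"
      if p: "p \<in> I \<times> {..<k}" and P: "P \<in> borel_measurable predS" for p P
    proof -
      have pI: "fst p \<in> I" using p by auto
      note ci = comps[OF pI]
      have "(\<integral>\<^sup>+w. indicator {..t} (\<tau> p w) * P (\<tau> p w, w) \<partial>M)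
        = (\<integral>\<^sup>+w. \<integral>\<^sup>+s. indicator {T (fst p) (snd p) w<..min t (T (fst p) (Suc (snd p)) w)} s * ennreal (a (fst p) (s, w)) * P (s, w) \<partial>lborel \<partial>M)"
        using counting_intensity.compensator_jump[OF ci P, of "snd p"] by (simp add: T_eq[OF pI] \<tau>_def)
      also have "\<dots> = (\<integral>\<^sup>+w. \<integral>\<^sup>+s. indicator {0<..t} s * ennreal (r p (s, w)) * P (s, w) \<partial>lborel \<partial>M)"
      proof (intro nn_integral_cong)
        fix w s
        have "0 \<le> T (fst p) (snd p) w" using counting_intensity.T_bounds(1)[OF ci] T_eq[OF pI] by metis
        then show "indicator {T (fst p) (snd p) w<..min t (T (fst p) (Suc (snd p)) w)} s * ennreal (a (fst p) (s, w)) * P (s, w)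
          = indicator {0<..t} s * ennreal (r p (s, w)) * P (s, w)"
          by (auto simp: r_def indicator_def)
      qed
      finally show ?thesis .
    qed
    have 7: "GC k p \<in> borel_measurable predS" if "p \<in> I \<times> {..<k}" for p
      unfolding GC_def using that G(1) Cut_meas by auto
    have 8: "(\<integral>\<^sup>+s. indicator {0<..t} s * ennreal (?qa k p w s) \<partial>lborel) \<le> ennreal ((exp B' + 1) * real k)"
      if p: "p \<in> I \<times> {..<k}" and w: "w \<in> space M" for p w
    proof -
      have pI: "fst p \<in> I" using p by auto
      have mm: "(\<lambda>s. indicator {0<..t} s * ?ca k w s) \<in> borel_measurable lborel"
        using pred_section_indicator_ennreal[of "\<lambda>x. ennreal (Cut k x) * (\<Sum>i\<in>I. ennreal (a i x))", OF _ w, of "{0<..t}"]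
          a_meas Cut_meas by simp
      have "(\<integral>\<^sup>+s. indicator {0<..t} s * ennreal (?qa k p w s) \<partial>lborel)
        \<le> (\<integral>\<^sup>+s. ennreal (exp B' + 1) * (indicator {0<..t} s * ?ca k w s) \<partial>lborel)"
      proof (rule nn_integral_mono)
        fix s
        show "indicator {0<..t} s * ennreal (?qa k p w s)
          \<le> ennreal (exp B' + 1) * (indicator {0<..t} s * ?ca k w s)"
        proof (cases "s \<in> {0<..t}")
          case True
          then have s: "0 \<le> s" by auto
          have a0: "0 \<le> a (fst p) (s, w)" by (rule a_nonneg[OF pI s w])
          have C0: "0 \<le> Cut k (s, w)" using Cut01[of k "(s, w)"] by auto
          have eB0: "0 \<le> exp B' + 1" by (simp add: add_nonneg_nonneg)
          have "?qa k p w s \<le> a (fst p) (s, w) * (Cut k (s, w) * (exp B' + 1))"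
            by (rule mult_mono[OF _ eGC[OF p s w] a0]) (use a0 in \<open>auto simp: r_def indicator_def\<close>)
          then have "ennreal (?qa k p w s) \<le> ennreal (a (fst p) (s, w) * (Cut k (s, w) * (exp B' + 1)))"
            by (rule ennreal_leI)
          also have "\<dots> = ennreal (exp B' + 1) * (ennreal (Cut k (s, w)) * ennreal (a (fst p) (s, w)))"
            using a0 C0 eB0 by (simp add: ennreal_mult mult_ac)
          also have "\<dots> \<le> ennreal (exp B' + 1) * ?ca k w s"
            by (intro mult_left_mono member_le_sum[OF pI _ I]) auto
          finally show ?thesis using True by simp
        qed simp
      qed
      also have "\<dots> = ennreal (exp B' + 1) * (\<integral>\<^sup>+s. indicator {0<..t} s * ?ca k w s \<partial>lborel)"
        by (rule nn_integral_cmult[OF mm])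
      also have "\<dots> \<le> ennreal (exp B' + 1) * of_nat k" by (intro mult_left_mono Cut_bound[OF w]) simp
      also have "\<dots> = ennreal ((exp B' + 1) * real k)"
        by (simp add: ennreal_of_nat_eq_real_of_nat ennreal_mult add_nonneg_nonneg)
      finally show ?thesis .
    qed
    have 9: "0 \<le> (exp B' + 1) * real k" by (simp add: add_nonneg_nonneg)
    have eq: "(\<Sum>p\<in>I \<times> {..<k}. indicator {0<..t} (\<tau> p w) * GC k p (\<tau> p w, w))
      - (LINT s:{0<..t}|lborel. (\<Sum>p\<in>I \<times> {..<k}. ?q k p w s)) = A k w" for w
      by (simp add: A_def)
    have "(\<lambda>w. (\<Sum>p\<in>I \<times> {..<k}. indicator {0<..t} (\<tau> p w) * GC k p (\<tau> p w, w))
      - (LINT s:{0<..t}|lborel. (\<Sum>p\<in>I \<times> {..<k}. ?q k p w s))) \<in> borel_measurable M"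
      by (rule prem(1)) (rule 1 t 9 AE_ties | (rule 2 3 4 5 6 7 8 GCb; assumption))+
    then show "A k \<in> borel_measurable M" unfolding eq .
    have "(\<integral>\<^sup>+w. ennreal (exp ((\<Sum>p\<in>I \<times> {..<k}. indicator {0<..t} (\<tau> p w) * GC k p (\<tau> p w, w))
      - (LINT s:{0<..t}|lborel. (\<Sum>p\<in>I \<times> {..<k}. ?q k p w s)))) \<partial>M) = 1"
      by (rule prem(2)) (rule 1 t 9 AE_ties | (rule 2 3 4 5 6 7 8 GCb; assumption))+
    then show "(\<integral>\<^sup>+w. ennreal (exp (A k w)) \<partial>M) = 1" unfolding eq .
  qed
  define L where "L w = liminf (\<lambda>k. ennreal (exp (A k w)))" for w
  show thesis
  proof (rule that)
    show "L \<in> borel_measurable M" unfolding L_def using core(1) by measurable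
    have "(\<integral>\<^sup>+w. L w \<partial>M) \<le> liminf (\<lambda>k. \<integral>\<^sup>+w. ennreal (exp (A k w)) \<partial>M)"
      unfolding L_def by (rule nn_integral_liminf) (use core(1) in measurable)
    then show "(\<integral>\<^sup>+w. L w \<partial>M) \<le> 1" by (simp add: core(2) Liminf_const)
    have "AE w in M. \<forall>i\<in>I. set_integrable lborel {0..t} (\<lambda>s. a i (s, w))"
      using I counting_intensity.a_int[OF comps t] by (simp add: AE_finite_all)
    then show "AE w in M. ennreal (exp (log_exponential G w)) = L w"
      using \<Lambda>_finite AE_space
    proof eventually_elim
      case (elim w)
      note w = elim(3)
      obtain k1 :: nat where k1: "\<Lambda> t w \<le> of_nat k1"
        using elim(2) by (metis ennreal_Ex_less_of_nat less_imp_le infinity_ennreal_def)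
      have "\<exists>k. \<forall>i\<in>I. N i t w < real k"
      proof -
        obtain k where "Max (insert 0 ((\<lambda>i. N i t w) ` I)) < real k" using reals_Archimedean2 by blast
        then have "\<forall>i\<in>I. N i t w < real k" using I by (subst (asm) Max_less_iff) auto
        then show ?thesis by blast
      qed
      then obtain k2 where k2: "\<And>i. i \<in> I \<Longrightarrow> N i t w < real k2" by blast
      \<comment> \<open>For such \<open>k\<close> neither truncation is active up to
        \<open>t\<close>: the total intensity at \<open>t\<close> is at most \<open>k\<close>, and
        no component has \<open>k\<close> jumps by then. The interjump intervals then partition
        {0<..t} and their intensities add up to \<open>a i\<close>.\<close>
      have Ak: "A k w = log_exponential G w" if k: "k \<ge> max k1 k2" for k
      proof -
        have C1: "Cut k (s, w) = 1" if "s \<le> t" for s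
        proof -
          have "\<Lambda> s w \<le> of_nat k"
            using \<Lambda>_mono[OF that, of w] k1 k by (meson max.boundedE of_nat_mono order_trans)
          then show ?thesis by (simp add: Cut_def not_less)
        qed
        have Tk: "\<not> T i k w \<le> t" if i: "i \<in> I" for i
          using counting_intensity.T_le_iff[OF comps[OF i] w t order_refl, of k] k2[OF i] k by (simp add: T_eq[OF i])
        have Tpos: "0 < T i (Suc m) w" if i: "i \<in> I" for i m
          using counting_intensity.T_pos[OF comps[OF i] w, of m] by (simp add: T_eq[OF i])
        have Tmono: "mono (\<lambda>m. T i m w)" if i: "i \<in> I" for i
          using counting_intensity.T_mono[OF comps[OF i] w] by (auto simp: T_eq[OF i] mono_def)
        have T0: "T i 0 w = 0" if i: "i \<in> I" for i
          using counting_intensity.T_0[OF comps[OF i] w] by (simp add: T_eq[OF i])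
        have "(\<Sum>p\<in>I \<times> {..<k}. indicator {0<..t} (\<tau> p w) * GC k p (\<tau> p w, w))
          = (\<Sum>i\<in>I. \<Sum>m<k. indicator {0<..t} (T i (Suc m) w) * (Cut k (T i (Suc m) w, w) * G i (T i (Suc m) w, w)))"
          unfolding \<tau>_def GC_def by (simp only: sum.cartesian_product split_def)
        also have "\<dots> = (\<Sum>i\<in>I. \<Sum>m\<in>jumps i w. G i (T i m w, w))"
        proof (rule sum.cong[OF refl])
          fix i assume i: "i \<in> I"
          have lt: "m < k" if "T i m w \<le> t" for m
            using Tk[OF i] monoD[OF Tmono[OF i], of k m] that by (meson leI order_trans)
          have "(\<Sum>m<k. indicator {0<..t} (T i (Suc m) w) * (Cut k (T i (Suc m) w, w) * G i (T i (Suc m) w, w)))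
            = (\<Sum>m\<in>{m. m < k \<and> T i (Suc m) w \<le> t}. G i (T i (Suc m) w, w))"
            by (rule sum.mono_neutral_cong_right) (use Tpos[OF i] C1 in \<open>auto simp: indicator_def\<close>)
          also have "\<dots> = (\<Sum>m\<in>jumps i w. G i (T i m w, w))"
            by (rule sum.reindex_bij_witness[of _ "\<lambda>m. m - 1" Suc]) (use lt less_imp_diff_less[OF lt] in \<open>auto simp: jumps_def Suc_le_eq\<close>)
          finally show "(\<Sum>m<k. indicator {0<..t} (T i (Suc m) w) * (Cut k (T i (Suc m) w, w) * G i (T i (Suc m) w, w)))
            = (\<Sum>m\<in>jumps i w. G i (T i m w, w))" .
        qed
        finally have S: "(\<Sum>p\<in>I \<times> {..<k}. indicator {0<..t} (\<tau> p w) * GC k p (\<tau> p w, w))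
          = (\<Sum>i\<in>I. \<Sum>m\<in>jumps i w. G i (T i m w, w))" .
        have ir: "(\<Sum>p\<in>I \<times> {..<k}. ?q k p w s) = (\<Sum>i\<in>I. ?e i w s)"
          if s: "s \<in> {0<..t}" for s
        proof -
          have "(\<Sum>p\<in>I \<times> {..<k}. ?q k p w s)
            = (\<Sum>i\<in>I. \<Sum>m<k. indicator {T i m w<..T i (Suc m) w} s * a i (s, w) * (exp (Cut k (s, w) * G i (s, w)) - 1))"
            unfolding r_def GC_def by (simp add: sum.cartesian_product split_def)
          also have "\<dots> = (\<Sum>i\<in>I. ?e i w s)"
          proof (rule sum.cong[OF refl])
            fix i assume i: "i \<in> I"
            have "(\<Sum>m<k. indicator {T i m w<..T i (Suc m) w} s * a i (s, w) * (exp (Cut k (s, w) * G i (s, w)) - 1))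
              = (\<Sum>m<k. indicator {T i m w<..T i (Suc m) w} s) * (a i (s, w) * (exp (G i (s, w)) - 1))"
              using C1[of s] s by (simp add: sum_distrib_right mult.assoc)
            also have "(\<Sum>m<k. indicator {T i m w<..T i (Suc m) w} s) = (1::real)"
              using sum_indicator_partition[OF Tmono[OF i], of s k] T0[OF i] Tk[OF i] s by (auto simp: indicator_def)
            finally show "(\<Sum>m<k. indicator {T i m w<..T i (Suc m) w} s * a i (s, w) * (exp (Cut k (s, w) * G i (s, w)) - 1))
              = ?e i w s" by simp
          qed
          finally show ?thesis .
        qed
        have int: "set_integrable lborel {0..t} (\<lambda>s. ?e i w s)" if i: "i \<in> I" for i
          unfolding set_integrable_def
        proof (rule Bochner_Integration.integrable_bound)
          show "integrable lborel (\<lambda>s. (exp B' + 1) * (indicator {0..t} s *\<^sub>R a i (s, w)))"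
            using elim(1) i by (simp add: set_integrable_def)
          show "(\<lambda>s. indicator {0..t} s *\<^sub>R (?e i w s)) \<in> borel_measurable lborel"
          proof -
            have "(\<lambda>x. (exp (G i x) - 1) * a i x) \<in> borel_measurable predS" using G(1)[OF i] a_meas[OF i] by simp
            then have "(\<lambda>s. indicator {0..t} s * ?e i w s) \<in> borel_measurable borel"
              by (rule pred_section_indicator[OF _ w]) auto
            then show ?thesis unfolding real_scaleR_def measurable_lborel2 .
          qed
          show "AE s in lborel. norm (indicator {0..t} s *\<^sub>R (?e i w s))
            \<le> norm ((exp B' + 1) * (indicator {0..t} s *\<^sub>R a i (s, w)))"
          proof (rule AE_I2)
            fix s
            show "norm (indicator {0..t} s *\<^sub>R (?e i w s))
            \<le> norm ((exp B' + 1) * (indicator {0..t} s *\<^sub>R a i (s, w)))"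
            proof (cases "s \<in> {0..t}")
              case True
              then have "\<bar>G i (s, w)\<bar> \<le> B" using G(2)[OF i _ w] by auto
              then have "exp (G i (s, w)) \<le> exp B'" "0 < exp (G i (s, w))" by (auto simp: B'_def)
              then have "\<bar>exp (G i (s, w)) - 1\<bar> \<le> \<bar>exp B' + 1\<bar>" by linarith
              then show ?thesis using True by (simp add: abs_mult mult_right_mono)
            qed simp
          qed
        qed
        have "(LINT s:{0<..t}|lborel. (\<Sum>p\<in>I \<times> {..<k}. ?q k p w s))
          = (LINT s:{0..t}|lborel. (\<Sum>i\<in>I. ?e i w s))"
        proof -
          have "(LINT s:{0<..t}|lborel. (\<Sum>p\<in>I \<times> {..<k}. ?q k p w s))
            = (LINT s:{0<..t}|lborel. (\<Sum>i\<in>I. ?e i w s))"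
            by (rule set_lebesgue_integral_cong) (use ir in auto)
          also have "\<dots> = (LINT s:{0..t}|lborel. (\<Sum>i\<in>I. ?e i w s))"
          proof -
            have i2: "set_integrable lborel {0..t} (\<lambda>s. \<Sum>i\<in>I. ?e i w s)"
              unfolding set_integrable_def scaleR_right.sum
              by (rule Bochner_Integration.integrable_sum) (use int in \<open>simp add: set_integrable_def\<close>)
            have un: "{0..t} = {0} \<union> {0<..t}" using t by auto
            have "(LINT s:{0..t}|lborel. (\<Sum>i\<in>I. ?e i w s))
              = (LINT s:{0}|lborel. (\<Sum>i\<in>I. ?e i w s))
                + (LINT s:{0<..t}|lborel. (\<Sum>i\<in>I. ?e i w s))"
              unfolding un by (rule set_integral_Un) (use t in \<open>auto intro: set_integrable_subset[OF i2]\<close>)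
            moreover have "(LINT s:{0}|lborel. (\<Sum>i\<in>I. ?e i w s)) = 0"
              unfolding set_lebesgue_integral_def
              by (rule integral_eq_zero_AE) (use AE_lborel_singleton[of 0] in \<open>eventually_elim, simp\<close>)
            ultimately show ?thesis by simp
          qed
          finally show ?thesis .
        qed
        also have "\<dots> = (\<Sum>i\<in>I. LINT s:{0..t}|lborel. ?e i w s)"
          unfolding set_lebesgue_integral_def scaleR_right.sum
          by (rule Bochner_Integration.integral_sum) (use int in \<open>simp add: set_integrable_def\<close>)
        finally show ?thesis unfolding A_def S log_exponential_def by (simp add: sum_subtractf)
      qed
      have "(\<lambda>k. ennreal (exp (A k w))) \<longlonglongrightarrow> ennreal (exp (log_exponential G w))"
        by (rule tendsto_eventually, rule eventually_sequentiallyI[of "max k1 k2"]) (simp only: Ak)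
      then show ?case unfolding L_def by (rule lim_imp_Liminf[OF trivial_limit_sequentially, symmetric])
    qed
  qed
qed

end

section \<open>Self-normalized tails and peeling\<close>

text \<open>For \<open>u \<ge> 0\<close> the bound with denominator 2 is already true. For
  \<open>u < 0\<close>, \<open>g\<close> with \<open>z = - u\<close> has derivative
  \<open>z\<^sup>2 / (2 * (1 - z)\<^sup>2)\<close>, which gives the denominator
  \<open>2 * (1 + u)\<close>, and \<open>1 + u \<ge> 1 - c\<close>.\<close>

lemma ln_one_plus_lower_bound:
  fixes u c :: real
  assumes u: "\<bar>u\<bar> \<le> c" and c: "c < 1"
  shows "u - u\<^sup>2 / (2 * (1 - c)) \<le> ln (1 + u)"
proof (cases "0 \<le> u")
  case True
  define g where "g z = ln (1 + z) - z + z\<^sup>2 / 2" for z :: real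
  have "g 0 \<le> g u"
  proof (rule DERIV_nonneg_imp_nondecreasing[OF True])
    fix z assume z: "0 \<le> z" "z \<le> u"
    have "(g has_real_derivative (1 / (1 + z) - 1 + z)) (at z)"
      unfolding g_def using z by (auto intro!: derivative_eq_intros)
    moreover have "1 / (1 + z) - 1 + z = z\<^sup>2 / (1 + z)" using z by (simp add: field_simps power2_eq_square)
    ultimately show "\<exists>y. (g has_real_derivative y) (at z) \<and> 0 \<le> y" using z by (intro exI[of _ "z\<^sup>2 / (1 + z)"]) auto
  qed
  then have "u - u\<^sup>2 / 2 \<le> ln (1 + u)" by (simp add: g_def)
  moreover have "u\<^sup>2 / 2 \<le> u\<^sup>2 / (2 * (1 - c))" by (rule divide_left_mono) (use u c True in auto)
  ultimately show ?thesis by linarith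
next
  case False
  define g where "g z = z + z\<^sup>2 / (2 * (1 - z)) + ln (1 - z)" for z :: real
  have "g 0 \<le> g (- u)"
  proof (rule DERIV_nonneg_imp_nondecreasing[of 0 "- u" g])
    fix z assume z: "0 \<le> z" "z \<le> - u"
    then have z1: "z < 1" using u c by auto
    have "(g has_real_derivative (1 + (2 * z * (2 * (1 - z)) + z\<^sup>2 * 2) / (2 * (1 - z))\<^sup>2 - 1 / (1 - z))) (at z)"
      unfolding g_def using z1 by (auto intro!: derivative_eq_intros simp: power2_eq_square)
    moreover have "1 + (2 * z * (2 * (1 - z)) + z\<^sup>2 * 2) / (2 * (1 - z))\<^sup>2 - 1 / (1 - z) = z\<^sup>2 / (2 * (1 - z)\<^sup>2)"
    proof -
      define d where "d = 1 - z"
      have d: "d \<noteq> 0" "z = 1 - d" using z1 by (auto simp: d_def)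
      show ?thesis unfolding d_def[symmetric] unfolding d(2) using d(1) by (simp add: field_simps power2_eq_square)
    qed
    ultimately show "\<exists>y. (g has_real_derivative y) (at z) \<and> 0 \<le> y" by (intro exI[of _ "z\<^sup>2 / (2 * (1 - z)\<^sup>2)"]) auto
  qed (use False in simp)
  then have "u - u\<^sup>2 / (2 * (1 - (- u))) \<le> ln (1 + u)" by (simp add: g_def)
  moreover have "u\<^sup>2 / (2 * (1 - (- u))) \<le> u\<^sup>2 / (2 * (1 - c))" by (rule divide_left_mono) (use u c False in auto)
  ultimately show ?thesis by linarith
qed

context counting_system
begin

section \<open>Tail bounds for the normalized integrals\<close>

definition W :: "('i \<Rightarrow> real \<times> 'a \<Rightarrow> real) \<Rightarrow> 'a \<Rightarrow> real" where
  "W H w = (\<Sum>i\<in>I. (\<Sum>m\<in>jumps i w. H i (T i m w, w))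
     - (LINT s:{0..t}|lborel. H i (s, w) * a i (s, w)))"

definition Q :: "('i \<Rightarrow> real \<times> 'a \<Rightarrow> real) \<Rightarrow> 'a \<Rightarrow> real" where
  "Q H w = (\<Sum>i\<in>I. \<Sum>m\<in>jumps i w. (H i (T i m w, w))\<^sup>2)"

lemma Q_nonneg: "0 \<le> Q H w"
  unfolding Q_def by (intro sum_nonneg) auto

text \<open>Markov's inequality for the exponential of \<open>G = ln (1 + \<sigma> * l * H)\<close>;
  the sign \<sigma> covers both tails. The measurable cover \<open>A\<close> stands in for the
  event, whose own measurability is not claimed.\<close>

lemma self_normalized_tail:
  assumes H: "\<And>i. i \<in> I \<Longrightarrow> H i \<in> borel_measurable predS"
      "\<And>i s w. i \<in> I \<Longrightarrow> 0 \<le> s \<Longrightarrow> w \<in> space M \<Longrightarrow> \<bar>H i (s, w)\<bar> \<le> 2"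
    and v: "0 < v" and y: "0 < y" and \<sigma>: "\<bar>\<sigma>\<bar> = 1"
  shows "\<exists>A\<in>sets M. {w\<in>space M. Q H w \<le> v \<and> sqrt (2 * v * y) + 2 * y \<le> \<sigma> * W H w} \<subseteq> A \<and> measure M A \<le> exp (- y)"
proof -
  \<comment> \<open>\<open>l\<close> is the optimal parameter of the sub-gamma bound with variance
    factor \<open>v\<close> and scale 2. It satisfies \<open>1 - 2 * l = 1 / (1 + 2 * r)\<close>, so
    that \<open>l\<close> times the threshold minus \<open>c * v\<close> is exactly
    \<open>y\<close>.\<close>
  define r where "r = sqrt (2 * y / v)"
  define l where "l = r / (1 + 2 * r)"
  define c where "c = l\<^sup>2 / (2 * (1 - 2 * l))"
  have r: "0 < r" "r\<^sup>2 * v = 2 * y" using v y by (auto simp: r_def)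
  have l: "0 < l" "2 * l < 1" and l1: "1 - 2 * l = 1 / (1 + 2 * r)" using r by (auto simp: l_def field_simps)
  have sq: "sqrt (2 * v * y) = r * v"
  proof (rule real_sqrt_unique)
    show "(r * v)\<^sup>2 = 2 * v * y" using r(2) by (simp add: power_mult_distrib power2_eq_square mult_ac)
  qed (use r v in auto)
  have opt: "l * (sqrt (2 * v * y) + 2 * y) - c * v = y"
  proof -
    define d where "d = 1 + 2 * r"
    have d: "d \<noteq> 0" using r(1) by (simp add: d_def)
    have "c = r\<^sup>2 / (2 * d)"
    proof -
      have "c = l\<^sup>2 / (2 * (1 / d))" by (simp only: c_def l1 d_def)
      also have "l = r / d" by (simp only: l_def d_def)
      also have "(r / d)\<^sup>2 / (2 * (1 / d)) = r\<^sup>2 / (2 * d)" using d by (simp add: field_simps power2_eq_square)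
      finally show ?thesis .
    qed
    then have "c * v = (r\<^sup>2 * v) / (2 * (1 + 2 * r))" by (simp add: d_def)
    then have "c * v = (2 * y) / (2 * (1 + 2 * r))" by (simp only: r(2))
    then have cv: "c * v = y / (1 + 2 * r)" by (simp only: mult_divide_mult_cancel_left[of 2, OF zero_neq_numeral[symmetric]])
    have "l * (sqrt (2 * v * y) + 2 * y) = (r * (r * v + 2 * y)) / (1 + 2 * r)"
      unfolding sq l_def by (rule times_divide_eq_left)
    also have "r * (r * v + 2 * y) = r\<^sup>2 * v + 2 * y * r" by (simp add: power2_eq_square algebra_simps)
    also have "(r\<^sup>2 * v + 2 * y * r) / (1 + 2 * r) = (2 * y + 2 * y * r) / (1 + 2 * r)" by (simp only: r(2))
    finally have "l * (sqrt (2 * v * y) + 2 * y) - c * v = (2 * y + 2 * y * r - y) / (1 + 2 * r)"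
      by (simp only: cv diff_divide_distrib)
    also have "2 * y + 2 * y * r - y = y * (1 + 2 * r)" by (simp add: algebra_simps)
    finally show ?thesis using r(1) by simp
  qed
  define G where "G i x = ln (1 + \<sigma> * l * H i x)" for i x
  have Gm: "G i \<in> borel_measurable predS" if "i \<in> I" for i
    unfolding G_def using H(1)[OF that] by simp
  have small: "\<bar>\<sigma> * l * H i (s, w)\<bar> \<le> 2 * l" if "i \<in> I" "0 \<le> s" "w \<in> space M" for i s w
    using H(2)[OF that] l \<sigma> by (simp add: abs_mult mult.commute)
  have Gb: "\<bar>G i (s, w)\<bar> \<le> ln (1 + 2 * l) - ln (1 - 2 * l)" if "i \<in> I" "0 \<le> s" "w \<in> space M" for i s w
  proof -
    let ?z = "1 + \<sigma> * l * H i (s, w)"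
    have z: "1 - 2 * l \<le> ?z" "?z \<le> 1 + 2 * l" using small[OF that] by auto
    have "ln (1 - 2 * l) \<le> ln ?z" "ln ?z \<le> ln (1 + 2 * l)" using z l by (auto simp: ln_le_cancel_iff)
    moreover have "ln (1 - 2 * l) \<le> 0" "0 \<le> ln (1 + 2 * l)" using l by auto
    ultimately show ?thesis unfolding G_def by linarith
  qed
  obtain L :: "'a \<Rightarrow> ennreal" where L: "L \<in> borel_measurable M" "(\<integral>\<^sup>+w. L w \<partial>M) \<le> 1"
    "AE w in M. ennreal (exp (log_exponential G w)) = L w"
    using exponential_supermartingale[of G "ln (1 + 2 * l) - ln (1 - 2 * l)", OF Gm Gb] by blast
  obtain N0 where N0sub: "{w\<in>space M. \<not> ennreal (exp (log_exponential G w)) = L w} \<subseteq> N0"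
    and N0': "emeasure M N0 = 0" "N0 \<in> sets M" by (rule AE_E[OF L(3)])
  have N0: "N0 \<in> null_sets M" using N0' by (rule null_setsI)
  \<comment> \<open>Adding the null set where \<open>L\<close> may differ from the exponential turns
    an almost sure inclusion into a true one.\<close>
  define A where "A = {w\<in>space M. ennreal (exp y) \<le> L w} \<union> N0"
  have A1: "{w\<in>space M. ennreal (exp y) \<le> L w} \<in> sets M" using L(1) by measurable
  then have AM: "A \<in> sets M" using N0 by (auto simp: A_def)
  have exponent: "l * (\<sigma> * W H w) - c * Q H w \<le> log_exponential G w" if w: "w \<in> space M" for w
  proof -
    have int: "(LINT s:{0..t}|lborel. (exp (G i (s, w)) - 1) * a i (s, w))
      = l * \<sigma> * (LINT s:{0..t}|lborel. H i (s, w) * a i (s, w))" if i: "i \<in> I" for i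
    proof -
      have "(LINT s:{0..t}|lborel. (exp (G i (s, w)) - 1) * a i (s, w))
        = (LINT s:{0..t}|lborel. (l * \<sigma>) * (H i (s, w) * a i (s, w)))"
      proof (rule set_lebesgue_integral_cong)
        show "\<forall>s. s \<in> {0..t} \<longrightarrow> (exp (G i (s, w)) - 1) * a i (s, w) = (l * \<sigma>) * (H i (s, w) * a i (s, w))"
        proof (intro allI impI)
          fix s assume "s \<in> {0..t}"
          then have "\<bar>\<sigma> * l * H i (s, w)\<bar> \<le> 2 * l" using small[OF i _ w] by auto
          then have "0 < 1 + \<sigma> * l * H i (s, w)" using l by linarith
          then show "(exp (G i (s, w)) - 1) * a i (s, w) = (l * \<sigma>) * (H i (s, w) * a i (s, w))"
            by (simp add: G_def)
        qed
      qed simp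
      then show ?thesis by simp
    qed
    have jumps: "l * \<sigma> * (\<Sum>m\<in>jumps i w. H i (T i m w, w))
       - c * (\<Sum>m\<in>jumps i w. (H i (T i m w, w))\<^sup>2)
      \<le> (\<Sum>m\<in>jumps i w. G i (T i m w, w))" if i: "i \<in> I" for i
    proof -
      have "(\<Sum>m\<in>jumps i w. l * \<sigma> * H i (T i m w, w) - c * (H i (T i m w, w))\<^sup>2)
        \<le> (\<Sum>m\<in>jumps i w. G i (T i m w, w))"
      proof (rule sum_mono)
        fix m
        have "0 \<le> T i m w" using counting_intensity.T_bounds(1)[OF comps[OF i]] T_eq[OF i] by metis
        from ln_one_plus_lower_bound[OF small[OF i this w] l(2)]
        have "\<sigma> * l * H i (T i m w, w) - (\<sigma> * l * H i (T i m w, w))\<^sup>2 / (2 * (1 - 2 * l)) \<le> G i (T i m w, w)"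
          unfolding G_def .
        moreover have "(\<sigma> * l * H i (T i m w, w))\<^sup>2 / (2 * (1 - 2 * l)) = c * (H i (T i m w, w))\<^sup>2"
        proof -
          have "\<sigma>\<^sup>2 = 1" using \<sigma> by (metis power2_abs power_one)
          then show ?thesis by (simp add: c_def power_mult_distrib)
        qed
        ultimately show "l * \<sigma> * H i (T i m w, w) - c * (H i (T i m w, w))\<^sup>2 \<le> G i (T i m w, w)"
          by (simp add: mult.commute[of \<sigma> l])
      qed
      then show ?thesis by (simp add: sum_subtractf sum_distrib_left)
    qed
    have "l * (\<sigma> * W H w) - c * Q H w = (\<Sum>i\<in>I. (l * \<sigma> * (\<Sum>m\<in>jumps i w. H i (T i m w, w))
       - c * (\<Sum>m\<in>jumps i w. (H i (T i m w, w))\<^sup>2))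
       - l * \<sigma> * (LINT s:{0..t}|lborel. H i (s, w) * a i (s, w)))"
    proof -
      have 1: "l * (\<sigma> * W H w) = (\<Sum>i\<in>I. l * \<sigma> * ((\<Sum>m\<in>jumps i w. H i (T i m w, w))
          - (LINT s:{0..t}|lborel. H i (s, w) * a i (s, w))))"
        unfolding W_def mult.assoc[symmetric] by (rule sum_distrib_left)
      have 2: "c * Q H w = (\<Sum>i\<in>I. c * (\<Sum>m\<in>jumps i w. (H i (T i m w, w))\<^sup>2))"
        unfolding Q_def by (rule sum_distrib_left)
      show ?thesis unfolding 1 2 sum_subtractf[symmetric]
        by (rule sum.cong[OF refl]) (simp only: right_diff_distrib diff_right_commute)
    qed
    also have "\<dots> \<le> log_exponential G w"
      unfolding log_exponential_def
    proof (rule sum_mono)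
      fix i assume i: "i \<in> I"
      show "(l * \<sigma> * (\<Sum>m\<in>jumps i w. H i (T i m w, w))
         - c * (\<Sum>m\<in>jumps i w. (H i (T i m w, w))\<^sup>2))
         - l * \<sigma> * (LINT s:{0..t}|lborel. H i (s, w) * a i (s, w))
        \<le> (\<Sum>m\<in>jumps i w. G i (T i m w, w))
         - (LINT s:{0..t}|lborel. (exp (G i (s, w)) - 1) * a i (s, w))"
        unfolding int[OF i] by (rule diff_right_mono[OF jumps[OF i]])
    qed
    finally show ?thesis .
  qed
  have sub: "{w\<in>space M. Q H w \<le> v \<and> sqrt (2 * v * y) + 2 * y \<le> \<sigma> * W H w} \<subseteq> A"
  proof
    fix w assume "w \<in> {w\<in>space M. Q H w \<le> v \<and> sqrt (2 * v * y) + 2 * y \<le> \<sigma> * W H w}"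
    then have w: "w \<in> space M" and q: "Q H w \<le> v" and W: "sqrt (2 * v * y) + 2 * y \<le> \<sigma> * W H w" by auto
    show "w \<in> A"
    proof (cases "w \<in> N0")
      case False
      then have Lw: "ennreal (exp (log_exponential G w)) = L w" using N0sub w by blast
      have c0: "0 \<le> c" using l by (simp add: c_def)
      have "y \<le> l * (\<sigma> * W H w) - c * Q H w"
        using opt mult_left_mono[OF W less_imp_le[OF l(1)]] mult_left_mono[OF q c0] by linarith
      then have "exp y \<le> exp (log_exponential G w)" using exponent[OF w] by simp
      then have "ennreal (exp y) \<le> L w" unfolding Lw[symmetric] by (rule ennreal_leI)
      then show ?thesis using w by (auto simp: A_def)
    qed (simp add: A_def)
  qed
  have "emeasure M A = emeasure M {w\<in>space M. ennreal (exp y) \<le> L w}"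
    unfolding A_def by (rule emeasure_Un_null_set[OF A1 N0])
  moreover have "ennreal (exp y) * emeasure M {w\<in>space M. ennreal (exp y) \<le> L w} \<le> 1"
  proof -
    have "ennreal (exp y) * emeasure M {w\<in>space M. ennreal (exp y) \<le> L w}
      = (\<integral>\<^sup>+w. ennreal (exp y) * indicator {w\<in>space M. ennreal (exp y) \<le> L w} w \<partial>M)"
      using A1 by (simp add: nn_integral_cmult_indicator)
    also have "\<dots> \<le> (\<integral>\<^sup>+w. L w \<partial>M)" by (rule nn_integral_mono) (auto simp: indicator_def)
    finally show ?thesis using L(2) by (rule order_trans)
  qed
  ultimately have "ennreal (exp y) * ennreal (measure M A) \<le> ennreal 1" by (simp add: emeasure_eq_measure)
  then have "exp y * measure M A \<le> 1" by (simp add: ennreal_mult'[symmetric])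
  then have "measure M A \<le> exp (- y)" by (simp add: exp_minus field_simps)
  then show ?thesis using AM sub by blast
qed

text \<open>Only lower bounds on \<open>ell\<close> and \<open>c2\<close> enter, which lets the
  general and the numerical statement share the argument. Slices 0 and 1 cost exp (- x) each and the
  later ones sum to \<open>S\<close>; with both signs this is twice 2 + \<open>S\<close>.\<close>

theorem peeling:
  assumes H: "\<And>i. i \<in> I \<Longrightarrow> H i \<in> borel_measurable predS"
      "\<And>i s w. i \<in> I \<Longrightarrow> 0 \<le> s \<Longrightarrow> w \<in> space M \<Longrightarrow> \<bar>H i (s, w)\<bar> \<le> 2"
    and cl: "1 < cl" and \<epsilon>: "0 < \<epsilon>" and c0: "0 < c0" and x: "0 < x"
    and ell: "\<And>w. 0 \<le> ell w" "\<And>w. cl * ln (ln (max (Q H w / (2 * c0)) (exp 1))) \<le> ell w"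
    and c2: "2 \<le> c2" "2 + sqrt c0 \<le> c2"
  defines "S \<equiv> (ln (1 + \<epsilon>)) powr (- cl) * (\<Sum>j. (real (Suc j)) powr (- cl))"
  shows "\<exists>A\<in>sets M. {w\<in>space M. 2 * sqrt (1 + \<epsilon>) * sqrt ((x + ell w) * Q H w) + c2 * (x + 1 + ell w) \<le> \<bar>W H w\<bar>} \<subseteq> A
    \<and> measure M A \<le> (4 + 2 * S) * exp (- x)"
proof -
  let ?thr = "\<lambda>w. 2 * sqrt (1 + \<epsilon>) * sqrt ((x + ell w) * Q H w) + c2 * (x + 1 + ell w)"
  \<comment> \<open>Geometric slices let the variance factor be compared with \<open>Q\<close> up to
    the factor 1 + \<epsilon>. The base \<open>2 * c0\<close> is the divisor of \<open>Q\<close>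
    inside the iterated logarithm \<open>ell\<close>.\<close>
  define v where "v k = 2 * c0 * (1 + \<epsilon>) ^ k" for k :: nat
  \<comment> \<open>For \<open>k = 1\<close> the logarithm of \<open>0\<close> is \<open>0\<close> in HOL, so \<open>y 1 = x\<close>.\<close>
  define y where "y k = x + (if k = 0 then 0 else max 0 (cl * ln (real (k - 1) * ln (1 + \<epsilon>))))" for k :: nat
  \<comment> \<open>The weight of slice \<open>k\<close>. The index is \<open>k - 1\<close> because
    on this slice \<open>Q\<close> exceeds \<open>v (k - 1)\<close>, so the inner logarithm in
    \<open>ell\<close> is at least \<open>(k - 1) * ln (1 + \<epsilon>)\<close>.\<close>
  define z where "z k = (if k < 2 then 1 else (ln (1 + \<epsilon>)) powr (- cl) * (real (k - 1)) powr (- cl))" for k :: nat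
  have v0: "0 < v k" for k using c0 \<epsilon> by (simp add: v_def)
  have y0: "0 < y k" "x \<le> y k" for k using x by (auto simp: y_def)
  have le0: "0 < ln (1 + \<epsilon>)" using \<epsilon> by simp
  \<comment> \<open>Exponentiating \<open>cl\<close> times the iterated logarithm turns the cost of
    a slice into a power of its index. The \<open>max\<close> with 0 in \<open>y\<close> only lowers
    the left side.\<close>
  have yz: "exp (- y k) \<le> exp (- x) * z k" for k
  proof (cases "k < 2")
    case True
    then show ?thesis using y0(2)[of k] by (simp add: z_def)
  next
    case False
    then have k: "0 < real (k - 1)" by simp
    have "exp (- y k) \<le> exp (- x - cl * ln (real (k - 1) * ln (1 + \<epsilon>)))" using False by (simp add: y_def)
    also have "\<dots> = exp (- x) * (real (k - 1) * ln (1 + \<epsilon>)) powr (- cl)"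
      using k le0 by (simp add: exp_diff powr_def exp_minus field_simps)
    also have "\<dots> = exp (- x) * z k" using False k le0 by (simp add: z_def powr_mult mult.commute)
    finally show ?thesis .
  qed
  have sumz: "summable z" "(\<Sum>k. z k) = 2 + S"
  proof -
    have s0: "summable (\<lambda>j. (real j) powr (- cl))" using cl by (simp add: summable_real_powr_iff)
    then have s: "summable (\<lambda>j. (real (Suc j)) powr (- cl))" by (subst summable_Suc_iff)
    have zs: "z (k + 2) = (ln (1 + \<epsilon>)) powr (- cl) * (real (Suc k)) powr (- cl)" for k by (simp add: z_def)
    have "summable (\<lambda>k. z (k + 2))" unfolding zs by (rule summable_mult[OF s])
    then show sz: "summable z" by (subst (asm) summable_iff_shift)
    have "(\<Sum>k. z k) = (\<Sum>k. z (k + 2)) + (\<Sum>k<2. z k)" by (rule suminf_split_initial_segment[OF sz])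
    also have "(\<Sum>k. z (k + 2)) = (ln (1 + \<epsilon>)) powr (- cl) * (\<Sum>j. (real (Suc j)) powr (- cl))"
      unfolding zs by (rule suminf_mult[OF s])
    also have "(\<Sum>k<2. z k) = 2" by (simp add: z_def numeral_2_eq_2)
    finally show "(\<Sum>k. z k) = 2 + S" by (simp add: S_def)
  qed
  have ex: "\<exists>f. \<forall>k. f k \<in> sets M \<and> {w\<in>space M. Q H w \<le> v k \<and> sqrt (2 * v k * y k) + 2 * y k \<le> \<sigma> * W H w} \<subseteq> f k
      \<and> measure M (f k) \<le> exp (- y k)" if "\<bar>\<sigma>\<bar> = 1" for \<sigma> :: real
    by (rule choice, rule allI, rule self_normalized_tail[unfolded Bex_def, OF H(1) H(2) v0 y0(1) that])
  obtain A1 where "\<forall>k. A1 k \<in> sets M \<and> {w\<in>space M. Q H w \<le> v k \<and> sqrt (2 * v k * y k) + 2 * y k \<le> 1 * W H w} \<subseteq> A1 k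
      \<and> measure M (A1 k) \<le> exp (- y k)"
    using ex[OF abs_one] by blast
  then have A1: "A1 k \<in> sets M" "{w\<in>space M. Q H w \<le> v k \<and> sqrt (2 * v k * y k) + 2 * y k \<le> 1 * W H w} \<subseteq> A1 k"
    "measure M (A1 k) \<le> exp (- y k)" for k by blast+
  obtain A2 where "\<forall>k. A2 k \<in> sets M \<and> {w\<in>space M. Q H w \<le> v k \<and> sqrt (2 * v k * y k) + 2 * y k \<le> -1 * W H w} \<subseteq> A2 k
      \<and> measure M (A2 k) \<le> exp (- y k)"
    using ex[OF abs_neg_one] by blast
  then have A2: "A2 k \<in> sets M" "{w\<in>space M. Q H w \<le> v k \<and> sqrt (2 * v k * y k) + 2 * y k \<le> -1 * W H w} \<subseteq> A2 k"
    "measure M (A2 k) \<le> exp (- y k)" for k by blast+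
  define A where "A = (\<Union>k. A1 k \<union> A2 k)"
  have AM: "A \<in> sets M" using A1(1) A2(1) by (auto simp: A_def)
  have m: "measure M (A1 k \<union> A2 k) \<le> 2 * exp (- x) * z k" for k
  proof -
    have "measure M (A1 k \<union> A2 k) \<le> measure M (A1 k) + measure M (A2 k)" by (rule measure_Un_le[OF A1(1) A2(1)])
    also have "\<dots> \<le> 2 * (exp (- x) * z k)" using A1(3)[of k] A2(3)[of k] yz[of k] by linarith
    finally show ?thesis by simp
  qed
  have sm: "summable (\<lambda>k. measure M (A1 k \<union> A2 k))"
    by (rule summable_comparison_test[OF _ summable_mult[OF sumz(1), of "2 * exp (- x)"]]) (use m in auto)
  have "measure M A \<le> (\<Sum>k. measure M (A1 k \<union> A2 k))"
    unfolding A_def by (rule finite_measure_subadditive_countably[OF _ sm]) (use A1 A2 in auto)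
  also have "\<dots> \<le> (\<Sum>k. 2 * exp (- x) * z k)" by (rule suminf_le[OF m sm summable_mult[OF sumz(1)]])
  also have "\<dots> = 2 * exp (- x) * (\<Sum>k. z k)" by (rule suminf_mult[OF sumz(1)])
  also have "\<dots> = (4 + 2 * S) * exp (- x)"
    unfolding sumz(2) by (simp add: algebra_simps)
  finally have mA: "measure M A \<le> (4 + 2 * S) * exp (- x)" .
  have "{w\<in>space M. ?thr w \<le> \<bar>W H w\<bar>} \<subseteq> A"
  proof (rule subsetI)
    fix w assume "w \<in> {w\<in>space M. ?thr w \<le> \<bar>W H w\<bar>}"
    then have w: "w \<in> space M"
      and big: "?thr w \<le> \<bar>W H w\<bar>" by auto
    note e0 = ell(1)[of w]
    have "\<exists>k. Q H w \<le> v k \<and> sqrt (2 * v k * y k) + 2 * y k \<le> ?thr w"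
    proof (cases "Q H w \<le> 2 * c0")
      case True
      \<comment> \<open>For small \<open>Q\<close> the variance factor cannot be compared with
        \<open>Q\<close>. Its root sqrt (4 c0 x) is absorbed into the linear term, which is where
        the condition \<open>2 + sqrt c0 \<le> c2\<close> comes from.\<close>
      have "2 * sqrt x \<le> x + 1"
      proof -
        have "0 \<le> (sqrt x - 1)\<^sup>2" by simp
        also have "\<dots> = x - 2 * sqrt x + 1" using x by (simp add: power2_diff)
        finally show ?thesis by simp
      qed
      then have "sqrt c0 * (2 * sqrt x) \<le> sqrt c0 * (x + 1)" using c0 by (intro mult_left_mono) auto
      moreover have "sqrt (2 * v 0 * y 0) = sqrt c0 * (2 * sqrt x)"
        by (simp add: v_def y_def real_sqrt_mult)
      moreover have "2 * y 0 \<le> 2 * (x + 1)" by (simp add: y_def)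
      moreover have "(2 + sqrt c0) * (x + 1) \<le> c2 * (x + 1 + ell w)"
        by (rule mult_mono) (use c2 e0 x in auto)
      moreover have "0 \<le> 2 * sqrt (1 + \<epsilon>) * sqrt ((x + ell w) * Q H w)" using \<epsilon> x e0 Q_nonneg by simp
      moreover have "(2 + sqrt c0) * (x + 1) = 2 * (x + 1) + sqrt c0 * (x + 1)" by (simp add: algebra_simps)
      ultimately have "sqrt (2 * v 0 * y 0) + 2 * y 0 \<le> ?thr w"
        by linarith
      then show ?thesis using True by (intro exI[of _ 0]) (simp add: v_def)
    next
      case False
      then have Q0: "2 * c0 < Q H w" by simp
      \<comment> \<open>The least admissible slice: its predecessor fails, so \<open>v k\<close> is
        at most \<open>(1 + \<epsilon>) * Q H w\<close>, and the failure also gives the lower bound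
        on \<open>Q\<close> behind \<open>y k \<le> x + ell w\<close>.\<close>
      define k where "k = (LEAST k. Q H w \<le> v k)"
      obtain k' where "Q H w / (2 * c0) < (1 + \<epsilon>) ^ k'" using real_arch_pow[of "1 + \<epsilon>"] \<epsilon> by auto
      then have "Q H w \<le> v k'" using c0 by (simp add: v_def field_simps)
      then have kv: "Q H w \<le> v k" unfolding k_def by (rule LeastI)
      have "k \<noteq> 0"
      proof
        assume "k = 0"
        then show False using kv Q0 by (simp add: v_def)
      qed
      then obtain j where j: "k = Suc j" by (cases k) auto
      have vj: "v j < Q H w" using not_less_Least[of j "\<lambda>k. Q H w \<le> v k"] j by (simp add: k_def)
      have vk: "v k \<le> (1 + \<epsilon>) * Q H w"
      proof -
        have "v k = (1 + \<epsilon>) * v j" by (simp add: v_def j)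
        also have "\<dots> \<le> (1 + \<epsilon>) * Q H w" using vj \<epsilon> by (intro mult_left_mono) auto
        finally show ?thesis .
      qed
      have yk: "y k \<le> x + ell w"
      proof (cases "j = 0")
        case True
        then show ?thesis using e0 by (simp add: y_def j)
      next
        case jn: False
        have p1: "0 < real j * ln (1 + \<epsilon>)" using jn le0 by simp
        have "(1 + \<epsilon>) ^ j \<le> Q H w / (2 * c0)" using vj c0 by (simp add: v_def field_simps)
        then have "(1 + \<epsilon>) ^ j \<le> max (Q H w / (2 * c0)) (exp 1)" by simp
        then have "ln ((1 + \<epsilon>) ^ j) \<le> ln (max (Q H w / (2 * c0)) (exp 1))" using \<epsilon> by (intro ln_mono) auto
        then have "real j * ln (1 + \<epsilon>) \<le> ln (max (Q H w / (2 * c0)) (exp 1))" using \<epsilon> by (simp add: ln_realpow)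
        then have "ln (real j * ln (1 + \<epsilon>)) \<le> ln (ln (max (Q H w / (2 * c0)) (exp 1)))" using p1 by (intro ln_mono) auto
        then have "cl * ln (real j * ln (1 + \<epsilon>)) \<le> cl * ln (ln (max (Q H w / (2 * c0)) (exp 1)))" using cl by (intro mult_left_mono) auto
        then show ?thesis using ell(2)[of w] e0 by (simp add: y_def j)
      qed
      \<comment> \<open>The factor 2 on the left meets a factor 4 on the right, which is the square
        of the leading 2 in the first constant of the threshold.\<close>
      have "sqrt (2 * v k * y k) \<le> sqrt (4 * (1 + \<epsilon>) * ((x + ell w) * Q H w))"
      proof (rule real_sqrt_le_mono)
        have "v k * y k \<le> ((1 + \<epsilon>) * Q H w) * (x + ell w)"
          by (rule mult_mono[OF vk yk]) (use y0(1)[of k] \<epsilon> Q_nonneg in auto)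
        moreover have "0 \<le> v k * y k" using v0[of k] y0(1)[of k] by simp
        moreover have "2 * v k * y k = 2 * (v k * y k)" by simp
        moreover have "4 * (1 + \<epsilon>) * ((x + ell w) * Q H w) = 4 * (((1 + \<epsilon>) * Q H w) * (x + ell w))"
          by (simp only: mult_ac)
        ultimately show "2 * v k * y k \<le> 4 * (1 + \<epsilon>) * ((x + ell w) * Q H w)" by linarith
      qed
      also have "\<dots> = 2 * sqrt (1 + \<epsilon>) * sqrt ((x + ell w) * Q H w)"
        by (simp only: real_sqrt_mult real_sqrt_four)
      finally have s: "sqrt (2 * v k * y k) \<le> 2 * sqrt (1 + \<epsilon>) * sqrt ((x + ell w) * Q H w)" .
      have "2 * y k \<le> 2 * (x + 1 + ell w)" using yk by simp
      also have "\<dots> \<le> c2 * (x + 1 + ell w)" using c2 x e0 by (intro mult_right_mono) auto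
      finally show ?thesis using kv s by (intro exI[of _ k]) auto
    qed
    then obtain k where k: "Q H w \<le> v k" "sqrt (2 * v k * y k) + 2 * y k \<le> \<bar>W H w\<bar>" using big by (meson order_trans)
    show "w \<in> A"
    proof (cases "0 \<le> W H w")
      case True
      then have "w \<in> A1 k" using A1(2)[of k] k w by auto
      then show ?thesis by (auto simp: A_def)
    next
      case False
      then have "w \<in> A2 k" using A2(2)[of k] k w by auto
      then show ?thesis by (auto simp: A_def)
    qed
  qed
  then show ?thesis using AM mA by blast
qed

end

section \<open>The concentration inequality\<close>

text \<open>Fubini for the product law: each slice of the diagonal is a point without mass for
  \<open>V\<close>. The restriction to values up to \<open>t\<close> matters, because the cap of a
  jump time can be an atom beyond \<open>t\<close>.\<close>

lemma (in prob_space) indep_var_no_ties: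
  fixes U V :: "'a \<Rightarrow> real"
  assumes ind: "indep_var borel U borel V" and V: "\<And>s. s \<le> t \<Longrightarrow> AE w in M. V w \<noteq> s"
  shows "AE w in M. U w \<le> t \<longrightarrow> U w \<noteq> V w"
proof -
  have rv [measurable]: "U \<in> borel_measurable M" "V \<in> borel_measurable M"
    using ind by (auto dest: indep_var_rv1 indep_var_rv2)
  interpret V: prob_space "distr M borel V" by (rule prob_space_distr) (rule rv)
  let ?B = "{z :: real \<times> real. fst z \<le> t \<and> fst z = snd z}"
  have B: "?B \<in> sets (borel \<Otimes>\<^sub>M borel)"
  proof -
    have "Measurable.pred (borel \<Otimes>\<^sub>M borel) (\<lambda>z :: real \<times> real. fst z \<le> t \<and> fst z = snd z)" by measurable
    then show ?thesis by (simp add: pred_def space_pair_measure)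
  qed
  have slice: "emeasure (distr M borel V) (Pair u -` ?B) = 0" for u
  proof (cases "u \<le> t")
    case True
    then have "Pair u -` ?B = {u}" by auto
    moreover have "emeasure (distr M borel V) {u} = emeasure M {w\<in>space M. V w = u}"
      by (subst emeasure_distr) (auto intro!: arg_cong[of _ _ "emeasure M"])
    moreover have "emeasure M {w\<in>space M. V w = u} = 0"
      using V[OF True] by (subst (asm) AE_iff_measurable[OF _ refl]) auto
    ultimately show ?thesis by simp
  qed auto
  have "emeasure (distr M (borel \<Otimes>\<^sub>M borel) (\<lambda>w. (U w, V w))) ?B = emeasure (distr M borel U \<Otimes>\<^sub>M distr M borel V) ?B"
    using ind unfolding indep_var_distribution_eq by simp
  also have "\<dots> = (\<integral>\<^sup>+u. emeasure (distr M borel V) (Pair u -` ?B) \<partial>distr M borel U)"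
    by (rule V.emeasure_pair_measure_alt) (use B in \<open>simp cong: sets_pair_measure_cong\<close>)
  also have "\<dots> = 0" by (simp only: slice nn_integral_const mult_zero_left)
  finally have "emeasure (distr M (borel \<Otimes>\<^sub>M borel) (\<lambda>w. (U w, V w))) ?B = 0" .
  then have "emeasure M ((\<lambda>w. (U w, V w)) -` ?B \<inter> space M) = 0"
    by (subst (asm) emeasure_distr) (use B in auto)
  moreover have "(\<lambda>w. (U w, V w)) -` ?B \<inter> space M \<in> sets M"
    by (rule measurable_sets[OF _ B]) measurable
  ultimately have "(\<lambda>w. (U w, V w)) -` ?B \<inter> space M \<in> null_sets M" by auto
  then have "AE w in M. w \<notin> (\<lambda>w. (U w, V w)) -` ?B \<inter> space M" by (rule AE_not_in)
  then show ?thesis using AE_space by eventually_elim auto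
qed

text \<open>Only countably many coordinates of the path enter here, so this is measurable for the
  product sigma-algebra, unlike \<open>jump_time\<close>; this is what transfers the independence of the
  paths to their jump times.\<close>

definition rational_passage :: "real \<Rightarrow> nat \<Rightarrow> (real \<Rightarrow> real) \<Rightarrow> real" where
  "rational_passage K m f = Inf ({q\<in>\<rat> \<inter> {0..K}. real m \<le> f q} \<union> {K})"

lemma rational_passage_less_iff:
  assumes "0 \<le> K"
  shows "rational_passage K m f < c \<longleftrightarrow> K < c \<or> (\<exists>q\<in>\<rat> \<inter> {0..K}. q < c \<and> real m \<le> f q)"
proof -
  have "bdd_below ({q\<in>\<rat> \<inter> {0..K}. real m \<le> f q} \<union> {K})" by (intro bdd_belowI[of _ 0]) (use assms in auto)
  then show ?thesis unfolding rational_passage_def by (subst cInf_less_iff) auto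
qed

lemma rational_passage_measurable:
  assumes K: "0 \<le> K"
  shows "rational_passage K m \<in> borel_measurable path_space"
proof (rule borel_measurableI_less)
  fix c
  have comp: "(\<lambda>f. f q) \<in> borel_measurable path_space" for q :: real
    unfolding path_space_def by (rule measurable_component_singleton) simp
  have "{f\<in>space path_space. rational_passage K m f < c}
    = (if K < c then space path_space else (\<Union>q\<in>{q\<in>\<rat> \<inter> {0..K}. q < c}. {f\<in>space path_space. real m \<le> f q}))"
    by (auto simp: rational_passage_less_iff[OF K])
  also have "\<dots> \<in> sets path_space"
  proof (cases "K < c")
    case False
    have cnt: "countable {q\<in>\<rat> \<inter> {0..K}. q < c}" by (rule countable_subset[OF _ countable_rat]) auto
    have "{f\<in>space path_space. real m \<le> f q} \<in> sets path_space" for q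
      using comp[of q] by measurable
    then have "(\<Union>q\<in>{q\<in>\<rat> \<inter> {0..K}. q < c}. {f\<in>space path_space. real m \<le> f q}) \<in> sets path_space"
      by (intro sets.countable_UN'[OF cnt]) auto
    then show ?thesis using False by (simp only: if_False)
  qed auto
  finally show "{f\<in>space path_space. rational_passage K m f < c} \<in> sets path_space" .
qed

text \<open>Monotonicity moves any time \<open>s < c\<close> with count at least \<open>m\<close> to
  a slightly later rational below \<open>c\<close>. Thus both infima lie below the same numbers
  \<open>c\<close>, the cap being common to both.\<close>

lemma rational_passage_eq_jump_time:
  assumes f: "counting_path f" and K: "0 < K"
  shows "rational_passage K m f = jump_time K f m"
proof -
  have bdd: "bdd_below ({s\<in>{0..K}. real m \<le> f s} \<union> {K})" by (intro bdd_belowI[of _ 0]) (use K in auto)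
  have j: "jump_time K f m < c \<longleftrightarrow> K < c \<or> (\<exists>s\<in>{0..K}. s < c \<and> real m \<le> f s)" for c
    unfolding jump_time_def by (subst cInf_less_iff[OF _ bdd]) auto
  have "rational_passage K m f < c \<longleftrightarrow> jump_time K f m < c" for c
  proof (cases "K < c")
    case True
    then show ?thesis using j rational_passage_less_iff[of K m f c] K by simp
  next
    case False
    have "\<exists>q\<in>\<rat> \<inter> {0..K}. q < c \<and> real m \<le> f q" if s: "s \<in> {0..K}" "s < c" "real m \<le> f s" for s
    proof -
      obtain q where q: "q \<in> \<rat>" "s < q" "q < c" using Rats_dense_in_real[OF s(2)] by blast
      have "f s \<le> f q" by (rule counting_path_mono[OF f]) (use q s in auto)
      then show ?thesis using q s False by (intro bexI[of _ q]) auto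
    qed
    then show ?thesis unfolding j rational_passage_less_iff[OF less_imp_le[OF K]] by blast
  qed
  then show ?thesis by (meson linorder_neqE not_less_iff_gr_or_eq)
qed

section \<open>Normalization and the final constants\<close>

lemma hnorm_n_upper: "i \<in> {1..n} \<Longrightarrow> \<bar>h (X i w)\<bar> \<le> hnorm_n h n X w"
  unfolding hnorm_n_def by (rule Max_ge) auto

text \<open>A weighted average with nonnegative weights. When all weights vanish, division by 0
  gives the value 0, which satisfies the bound as well.\<close>

lemma hbarY_bound:
  assumes n: "1 \<le> n" and Y: "\<And>i. i \<in> {1..n} \<Longrightarrow> 0 \<le> Y i s w"
  shows "\<bar>hbarY h n X Y s w\<bar> \<le> hnorm_n h n X w"
proof -
  let ?H = "hnorm_n h n X w" and ?S = "\<Sum>i\<in>{1..n}. Y i s w"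
  have H0: "0 \<le> ?H" using hnorm_n_upper[of 1 n h X w] n by (auto intro: order_trans[OF abs_ge_zero])
  have S0: "0 \<le> ?S" by (rule sum_nonneg) (rule Y)
  have "\<bar>\<Sum>i\<in>{1..n}. h (X i w) * Y i s w\<bar> \<le> (\<Sum>i\<in>{1..n}. ?H * Y i s w)"
  proof (rule order_trans[OF sum_abs sum_mono])
    fix i assume i: "i \<in> {1..n}"
    from mult_right_mono[OF hnorm_n_upper[OF i, of h X w] Y[OF i]]
    show "\<bar>h (X i w) * Y i s w\<bar> \<le> ?H * Y i s w" using Y[OF i] by (simp add: abs_mult)
  qed
  also have "\<dots> = ?H * ?S" by (rule sum_distrib_left[symmetric])
  finally have "\<bar>\<Sum>i\<in>{1..n}. h (X i w) * Y i s w\<bar> \<le> ?H * ?S" .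
  then show ?thesis
    unfolding hbarY_def using S0 H0 by (cases "?S = 0") (auto simp: abs_divide divide_le_eq)
qed

text \<open>The cover \<open>A\<close> expresses a bound on the outer probability, without a
  measurability claim for the event. The condition \<open>H \<omega> > 0\<close> excludes the
  degenerate case in which all \<open>h (X i \<omega>)\<close> vanish: there both sides of the
  inequality are 0, so the event would hold trivially.\<close>

theorem theorem3:
  fixes M :: "'a measure" and F :: "real \<Rightarrow> 'a measure"
    and n :: nat
    and X :: "nat \<Rightarrow> 'a \<Rightarrow> real ^ 'd"
    and N Y :: "nat \<Rightarrow> real \<Rightarrow> 'a \<Rightarrow> real"
    and \<alpha>0 :: "real \<Rightarrow> real ^ 'd \<Rightarrow> real"
    and h :: "real ^ 'd \<Rightarrow> real"
    and t :: real
  assumes P: "prob_space M"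
    and UC: "usual_conditions M F"
    and n_pos: "n \<ge> 1"
    and X_F0: "\<And>i. i \<in> {1..n} \<Longrightarrow> X i \<in> borel_measurable (F 0)"
    and Y_pred: "\<And>i. i \<in> {1..n} \<Longrightarrow> predictable M F (Y i)"
    and Y_01: "\<And>i s \<omega>. i \<in> {1..n} \<Longrightarrow> 0 \<le> s \<Longrightarrow> \<omega> \<in> space M \<Longrightarrow> Y i s \<omega> \<in> {0..1}"
    and N_count: "\<And>i. i \<in> {1..n} \<Longrightarrow> counting_process F M (N i)"
    and \<alpha>0_meas: "(\<lambda>(s, z). \<alpha>0 s z) \<in> borel_measurable borel"
    and \<alpha>0_nonneg: "\<And>s z. \<alpha>0 s z \<ge> 0"
    and comp_finite: "\<And>i u. i \<in> {1..n} \<Longrightarrow> 0 \<le> u \<Longrightarrow>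
           AE \<omega> in M. set_integrable lborel {0..u} (\<lambda>s. \<alpha>0 s (X i \<omega>) * Y i s \<omega>)"
    and compensator: "\<And>i. i \<in> {1..n} \<Longrightarrow>
           martingale M F (\<lambda>u \<omega>. N i u \<omega> - (LINT s:{0..u}|lborel. \<alpha>0 s (X i \<omega>) * Y i s \<omega>))"
    and indep: "prob_space.indep_vars M (\<lambda>_. borel \<Otimes>\<^sub>M (path_space \<Otimes>\<^sub>M path_space))
           (\<lambda>i \<omega>. (X i \<omega>, (\<lambda>s. N i s \<omega>), (\<lambda>s. Y i s \<omega>))) {1..n}"
    and ident: "\<And>i. i \<in> {1..n} \<Longrightarrow>
           distr M (borel \<Otimes>\<^sub>M (path_space \<Otimes>\<^sub>M path_space)) (\<lambda>\<omega>. (X i \<omega>, (\<lambda>s. N i s \<omega>), (\<lambda>s. Y i s \<omega>)))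
         = distr M (borel \<Otimes>\<^sub>M (path_space \<Otimes>\<^sub>M path_space)) (\<lambda>\<omega>. (X 1 \<omega>, (\<lambda>s. N 1 s \<omega>), (\<lambda>s. Y 1 s \<omega>)))"
    and h_meas: "h \<in> borel_measurable borel"
    and t_nonneg: "0 \<le> t"
  shows
   "(\<forall>cl \<epsilon> c0 x. cl > 1 \<and> \<epsilon> > 0 \<and> c0 > 0 \<and> exp 1 * c0 > 2 * (4/3 + \<epsilon>) * cl \<and> x > 0 \<longrightarrow>
      (let c1 = 2 * sqrt (1 + \<epsilon>);
           c2 = 2 * sqrt (2 * max c0 (2 * (1 + \<epsilon>) * (4/3 + \<epsilon>))) + 2/3;
           c3 = 8 + 6 * (ln (1 + \<epsilon>)) powr (- cl) * (\<Sum>j. (real (Suc j)) powr (- cl));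
           V = Vhat h n X N Y t;
           H = hnorm_n h n X;
           ell = (\<lambda>\<omega>. cl * ln (ln (max
                  ((2 * exp 1 * real n * V \<omega> + 8 * exp 1 * (4/3 + \<epsilon>) * x * (H \<omega>)\<^sup>2)
                    / (4 * (exp 1 * c0 - 2 * (4/3 + \<epsilon>) * cl) * (H \<omega>)\<^sup>2))
                  (exp 1))))
       in \<exists>A\<in>sets M.
            {\<omega> \<in> space M. H \<omega> > 0 \<and>
               \<bar>Zt \<alpha>0 h n X N Y t \<omega>\<bar> \<ge> c1 * sqrt ((x + ell \<omega>) / real n * V \<omega>)
                                     + c2 * (x + 1 + ell \<omega>) / real n * H \<omega>} \<subseteq> A
            \<and> measure M A \<le> c3 * exp (- x)))
  \<and> (\<forall>x > 0.
      (let c1 = 2 * sqrt 2;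
           c2 = 4 * sqrt (14/3) + 2/3;
           c3 = 28.55;
           V = Vhat h n X N Y t;
           H = hnorm_n h n X;
           ell = (\<lambda>\<omega>. 2 * ln (ln (max
                  ((2 * exp 1 * real n * V \<omega> + 56 * exp 1 * x * (H \<omega>)\<^sup>2 / 3) / (8 * (H \<omega>)\<^sup>2))
                  (exp 1))))
       in \<exists>A\<in>sets M.
            {\<omega> \<in> space M. H \<omega> > 0 \<and>
               \<bar>Zt \<alpha>0 h n X N Y t \<omega>\<bar> \<ge> c1 * sqrt ((x + ell \<omega>) / real n * V \<omega>)
                                     + c2 * (x + 1 + ell \<omega>) / real n * H \<omega>} \<subseteq> A
            \<and> measure M A \<le> c3 * exp (- x)))"
proof -
  interpret prob_space M by (rule P)
  interpret FP: filtered_prob_space M F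
    using UC by unfold_locales (simp add: usual_conditions_def)
  let ?I = "{1..n}"
  define a where "a i z = \<alpha>0 (fst z) (X i (snd z)) * Y i (fst z) (snd z)" for i z
  have a_eq: "a i (s, w) = \<alpha>0 s (X i w) * Y i s w" for i s w by (simp add: a_def)
  let ?P = "predictable_sigma M F"
  have X_pred: "(\<lambda>z. X i (snd z)) \<in> borel_measurable ?P" if "i \<in> ?I" for i
    by (rule measurable_compose[OF FP.measurable_snd_pred X_F0[OF that]])
  have Y_meas: "(\<lambda>z. Y i (fst z) (snd z)) \<in> borel_measurable ?P" if "i \<in> ?I" for i
    using Y_pred[OF that] by (simp add: predictable_def split_def)
  have hX_pred: "(\<lambda>z. h (X i (snd z))) \<in> borel_measurable ?P" if "i \<in> ?I" for i
    by (rule measurable_compose[OF X_pred[OF that] h_meas])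
  have ci: "counting_intensity M F (N i) (a i) t" if i: "i \<in> ?I" for i
  proof unfold_locales
    show "counting_process F M (N i)" by (rule N_count[OF i])
    have "(\<lambda>z. (fst z, X i (snd z))) \<in> measurable ?P (borel \<Otimes>\<^sub>M borel)"
      by (rule measurable_Pair[OF FP.measurable_fst_pred X_pred[OF i]])
    then have "(\<lambda>z. (fst z, X i (snd z))) \<in> measurable ?P borel" by (simp add: borel_prod)
    from measurable_compose[OF this \<alpha>0_meas]
    have "(\<lambda>z. \<alpha>0 (fst z) (X i (snd z))) \<in> borel_measurable ?P" by simp
    then show "a i \<in> borel_measurable ?P" unfolding a_def using Y_meas[OF i] by (rule borel_measurable_times)
    show "0 \<le> a i (s, w)" if "0 \<le> s" "w \<in> space M" for s w
      using Y_01[OF i that] \<alpha>0_nonneg by (simp add: a_eq)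
    show "AE w in M. set_integrable lborel {0..u} (\<lambda>s. a i (s, w))" if "0 \<le> u" for u
      unfolding a_eq by (rule comp_finite[OF i that])
    show "martingale M F (\<lambda>u w. N i u w - (LINT s:{0..u}|lborel. a i (s, w)))"
      unfolding a_eq by (rule compensator[OF i])
  qed (rule t_nonneg)
  have path: "counting_path (\<lambda>s. N i s w)" if "i \<in> ?I" "w \<in> space M" for i w
    by (rule counting_intensity.path[OF ci[OF that(1)] that(2)])
  interpret CS: counting_system M F ?I N a t
  proof (intro counting_system.intro counting_system_axioms.intro FP.filtered_prob_space_axioms)
    show "finite ?I" by simp
    show "counting_intensity M F (N i) (a i) t" if "i \<in> ?I" for i by (rule ci[OF that])
    show "0 \<le> t" by (rule t_nonneg)
    fix i j m l assume i: "i \<in> ?I" and j: "j \<in> ?I" and ij: "i \<noteq> j"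
    have t1: "0 < t + 1" using t_nonneg by simp
    \<comment> \<open>Lets one indexed family carry the jump number \<open>Suc m\<close> for
      component \<open>i\<close> and \<open>Suc l\<close> for component \<open>j\<close>.\<close>
    define f where "f k = (if k = i then Suc m else Suc l)" for k
    define J where "J k w = jump_time (t + 1) (\<lambda>s. N k s w) (f k)" for k w
    have ind1: "indep_vars (\<lambda>_. borel \<Otimes>\<^sub>M (path_space \<Otimes>\<^sub>M path_space))
        (\<lambda>i w. (X i w, (\<lambda>s. N i s w), (\<lambda>s. Y i s w))) {i, j}"
      by (rule indep_vars_subset[OF indep]) (use i j in auto)
    have ind2: "indep_vars (\<lambda>_. borel) (\<lambda>k w. rational_passage (t + 1) (f k) (fst (snd (X k w, (\<lambda>s. N k s w), (\<lambda>s. Y k s w))))) {i, j}"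
    proof (rule indep_vars_compose2[OF ind1])
      fix k
      have [measurable]: "rational_passage (t + 1) (f k) \<in> borel_measurable path_space"
        by (rule rational_passage_measurable) (use t_nonneg in simp)
      show "(\<lambda>z. rational_passage (t + 1) (f k) (fst (snd z))) \<in> borel_measurable (borel \<Otimes>\<^sub>M (path_space \<Otimes>\<^sub>M path_space))"
        by measurable
    qed
    \<comment> \<open>The minimum over the singleton \<open>{j}\<close> converts independence of the
      two-element family into independence of a pair.\<close>
    have "indep_var borel (\<lambda>w. rational_passage (t + 1) (f i) (\<lambda>s. N i s w)) borel
      (\<lambda>w. Min ((\<lambda>k. rational_passage (t + 1) (f k) (\<lambda>s. N k s w)) ` {j}))"
      using indep_vars_Min[of "{j}" i, OF _ _ ind2] ij by simp
    then have ind3: "indep_var borel (\<lambda>w. rational_passage (t + 1) (Suc m) (\<lambda>s. N i s w)) borel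
      (\<lambda>w. rational_passage (t + 1) (Suc l) (\<lambda>s. N j s w))"
      using ij by (simp add: f_def)
    have eq: "rational_passage (t + 1) m' (\<lambda>s. N k s w) = counting_intensity.T (N k) t m' w" if "k \<in> ?I" "w \<in> space M" for k m' w
      unfolding counting_intensity.T_def[OF ci[OF that(1)]]
      by (rule rational_passage_eq_jump_time[OF path[OF that] t1])
    have "AE w in M. rational_passage (t + 1) (Suc m) (\<lambda>s. N i s w) \<le> t \<longrightarrow>
      rational_passage (t + 1) (Suc m) (\<lambda>s. N i s w) \<noteq> rational_passage (t + 1) (Suc l) (\<lambda>s. N j s w)"
    proof (rule indep_var_no_ties[OF ind3])
      fix s assume s: "s \<le> t"
      show "AE w in M. rational_passage (t + 1) (Suc l) (\<lambda>s. N j s w) \<noteq> s"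
      proof (cases "0 \<le> s")
        case True
        from counting_intensity.no_atoms[OF ci[OF j] True s, of l] AE_space show ?thesis
          by eventually_elim (simp add: eq[OF j])
      next
        case False
        show ?thesis
        proof (rule AE_I2)
          fix w assume "w \<in> space M"
          from eq[OF j this, of "Suc l"] counting_intensity.T_bounds(1)[OF ci[OF j], of "Suc l" w] False
          show "rational_passage (t + 1) (Suc l) (\<lambda>s. N j s w) \<noteq> s" by auto
        qed
      qed
    qed
    then show "AE w in M. jump_time (t + 1) (\<lambda>s. N i s w) (Suc m) \<le> t \<longrightarrow>
      jump_time (t + 1) (\<lambda>s. N i s w) (Suc m) \<noteq> jump_time (t + 1) (\<lambda>s. N j s w) (Suc l)"
      using AE_space
      by eventually_elim (simp add: rational_passage_eq_jump_time[OF path[OF i] t1] rational_passage_eq_jump_time[OF path[OF j] t1])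
  qed
  let ?hn = "hnorm_n h n X" and ?V = "Vhat h n X N Y t" and ?Z = "Zt \<alpha>0 h n X N Y t"
  define g where "g i z = h (X i (snd z)) - hbarY h n X Y (fst z) (snd z)" for i z
  \<comment> \<open>The norm is known at time 0, so dividing by it preserves predictability. Where
    it vanishes, division by 0 makes \<open>H\<close> zero, and the bound 2 holds
    everywhere.\<close>
  define H where "H i z = g i z / ?hn (snd z)" for i z
  have g_meas: "g i \<in> borel_measurable ?P" if i: "i \<in> ?I" for i
    unfolding g_def hbarY_def by (intro borel_measurable_diff borel_measurable_divide borel_measurable_sum borel_measurable_times hX_pred Y_meas i)
  have H_meas: "H i \<in> borel_measurable ?P" if i: "i \<in> ?I" for i
    unfolding H_def hnorm_n_def
    by (intro borel_measurable_divide g_meas i borel_measurable_Max borel_measurable_abs hX_pred) auto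
  have H_bound: "\<bar>H i (s, w)\<bar> \<le> 2" if i: "i \<in> ?I" and s: "0 \<le> s" and w: "w \<in> space M" for i s w
  proof (cases "?hn w = 0")
    case False
    have "\<bar>h (X i w)\<bar> \<le> ?hn w" by (rule hnorm_n_upper[OF i])
    moreover have "\<bar>hbarY h n X Y s w\<bar> \<le> ?hn w" by (rule hbarY_bound[OF n_pos]) (use Y_01 s w in auto)
    ultimately have "\<bar>g i (s, w)\<bar> \<le> 2 * ?hn w" "0 \<le> ?hn w" unfolding g_def by auto
    then show ?thesis using False by (simp add: H_def abs_divide divide_le_eq)
  qed (simp add: H_def)
  have np: "0 < real n" using n_pos by simp
  have cp: "cp_integral (\<lambda>s. N i s w) q t = (\<Sum>m\<in>CS.jumps i w. q (CS.T i m w))"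
    if i: "i \<in> ?I" and w: "w \<in> space M" and q: "(\<lambda>s. q (max 0 s)) \<in> borel_measurable borel" for i w q
  proof -
    obtain k where k: "N i t w = real k" using counting_path_nat[OF path[OF i w] t_nonneg] by auto
    have "set_borel_measurable borel {0<..t} q"
    proof -
      have "(\<lambda>s. indicator {0<..t} s *\<^sub>R q (max 0 s)) \<in> borel_measurable borel" using q by simp
      also have "(\<lambda>s. indicator {0<..t} s *\<^sub>R q (max 0 s)) = (\<lambda>s. indicator {0<..t} s *\<^sub>R q s)" by (auto simp: indicator_def)
      finally show ?thesis by (simp add: set_borel_measurable_def)
    qed
    then have "cp_integral (\<lambda>s. N i s w) q t = (\<Sum>m\<in>{1..k}. q (jump_time (t + 1) (\<lambda>s. N i s w) m))"
      by (intro cp_integral_jump_times[OF path[OF i w] t_nonneg _ k]) auto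
    also have "\<dots> = (\<Sum>m\<in>CS.jumps i w. q (CS.T i m w))"
    proof (rule sum.cong)
      have "jump_time (t + 1) (\<lambda>s. N i s w) m \<le> t \<longleftrightarrow> m \<le> k" for m
        using jump_time_le_iff[OF path[OF i w] t_nonneg, of "t + 1" m] k by simp
      then have le: "CS.T i m w \<le> t \<longleftrightarrow> m \<le> k" for m unfolding CS.T_def .
      show "{1..k} = CS.jumps i w" unfolding CS.jumps_def le by auto
      show "q (jump_time (t + 1) (\<lambda>s. N i s w) m) = q (CS.T i m w)" for m unfolding CS.T_def ..
    qed
    finally show ?thesis .
  qed
  have W_eq: "real n * ?Z w = ?hn w * CS.W H w" and Q_eq: "real n * ?V w = (?hn w)\<^sup>2 * CS.Q H w"
    if w: "w \<in> space M" and hn: "0 < ?hn w" for w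
  proof -
    have gH: "g i (s, w) = ?hn w * H i (s, w)" for i s using hn by (simp add: H_def)
    have gsec: "(\<lambda>s. h (X i w) - hbarY h n X Y (max 0 s) w) \<in> borel_measurable borel" if i: "i \<in> ?I" for i
      using FP.pred_section_borel[OF g_meas[OF i] w] by (simp add: g_def)
    have gs: "h (X i w) - hbarY h n X Y s w = ?hn w * H i (s, w)" for i s
      using gH[of i s] by (simp add: g_def)
    have "real n * ?Z w = (\<Sum>i\<in>?I. cp_integral (\<lambda>s. N i s w) (\<lambda>s. h (X i w) - hbarY h n X Y s w) t
      - (LINT s:{0..t}|lborel. (h (X i w) - hbarY h n X Y s w) * (\<alpha>0 s (X i w) * Y i s w)))"
      using np by (simp add: Zt_def)
    also have "\<dots> = (\<Sum>i\<in>?I. ?hn w * ((\<Sum>m\<in>CS.jumps i w. H i (CS.T i m w, w))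
      - (LINT s:{0..t}|lborel. H i (s, w) * a i (s, w))))"
    proof (rule sum.cong[OF refl])
      fix i assume i: "i \<in> ?I"
      have "(LINT s:{0..t}|lborel. (h (X i w) - hbarY h n X Y s w) * (\<alpha>0 s (X i w) * Y i s w))
        = (LINT s:{0..t}|lborel. ?hn w * (H i (s, w) * a i (s, w)))"
        unfolding gs a_eq mult.assoc ..
      then show "cp_integral (\<lambda>s. N i s w) (\<lambda>s. h (X i w) - hbarY h n X Y s w) t
        - (LINT s:{0..t}|lborel. (h (X i w) - hbarY h n X Y s w) * (\<alpha>0 s (X i w) * Y i s w))
        = ?hn w * ((\<Sum>m\<in>CS.jumps i w. H i (CS.T i m w, w))
        - (LINT s:{0..t}|lborel. H i (s, w) * a i (s, w)))"
        unfolding cp[OF i w gsec[OF i]] by (simp add: gs sum_distrib_left right_diff_distrib)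
    qed
    also have "\<dots> = ?hn w * CS.W H w" unfolding CS.W_def by (rule sum_distrib_left[symmetric])
    finally show "real n * ?Z w = ?hn w * CS.W H w" .
    have "real n * ?V w = (\<Sum>i\<in>?I. cp_integral (\<lambda>s. N i s w) (\<lambda>s. (h (X i w) - hbarY h n X Y s w)\<^sup>2) t)"
      using np by (simp add: Vhat_def)
    also have "\<dots> = (\<Sum>i\<in>?I. (?hn w)\<^sup>2 * (\<Sum>m\<in>CS.jumps i w. (H i (CS.T i m w, w))\<^sup>2))"
    proof (rule sum.cong[OF refl])
      fix i assume i: "i \<in> ?I"
      have "(\<lambda>s. (h (X i w) - hbarY h n X Y (max 0 s) w)\<^sup>2) \<in> borel_measurable borel" using gsec[OF i] by simp
      from cp[OF i w this]
      show "cp_integral (\<lambda>s. N i s w) (\<lambda>s. (h (X i w) - hbarY h n X Y s w)\<^sup>2) t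
        = (?hn w)\<^sup>2 * (\<Sum>m\<in>CS.jumps i w. (H i (CS.T i m w, w))\<^sup>2)"
        by (simp add: gs sum_distrib_left power_mult_distrib)
    qed
    also have "\<dots> = (?hn w)\<^sup>2 * CS.Q H w" unfolding CS.Q_def by (rule sum_distrib_left[symmetric])
    finally show "real n * ?V w = (?hn w)\<^sup>2 * CS.Q H w" .
  qed
  let ?S = "\<lambda>cl \<epsilon>. (ln (1 + \<epsilon>)) powr (- cl) * (\<Sum>j. (real (Suc j)) powr (- cl)) :: real"
    and ?bad = "\<lambda>\<epsilon> ell c2 x. {w\<in>space M. ?hn w > 0 \<and> \<bar>?Z w\<bar> \<ge> 2 * sqrt (1 + \<epsilon>) * sqrt ((x + ell w) / real n * ?V w)
        + c2 * (x + 1 + ell w) / real n * ?hn w}"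
  \<comment> \<open>\<open>peeling\<close> rescaled to the noise process, with \<open>ell\<close>
    and \<open>c2\<close> still abstract so that both halves of the theorem are instances.\<close>
  have main: "\<exists>A\<in>sets M. ?bad \<epsilon> ell c2 x \<subseteq> A
      \<and> measure M A \<le> (4 + 2 * ?S cl \<epsilon>) * exp (- x)"
    if c: "1 < cl" "0 < \<epsilon>" "0 < c0" "0 < x" and c2: "2 \<le> c2" "2 + sqrt c0 \<le> c2"
      and ell0: "\<And>w. w \<in> space M \<Longrightarrow> ?hn w > 0 \<Longrightarrow> 0 \<le> ell w"
      and ell: "\<And>w. w \<in> space M \<Longrightarrow> ?hn w > 0 \<Longrightarrow>
        cl * ln (ln (max (real n * ?V w / (?hn w)\<^sup>2 / (2 * c0)) (exp 1))) \<le> ell w"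
    for cl \<epsilon> c0 x c2 :: real and ell
  proof -
    \<comment> \<open>\<open>peeling\<close> wants its conditions on \<open>ell\<close> at every
      point; where the norm vanishes, \<open>ell\<close> is replaced by the smallest admissible
      value.\<close>
    define ell' where "ell' w = (if w \<in> space M \<and> ?hn w > 0 then ell w
      else cl * ln (ln (max (CS.Q H w / (2 * c0)) (exp 1))))" for w
    have lnln: "0 \<le> ln (ln (max y (exp 1)))" for y :: real
    proof -
      have "ln (exp 1) \<le> ln (max y (exp 1))" by (intro ln_mono) auto
      then show ?thesis by (intro ln_ge_zero) simp
    qed
    have 1: "0 \<le> ell' w" for w using ell0[of w] lnln c(1) by (auto simp: ell'_def)
    have 2: "cl * ln (ln (max (CS.Q H w / (2 * c0)) (exp 1))) \<le> ell' w" for w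
    proof (cases "w \<in> space M \<and> ?hn w > 0")
      case True
      then have "real n * ?V w / (?hn w)\<^sup>2 = CS.Q H w" using Q_eq[of w] by simp
      then show ?thesis using ell[of w] True by (simp add: ell'_def)
    qed (auto simp: ell'_def)
    obtain A where A: "A \<in> sets M"
      "{w\<in>space M. 2 * sqrt (1 + \<epsilon>) * sqrt ((x + ell' w) * CS.Q H w) + c2 * (x + 1 + ell' w) \<le> \<bar>CS.W H w\<bar>} \<subseteq> A"
      "measure M A \<le> (4 + 2 * ?S cl \<epsilon>) * exp (- x)"
      using CS.peeling[of H cl \<epsilon> c0 x ell' c2, OF H_meas H_bound c 1 2 c2] by blast
    have "?bad \<epsilon> ell c2 x \<subseteq> A"
    proof (rule subsetI)
      fix w assume "w \<in> ?bad \<epsilon> ell c2 x"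
      then have w: "w \<in> space M" and hn: "0 < ?hn w" and big: "2 * sqrt (1 + \<epsilon>) * sqrt ((x + ell w) / real n * ?V w)
        + c2 * (x + 1 + ell w) / real n * ?hn w \<le> \<bar>?Z w\<bar>" by auto
      have e: "ell' w = ell w" using w hn by (simp add: ell'_def)
      \<comment> \<open>The scale between the two normalizations: the noise process is
        \<open>q\<close> times \<open>W\<close>, and the term under the root is \<open>q\<close>
        squared times its counterpart for \<open>Q\<close>.\<close>
      define q where "q = ?hn w / real n"
      have q: "0 < q" using hn np by (simp add: q_def)
      have Z: "?Z w = q * CS.W H w" using W_eq[OF w hn] np by (simp add: q_def field_simps)
      have V: "?V w / real n = q\<^sup>2 * CS.Q H w" using Q_eq[OF w hn] np by (simp add: q_def field_simps power2_eq_square)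
      have "(x + ell w) / real n * ?V w = q\<^sup>2 * ((x + ell w) * CS.Q H w)"
      proof -
        have "(x + ell w) / real n * ?V w = (x + ell w) * (?V w / real n)" by simp
        then show ?thesis unfolding V by (simp only: mult_ac)
      qed
      then have s: "sqrt ((x + ell w) / real n * ?V w) = q * sqrt ((x + ell w) * CS.Q H w)"
        using q by (simp add: real_sqrt_mult)
      have "q * (2 * sqrt (1 + \<epsilon>) * sqrt ((x + ell w) * CS.Q H w) + c2 * (x + 1 + ell w))
        = 2 * sqrt (1 + \<epsilon>) * (q * sqrt ((x + ell w) * CS.Q H w)) + c2 * (x + 1 + ell w) / real n * ?hn w"
      proof -
        have "q * (2 * sqrt (1 + \<epsilon>) * sqrt ((x + ell w) * CS.Q H w)) = 2 * sqrt (1 + \<epsilon>) * (q * sqrt ((x + ell w) * CS.Q H w))"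
          by (simp only: mult_ac)
        moreover have "q * (c2 * (x + 1 + ell w)) = c2 * (x + 1 + ell w) / real n * ?hn w" by (simp add: q_def)
        ultimately show ?thesis by (simp only: distrib_left)
      qed
      also have "\<dots> \<le> q * \<bar>CS.W H w\<bar>" using big q unfolding s Z by (simp add: abs_mult)
      finally have "2 * sqrt (1 + \<epsilon>) * sqrt ((x + ell w) * CS.Q H w) + c2 * (x + 1 + ell w) \<le> \<bar>CS.W H w\<bar>"
        using q by simp
      then show "w \<in> A" using A(2) w by (auto simp: e)
    qed
    then show ?thesis using A by blast
  qed
  have V0: "0 \<le> real n * ?V w / (?hn w)\<^sup>2" if "w \<in> space M" "?hn w > 0" for w
    using Q_eq[OF that] CS.Q_nonneg[of H w] that by simp
  have ell_nonneg: "0 \<le> cl * ln (ln (max y (exp 1)))" if "1 < cl" for cl y :: real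
  proof -
    have "ln (exp 1) \<le> ln (max y (exp 1))" by (intro ln_mono) auto
    then have "0 \<le> ln (ln (max y (exp 1)))" by (intro ln_ge_zero) simp
    then show ?thesis using that by simp
  qed
  have ell_mono: "cl * ln (ln (max y (exp 1))) \<le> cl * ln (ln (max y' (exp 1)))" if "1 < cl" "y \<le> y'" for cl y y' :: real
  proof -
    have "0 < max y (exp 1)" by (simp add: less_max_iff_disj)
    then have "ln (max y (exp 1)) \<le> ln (max y' (exp 1))" using that by (intro ln_mono) auto
    moreover have "0 < ln (max y (exp 1))"
    proof -
      have "ln (exp 1) \<le> ln (max y (exp 1))" by (intro ln_mono) auto
      then show ?thesis by simp
    qed
    ultimately have "ln (ln (max y (exp 1))) \<le> ln (ln (max y' (exp 1)))" by (subst ln_le_cancel_iff) linarith+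
    then show ?thesis using that by simp
  qed
  show ?thesis
  proof (unfold Let_def, intro conjI allI impI, goal_cases)
    case (1 cl \<epsilon> c0 x)
    then have c: "1 < cl" "0 < \<epsilon>" "0 < c0" "2 * (4/3 + \<epsilon>) * cl < exp 1 * c0" "0 < x" by auto
    let ?c2 = "2 * sqrt (2 * max c0 (2 * (1 + \<epsilon>) * (4/3 + \<epsilon>))) + 2/3"
    let ?D = "exp 1 * c0 - 2 * (4/3 + \<epsilon>) * cl"
    let ?ell = "\<lambda>w. cl * ln (ln (max
                ((2 * exp 1 * real n * ?V w + 8 * exp 1 * (4/3 + \<epsilon>) * x * (?hn w)\<^sup>2)
                  / (4 * ?D * (?hn w)\<^sup>2))
                (exp 1)))"
    \<comment> \<open>Since \<open>2 * (1 + \<epsilon>) * (4/3 + \<epsilon>)\<close> is at least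
      8/3, the root in \<open>?c2\<close> is at least 2; it is also at least \<open>sqrt c0\<close>,
      and it occurs twice.\<close>
    have c2: "2 \<le> ?c2" "2 + sqrt c0 \<le> ?c2"
    proof -
      let ?m = "max c0 (2 * (1 + \<epsilon>) * (4/3 + \<epsilon>))"
      have "2 * (1 * (4/3)) \<le> 2 * ((1 + \<epsilon>) * (4/3 + \<epsilon>))" by (intro mult_left_mono mult_mono) (use c in auto)
      then have "2 \<le> 2 * (1 + \<epsilon>) * (4/3 + \<epsilon>)" unfolding mult.assoc by simp
      then have "2 \<le> ?m" by (rule max.coboundedI2)
      then have "sqrt (2\<^sup>2) \<le> sqrt (2 * ?m)" by (intro real_sqrt_le_mono) simp
      then have 1: "2 \<le> sqrt (2 * ?m)" by simp
      have "sqrt c0 \<le> sqrt (2 * ?m)" by (intro real_sqrt_le_mono) (use c(3) in \<open>auto simp: max_def\<close>)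
      with 1 show "2 \<le> ?c2" "2 + sqrt c0 \<le> ?c2" by linarith+
    qed
    have "\<exists>A\<in>sets M. ?bad \<epsilon> ?ell ?c2 x \<subseteq> A
      \<and> measure M A \<le> (4 + 2 * ?S cl \<epsilon>) * exp (- x)"
    proof (rule main[OF c(1,2,3,5) c2])
      show "0 \<le> ?ell w" for w by (rule ell_nonneg[OF c(1)])
      fix w assume w: "w \<in> space M" and hn: "0 < ?hn w"
      show "cl * ln (ln (max (real n * ?V w / (?hn w)\<^sup>2 / (2 * c0)) (exp 1))) \<le> ?ell w"
      proof (rule ell_mono[OF c(1)])
        define q where "q = real n * ?V w / (?hn w)\<^sup>2"
        have q0: "0 \<le> q" unfolding q_def by (rule V0[OF w hn])
        have D: "0 < ?D" using c by simp
        have pos: "0 \<le> 2 * (4/3 + \<epsilon>) * cl" using c by simp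
        \<comment> \<open>The stated argument of the iterated logarithm arises from
          \<open>q / (2 * c0)\<close> by multiplying through with 2 e, shrinking the denominator to
          \<open>?D\<close> and adding a nonnegative term in \<open>x\<close>; each of the last two
          changes only increases it.\<close>
        have "q / (2 * c0) = (2 * exp 1 * q) / (4 * (exp 1 * c0))" using c(3) by (simp add: field_simps)
        also have "\<dots> \<le> (2 * exp 1 * q) / (4 * ?D)"
          by (rule divide_left_mono) (use q0 D c pos in auto)
        also have "\<dots> \<le> (2 * exp 1 * q + 8 * exp 1 * (4/3 + \<epsilon>) * x) / (4 * ?D)"
          by (rule divide_right_mono) (use D c in auto)
        also have "\<dots> = (2 * exp 1 * real n * ?V w + 8 * exp 1 * (4/3 + \<epsilon>) * x * (?hn w)\<^sup>2) / (4 * ?D * (?hn w)\<^sup>2)"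
        proof -
          define s where "s = (?hn w)\<^sup>2"
          define d where "d = ?D"
          have "s \<noteq> 0" "d \<noteq> 0" using hn D by (auto simp: s_def d_def)
          then show ?thesis unfolding q_def s_def[symmetric] d_def[symmetric] by (simp add: field_simps)
        qed
        finally show "real n * ?V w / (?hn w)\<^sup>2 / (2 * c0) \<le> \<dots>" unfolding q_def .
      qed
    qed
    \<comment> \<open>The series term is nonnegative, so the stated constant dominates the one
      obtained by peeling.\<close>
    moreover have "(4 + 2 * ?S cl \<epsilon>) * exp (- x)
      \<le> (8 + 6 * (ln (1 + \<epsilon>)) powr (- cl) * (\<Sum>j. (real (Suc j)) powr (- cl))) * exp (- x)"
    proof -
      have "summable (\<lambda>j. (real (Suc j)) powr (- cl))"
        by (subst summable_Suc_iff[of "\<lambda>j. (real j) powr (- cl)"]) (use c(1) in \<open>simp add: summable_real_powr_iff\<close>)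
      then have "0 \<le> ?S cl \<epsilon>" by (intro mult_nonneg_nonneg suminf_nonneg) auto
      then have "4 + 2 * ?S cl \<epsilon> \<le> 8 + 6 * ?S cl \<epsilon>" by simp
      then show ?thesis by (simp add: mult.assoc)
    qed
    ultimately show ?case by (elim bexE conjE) (intro bexI conjI; (assumption | erule order_trans))
  next
    case (2 x)
    then have x: "0 < x" .
    \<comment> \<open>The denominator \<open>8\<close> makes \<open>?ell\<close> large enough to use \<open>main\<close> with \<open>c0 = 1\<close>, for which its
      side conditions on \<open>c2\<close> are immediate.\<close>
    let ?c2 = "4 * sqrt (14/3) + 2/3 :: real"
    let ?ell = "\<lambda>w. 2 * ln (ln (max
                ((2 * exp 1 * real n * ?V w + 56 * exp 1 * x * (?hn w)\<^sup>2 / 3) / (8 * (?hn w)\<^sup>2))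
                (exp 1)))"
    have "1 \<le> sqrt (14/3 :: real)" by (rule real_le_rsqrt) simp
    then have c2: "2 \<le> ?c2" "2 + sqrt 1 \<le> ?c2" unfolding real_sqrt_one by linarith+
    have "\<exists>A\<in>sets M. ?bad 1 ?ell ?c2 x \<subseteq> A
      \<and> measure M A \<le> (4 + 2 * ?S 2 1) * exp (- x)"
    proof (rule main[OF _ _ _ x c2])
      show "0 \<le> ?ell w" for w by (rule ell_nonneg) simp
      fix w assume w: "w \<in> space M" and hn: "0 < ?hn w"
      show "2 * ln (ln (max (real n * ?V w / (?hn w)\<^sup>2 / (2 * 1)) (exp 1))) \<le> ?ell w"
      proof (rule ell_mono)
        define q where "q = real n * ?V w / (?hn w)\<^sup>2"
        have q0: "0 \<le> q" unfolding q_def by (rule V0[OF w hn])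
        have e2: "2 \<le> exp (1::real)" using exp_ge_add_one_self[of 1] by simp
        \<comment> \<open>The coefficient 2 e / 8 of \<open>q\<close> in \<open>?ell\<close> is at
          least 1/2 because e is at least 2.\<close>
        have "q / (2 * 1) = (2 * 2 * q) / 8" by simp
        also have "\<dots> \<le> (2 * exp 1 * q) / 8"
          using mult_right_mono[OF e2 q0] by (simp add: mult.commute)
        also have "\<dots> \<le> (2 * exp 1 * q + 56 * exp 1 * x / 3) / 8" using x by simp
        also have "\<dots> = (2 * exp 1 * real n * ?V w + 56 * exp 1 * x * (?hn w)\<^sup>2 / 3) / (8 * (?hn w)\<^sup>2)"
        proof -
          define s where "s = (?hn w)\<^sup>2"
          have "s \<noteq> 0" using hn by (auto simp: s_def)
          then show ?thesis unfolding q_def s_def[symmetric] by (simp add: field_simps)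
        qed
        finally show "real n * ?V w / (?hn w)\<^sup>2 / (2 * 1) \<le> \<dots>" unfolding q_def .
      qed simp
    qed simp_all
    \<comment> \<open>Rough bounds suffice: the series is pi squared over 6, at most 8/3 by pi < 4,
      and ln 2 at least 2/3 bounds the prefactor by 9/4. Together they give 4 + 2 * 6 = 16.\<close>
    moreover have "(4 + 2 * ?S 2 1) * exp (- x) \<le> 28.55 * exp (- x)"
    proof (rule mult_right_mono)
      have e: "(\<lambda>j. (real (Suc j)) powr (- 2)) = (\<lambda>j. 1 / (real j + 1)\<^sup>2)"
        by (auto simp: fun_eq_iff powr_minus powr_numeral inverse_eq_divide add.commute)
      have "(\<lambda>j. (real (Suc j)) powr (- 2)) sums (pi\<^sup>2 / 6)"
        unfolding e using inverse_squares_sums by (simp add: add.commute)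
      then have Seq: "(\<Sum>j. (real (Suc j)) powr (- 2)) = pi\<^sup>2 / 6" by (rule sums_unique[symmetric])
      have S0: "0 \<le> (\<Sum>j. (real (Suc j)) powr (- 2))" unfolding Seq by simp
      have "pi\<^sup>2 / 6 \<le> 4\<^sup>2 / 6" using pi_less_4 pi_gt_zero by (intro divide_right_mono power_mono) auto
      then have S: "(\<Sum>j. (real (Suc j)) powr (- 2)) \<le> 8 / 3" unfolding Seq by simp
      have "(2/3 :: real) \<le> ln 2" using ln2_ge_two_thirds .
      then have "(2/3)\<^sup>2 \<le> (ln 2 :: real)\<^sup>2" by (intro power_mono) auto
      then have "inverse ((ln 2)\<^sup>2) \<le> inverse ((2/3 :: real)\<^sup>2)" by (intro le_imp_inverse_le) auto
      moreover have "(ln (1 + 1 :: real)) powr (- 2) = inverse ((ln 2)\<^sup>2)" by (simp add: powr_minus powr_numeral)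
      ultimately have L: "(ln (1 + 1 :: real)) powr (- 2) \<le> 9 / 4" by (simp add: power2_eq_square)
      have "(ln (1 + 1 :: real)) powr (- 2) * (\<Sum>j. (real (Suc j)) powr (- 2)) \<le> 9 / 4 * (8 / 3)"
        by (rule mult_mono[OF L S _ S0]) simp
      then show "4 + 2 * ?S 2 1 \<le> (28.55::real)" by simp
    qed simp
    ultimately show ?case
      unfolding one_add_one by (elim bexE conjE) (intro bexI conjI; (assumption | erule order_trans))
  qed
qed

end
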